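(* Let $M>0$. There exist constants $C,C_1,C_2>0$ depending only on $M$ such that the following holds for all positive integers $n,p,s,r$ with $2s\le p$ and $r\le C_2$, every $\lambda\in(0,M]$ and every $\epsilon\in[0,1/5)$. Let $\hat\Gamma$ be any maximizer of $\mathcal{D}_{\mathcal{U}_s}(\Gamma,\{X_i\}_{i=1}^n)$ over $\Gamma\in\mathcal{F}_s$, and let $\hat V\in O(p,r)$ be the matrix whose $l$th column is the $l$th eigenvector of $\hat\Gamma$ (eigenvalues in decreasing order), $l=1,\dots,r$. Then for any $\delta\in(0,1/2)$ satisfying $$C_1\left(\left(\frac{s\log\frac{ep}{s}}{n\lambda^2}\vee\frac{\epsilon^2}{\lambda^2}\right)+\frac{\log(1/\delta)}{n\lambda^2}\right)\le1,$$ we have $$\|\hat V\hat V^T-VV^T\|_{\rm F}^2\le C\left(\left(\frac{s\log\frac{ep}{s}}{n\lambda^2}\vee\frac{\epsilon^2}{\lambda^2}\right)+\frac{\log(1/\delta)}{n\lambda^2}\right)$$ with $\mathbb{P}_{(\epsilon,\Sigma,Q)}$-probability at least $1-2\delta$, uniformly over all $\Sigma=V\Lambda V^T+I_p\in\mathcal{F}_{s,\lambda}(M,r)$ and all probability distributions $Q$ on $\mathbb{R}^p$.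
   Context: Contamination model: for $\epsilon\in[0,1]$, a covariance matrix $\Sigma\in\mathbb{R}^{p\times p}$ and a probability distribution $Q$ on $\mathbb{R}^p$, $\mathbb{P}_{(\epsilon,\Sigma,Q)}=(1-\epsilon)N(0,\Sigma)+\epsilon Q$; $X_1,\dots,X_n$ are i.i.d. from it, and the same symbol denotes their joint law. $O(p,r)$ is the set of $p\times r$ matrices with orthonormal columns. For $V\in O(p,r)$, $\mathrm{supp}(V)$ is the set of indices of nonzero rows of $V$. The spiked class is $$\mathcal{F}_{s,\lambda}(M,r)=\left\{\Sigma=V\Lambda V^T+I_p:\ \Lambda=\mathrm{diag}(\lambda_1,\dots,\lambda_r),\ \lambda\le\lambda_r\le\cdots\le\lambda_1\le M,\ V\in O(p,r),\ |\mathrm{supp}(V)|\le s\right\},$$ with the rank $r$ bounded by a constant and $M$ not scaling with $p$ or $n$. For $S\subset[p]=\{1,\dots,p\}$, $\mathcal{G}(S)=\{G=(g_{ij})\in\mathbb{R}^{p\times p}:g_{ij}=0\text{ if }i\notin S\text{ or }j\notin S\}$; $\mathcal{G}(s)=\bigcup_{|S|\le s}\mathcal{G}(S)$; $\mathcal{F}_s=\{\Sigma\succeq0:\Sigma-\mathrm{diag}(\Sigma)\in\mathcal{G}(s)\}$, where $\mathrm{diag}(\Sigma)$ is the diagonal part of $\Sigma$. With $S^{p-1}$ the Euclidean unit sphere of $\mathbb{R}^p$, $\mathcal{V}_S=\{u\in S^{p-1}:u_i=0\text{ if }i\notin S\}$ and $\mathcal{U}_s=\bigcup_{S\subset[p]:|S|=2s}\mathcal{V}_S$.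 Empirical matrix depth relative to $\mathcal{U}\subset S^{p-1}$: $$\mathcal{D}_{\mathcal{U}}(\Gamma,\{X_i\}_{i=1}^n)=\min_{u\in\mathcal{U}}\min\left\{\frac1n\sum_{i=1}^n\mathbb{I}\{|u^TX_i|^2\le u^T\Gamma u\},\ \frac1n\sum_{i=1}^n\mathbb{I}\{|u^TX_i|^2\ge u^T\Gamma u\}\right\};$$ it takes finitely many values, so maximizers exist. $\|\cdot\|_{\rm F}$ is the Frobenius norm; $a\vee b=\max(a,b)$. *)

theory Defs
  imports "HOL-Probability.Probability" "Jordan_Normal_Form.Char_Poly"
begin

text \<open>
  The dimension \<open>p\<close> and the sample size \<open>n\<close> vary while the constants of the theorem stay fixed,
  so they are natural numbers and not types.  Vectors and matrices are those of
  Jordan-Normal-Form, with indices starting at 0: \<open>{..<p}\<close> plays the role of \<open>{1, \<dots>, p}\<close>.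
\<close>

no_notation inner (infix "\<bullet>" 70)

subsection \<open>The contamination model\<close>

definition Rspace :: "nat \<Rightarrow> (nat \<Rightarrow> real) measure" where
  "Rspace p = (\<Pi>\<^sub>M i\<in>{..<p}. borel)"

text \<open>
  \<open>N(0, \<Sigma>)\<close> is the law of \<open>A Z\<close>, where \<open>Z\<close> has independent standard normal coordinates and
  \<open>A A\<^sup>T = \<Sigma>\<close>.  Every positive semidefinite \<open>\<Sigma>\<close> has such a factor \<open>A\<close>, and the law does not
  depend on which one is used.
\<close>

definition gaussian_factor :: "nat \<Rightarrow> real mat \<Rightarrow> real mat" where
  "gaussian_factor p \<Sigma> = (SOME A. A \<in> carrier_mat p p \<and> A * transpose_mat A = \<Sigma>)"

definition gaussian :: "nat \<Rightarrow> real mat \<Rightarrow> (nat \<Rightarrow> real) measure" where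
  "gaussian p \<Sigma> =
     distr (\<Pi>\<^sub>M i\<in>{..<p}. density lborel std_normal_density) (Rspace p)
       (\<lambda>z. \<lambda>i\<in>{..<p}. (gaussian_factor p \<Sigma> *\<^sub>v Matrix.vec p z) $ i)"

definition contaminated ::
  "nat \<Rightarrow> real \<Rightarrow> real mat \<Rightarrow> (nat \<Rightarrow> real) measure \<Rightarrow> (nat \<Rightarrow> real) measure" where
  "contaminated p \<epsilon> \<Sigma> Q =
     measure_of (space (Rspace p)) (sets (Rspace p))
       (\<lambda>B. ennreal (1 - \<epsilon>) * emeasure (gaussian p \<Sigma>) B + ennreal \<epsilon> * emeasure Q B)"

definition iid_sample :: "nat \<Rightarrow> 'a measure \<Rightarrow> (nat \<Rightarrow> 'a) measure" where
  "iid_sample n P = (\<Pi>\<^sub>M i\<in>{..<n}. P)"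

text \<open>
  An estimator is an arbitrary choice of maximizers, so the event \<open>E\<close> need not be measurable.
  The lower bound on its probability is then understood as one on its inner probability;
  for measurable \<open>E\<close> this is \<open>q \<le> P(E)\<close>.
\<close>

definition with_prob_at_least :: "'a measure \<Rightarrow> real \<Rightarrow> ('a \<Rightarrow> bool) \<Rightarrow> bool" where
  "with_prob_at_least P q E \<longleftrightarrow> (\<exists>A\<in>sets P. (\<forall>x\<in>A. E x) \<and> q \<le> measure P A)"

subsection \<open>Matrix classes\<close>

definition orthonormal_mats :: "nat \<Rightarrow> nat \<Rightarrow> real mat set" where
  "orthonormal_mats p r = {V \<in> carrier_mat p r. transpose_mat V * V = 1\<^sub>m r}"

definition row_supp :: "real mat \<Rightarrow> nat set" where
  "row_supp V = {i. i < dim_row V \<and> row V i \<noteq> 0\<^sub>v (dim_col V)}"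

definition psd :: "nat \<Rightarrow> real mat \<Rightarrow> bool" where
  "psd p A \<longleftrightarrow> A \<in> carrier_mat p p \<and> transpose_mat A = A \<and>
     (\<forall>v\<in>carrier_vec p. 0 \<le> v \<bullet> (A *\<^sub>v v))"

text \<open>
  \<open>spiked_params p s lam M r V L\<close> collects the constraints on \<open>V\<close> and on the diagonal \<open>L\<close> of \<open>\<Lambda>\<close>
  under which \<open>V \<Lambda> V\<^sup>T + I\<close> is a member of the spiked class.
\<close>

definition spiked_params ::
  "nat \<Rightarrow> nat \<Rightarrow> real \<Rightarrow> real \<Rightarrow> nat \<Rightarrow> real mat \<Rightarrow> (nat \<Rightarrow> real) \<Rightarrow> bool" where
  "spiked_params p s lam M r V L \<longleftrightarrow>
     V \<in> orthonormal_mats p r \<and> card (row_supp V) \<le> s \<and>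
     (\<forall>i<r. lam \<le> L i \<and> L i \<le> M) \<and> (\<forall>i j. i \<le> j \<and> j < r \<longrightarrow> L j \<le> L i)"

definition spiked_cov :: "nat \<Rightarrow> nat \<Rightarrow> real mat \<Rightarrow> (nat \<Rightarrow> real) \<Rightarrow> real mat" where
  "spiked_cov p r V L = V * mat_diag r L * transpose_mat V + 1\<^sub>m p"

definition supported_mats :: "nat \<Rightarrow> nat set \<Rightarrow> real mat set" where
  "supported_mats p S =
     {G \<in> carrier_mat p p. \<forall>i<p. \<forall>j<p. i \<notin> S \<or> j \<notin> S \<longrightarrow> G $$ (i, j) = 0}"

definition sparse_mats :: "nat \<Rightarrow> nat \<Rightarrow> real mat set" where
  "sparse_mats p s = (\<Union>S\<in>{S. S \<subseteq> {..<p} \<and> card S \<le> s}. supported_mats p S)"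

definition sparse_covs :: "nat \<Rightarrow> nat \<Rightarrow> real mat set" where
  "sparse_covs p s = {\<Sigma>. psd p \<Sigma> \<and> \<Sigma> - mat_diag p (\<lambda>i. \<Sigma> $$ (i, i)) \<in> sparse_mats p s}"

definition frob_norm :: "real mat \<Rightarrow> real" where
  "frob_norm A = sqrt (\<Sum>i<dim_row A. \<Sum>j<dim_col A. (A $$ (i, j))\<^sup>2)"

subsection \<open>Matrix depth\<close>

definition supported_sphere :: "nat \<Rightarrow> nat set \<Rightarrow> real vec set" where
  "supported_sphere p S = {u \<in> carrier_vec p. u \<bullet> u = 1 \<and> (\<forall>i<p. i \<notin> S \<longrightarrow> u $ i = 0)}"

definition sparse_directions :: "nat \<Rightarrow> nat \<Rightarrow> real vec set" where
  "sparse_directions p s = (\<Union>S\<in>{S. S \<subseteq> {..<p} \<and> card S = 2 * s}. supported_sphere p S)"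

text \<open>
  The sample is \<open>X 0, \<dots>, X (n - 1)\<close>.  The set under \<open>Min\<close> is finite, being contained in
  \<open>{k / n | k \<le> n}\<close>.
\<close>

definition matrix_depth ::
  "nat \<Rightarrow> nat \<Rightarrow> real vec set \<Rightarrow> real mat \<Rightarrow> (nat \<Rightarrow> nat \<Rightarrow> real) \<Rightarrow> real" where
  "matrix_depth p n U \<Gamma> X =
     Min ((\<lambda>u. min
        ((1 / real n) * (\<Sum>i<n. of_bool (\<bar>u \<bullet> Matrix.vec p (X i)\<bar>\<^sup>2 \<le> u \<bullet> (\<Gamma> *\<^sub>v u))))
        ((1 / real n) * (\<Sum>i<n. of_bool (\<bar>u \<bullet> Matrix.vec p (X i)\<bar>\<^sup>2 \<ge> u \<bullet> (\<Gamma> *\<^sub>v u))))) ` U)"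

text \<open>
  The columns of \<open>W\<close> are the first \<open>r\<close> members of an orthonormal basis of eigenvectors of \<open>\<Gamma>\<close>
  listed by decreasing eigenvalue.  With repeated eigenvalues there are several such \<open>W\<close>.
\<close>

definition leading_eigenvectors :: "nat \<Rightarrow> nat \<Rightarrow> real mat \<Rightarrow> real mat \<Rightarrow> bool" where
  "leading_eigenvectors p r \<Gamma> W \<longleftrightarrow>
     W \<in> orthonormal_mats p r \<and>
     (\<exists>B\<in>orthonormal_mats p p. \<exists>\<mu>::nat \<Rightarrow> real.
        (\<forall>l<p. eigenvector \<Gamma> (col B l) (\<mu> l)) \<and>
        (\<forall>i j. i \<le> j \<and> j < p \<longrightarrow> \<mu> j \<le> \<mu> i) \<and>
        (\<forall>l<r. l < p \<and> col W l = col B l))"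

definition rate :: "nat \<Rightarrow> nat \<Rightarrow> nat \<Rightarrow> real \<Rightarrow> real \<Rightarrow> real \<Rightarrow> real" where
  "rate n p s lam \<epsilon> \<delta> =
     max (real s * ln (exp 1 * real p / real s) / (real n * lam\<^sup>2)) (\<epsilon>\<^sup>2 / lam\<^sup>2)
       + ln (1 / \<delta>) / (real n * lam\<^sup>2)"

end

theory Submission
  imports Defs
begin

text \<open>
  Let \<open>\<tau>\<close> be the median of \<open>|N(0, 1)|\<close>.  Without contamination \<open>|u\<^sup>T X|\<^sup>2\<close> has median \<open>\<tau>\<^sup>2 u\<^sup>T \<Sigma> u\<close> for
  every \<open>u\<close>, so the population depth is maximal, with value 1/2, at the multiple \<open>\<tau>\<^sup>2 \<Sigma>\<close> of the
  covariance.  Scaling does not change eigenvectors, hence it suffices that the maximizer of the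
  sample depth is close to \<open>\<tau>\<^sup>2 \<Sigma>\<close>.

  Put \<open>y = (s log (e p / s) + log (1 / \<delta>)) / n\<close> and \<open>\<eta> = C \<surd>y + \<epsilon>\<close>.  Suppose that, uniformly over the
  sparse directions, the fractions of the sample in the slabs \<open>|u\<^sup>T X| \<le> T \<sigma>(u)\<close> and in their
  complements, where \<open>\<sigma>(u)\<^sup>2 = u\<^sup>T \<Sigma> u\<close>, exceed the Gaussian probabilities by at most \<open>\<eta>\<close>.  Then
  \<open>\<tau>\<^sup>2 \<Sigma>\<close> has sample depth at least \<open>1/2 - \<eta>\<close>, and so has the maximizer.  As the distribution
  function of \<open>|N(0, 1)|\<close> has positive slope at \<open>\<tau>\<close>, a matrix whose quadratic form differs from
  that of \<open>\<tau>\<^sup>2 \<Sigma>\<close> by a large multiple of \<open>\<eta>\<close> in one sparse direction has a smaller depth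
  (\<open>depth_maximizer_close\<close>).  Two matrices of the sparse class differ by a diagonal matrix plus one
  supported on at most \<open>2 s\<close> indices, so the bound extends from the sparse directions to all vectors
  (\<open>sparse_quadratic_bound_all\<close>).  A perturbation of size \<open>O(\<eta>)\<close> keeps each of the \<open>r\<close> leading
  eigenvectors within \<open>O(\<eta> / \<lambda>)\<close> of the range of \<open>V\<close>, since the eigenvalues of \<open>\<Sigma>\<close> above 1 are separated from 1 by \<open>\<lambda>\<close>
  (\<open>davis_kahan\<close>).  Finally \<open>\<eta>\<^sup>2 / \<lambda>\<^sup>2\<close> is at most a constant times the rate.

  The probabilistic work is the uniform deviation bound.  A union bound over one fine net of sparse
  directions would cost an additional logarithmic factor in \<open>y\<close>, so the directions are
  discretized at the scales \<open>8\<^sup>-\<^sup>j\<close> and the deviations are chained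
  (\<open>chaining\<close>): the indicators of the slabs of two directions at distance \<open>8\<^sup>-\<^sup>j\<close> differ with
  probability \<open>O(4\<^sup>-\<^sup>j)\<close>, which pays for the growing entropy \<open>O((1 + j) s log (e p / s))\<close> of the nets.
  The chain stops at the scale \<open>y\<^sup>3\<^sup>/\<^sup>2\<close>; from there on the slabs are widened by \<open>\<surd>y\<close>, and the
  remaining directions are handled by Chebyshev's inequality and a bound on the sparse second moments
  of the sample (\<open>good_deviation\<close>).

  Increments of the chain are small only for Gaussian data, whereas \<open>Q\<close> is arbitrary.  A sample of the
  mixture is therefore coupled with a Gaussian one from which it differs in about \<open>\<epsilon> n\<close> places
  (\<open>contamination_transfer\<close>), and only upper bounds on counts are used, which survive the deletion of
  the contaminated observations.  Every event is a finite combination of conditions on the sample,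
  so that no measurability question arises for suprema over directions.
\<close>

section \<open>Exponential bounds and chaining for independent samples\<close>

lemma exp_le_quadratic:
  fixes x :: real
  assumes "\<bar>x\<bar> \<le> 1"
  shows "exp x \<le> 1 + x + x\<^sup>2"
proof (cases "0 \<le> x")
  case True
  then show ?thesis using assms by (intro exp_bound) auto
next
  case False
  define t where "t = - x"
  have t: "0 \<le> t" "t \<le> 1" using False assms by (auto simp: t_def)
  \<comment> \<open>The second factor is a lower Taylor bound for \<open>exp t\<close>, and the first is the claimed bound for
    \<open>exp (- t)\<close>.\<close>
  have "1 \<le> (1 - t + t\<^sup>2) * (1 + t + t\<^sup>2 / 2)"
  proof -
    have "(1 - t + t\<^sup>2) * (1 + t + t\<^sup>2 / 2) = 1 + t\<^sup>2 / 2 + t ^ 3 / 2 + t ^ 4 / 2"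
      by (simp add: field_simps power2_eq_square power3_eq_cube power4_eq_xxxx)
    then show ?thesis using t by simp
  qed
  also have "\<dots> \<le> (1 - t + t\<^sup>2) * exp t"
    using t exp_lower_Taylor_quadratic[of t] by (intro mult_left_mono) auto
  finally have "exp (- t) \<le> 1 - t + t\<^sup>2"
    by (simp add: exp_minus field_simps)
  then show ?thesis by (simp add: t_def)
qed

lemma prob_space_iid_sample: "prob_space G \<Longrightarrow> prob_space (iid_sample n G)"
  unfolding iid_sample_def by (intro prob_space_PiM)

lemma iid_sample_component [measurable (raw)]:
  "i < n \<Longrightarrow> (\<lambda>X. X i) \<in> measurable (iid_sample n G) G"
  unfolding iid_sample_def by (intro measurable_component_singleton) auto

text \<open>
  Markov's inequality for the exponential of the sum, whose expectation factorizes.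
\<close>

lemma chernoff_iid:
  fixes \<psi> :: "'a \<Rightarrow> real"
  assumes "prob_space G" and [measurable]: "\<psi> \<in> borel_measurable G"
    and mgf: "(\<integral>\<^sup>+x. ennreal (exp (\<psi> x)) \<partial>G) \<le> ennreal (exp c)"
  shows "measure (iid_sample n G)
           {X \<in> space (iid_sample n G). real n * c + L \<le> (\<Sum>i<n. \<psi> (X i))} \<le> exp (- L)"
    (is "measure ?P ?B \<le> _")
proof -
  interpret G: prob_space G by fact
  interpret PG: product_sigma_finite "\<lambda>_::nat. G" by standard
  interpret P: prob_space ?P using assms(1) by (rule prob_space_iid_sample)
  have prod: "(\<integral>\<^sup>+X. ennreal (exp (\<Sum>i<n. \<psi> (X i))) \<partial>?P) = (\<integral>\<^sup>+x. ennreal (exp (\<psi> x)) \<partial>G) ^ n"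
  proof -
    have "(\<integral>\<^sup>+X. ennreal (exp (\<Sum>i<n. \<psi> (X i))) \<partial>?P) =
          (\<integral>\<^sup>+X. (\<Prod>i<n. ennreal (exp (\<psi> (X i)))) \<partial>?P)"
      by (simp add: exp_sum prod_ennreal)
    also have "\<dots> = (\<Prod>i<n. (\<integral>\<^sup>+x. ennreal (exp (\<psi> x)) \<partial>G))"
      unfolding iid_sample_def by (subst PG.product_nn_integral_prod) auto
    finally show ?thesis by simp
  qed
  have "?B = {X \<in> space ?P. 1 \<le> ennreal (exp (- (real n * c + L))) * ennreal (exp (\<Sum>i<n. \<psi> (X i)))}"
    by (auto simp flip: ennreal_mult exp_add ennreal_1 simp: ennreal_le_iff)
  then have "emeasure ?P ?B \<le>
      ennreal (exp (- (real n * c + L))) * (\<integral>\<^sup>+X. ennreal (exp (\<Sum>i<n. \<psi> (X i))) * indicator (space ?P) X \<partial>?P)"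
    using nn_integral_Markov_inequality[of "\<lambda>X. ennreal (exp (\<Sum>i<n. \<psi> (X i)))" "space ?P" ?P
        "ennreal (exp (- (real n * c + L)))"] by simp
  also have "(\<integral>\<^sup>+X. ennreal (exp (\<Sum>i<n. \<psi> (X i))) * indicator (space ?P) X \<partial>?P)
       = (\<integral>\<^sup>+x. ennreal (exp (\<psi> x)) \<partial>G) ^ n"
    unfolding prod[symmetric] by (intro nn_integral_cong) auto
  also have "ennreal (exp (- (real n * c + L))) * \<dots> \<le> ennreal (exp (- (real n * c + L))) * ennreal (exp c) ^ n"
    by (intro mult_left_mono power_mono mgf) auto
  also have "\<dots> = ennreal (exp (- L))"
    by (simp add: ennreal_power exp_of_nat_mult[symmetric] flip: ennreal_mult exp_add)
  finally show ?thesis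
    by (simp add: P.emeasure_eq_measure)
qed

text \<open>
  The parameter \<open>\<theta>\<close> of the exponential moment is left free instead of being optimized: chaining
  chooses it at every scale as a power of 2 times \<open>\<surd>y\<close>.  The variance bound \<open>q\<close> makes the price of
  a failure probability \<open>exp (- L)\<close> equal to \<open>n \<theta> q + L / \<theta>\<close>.
\<close>

lemma bernstein_iid:
  fixes \<phi> :: "'a \<Rightarrow> real"
  assumes "prob_space G" and [measurable]: "\<phi> \<in> borel_measurable G"
    and bound: "\<And>x. \<bar>\<phi> x\<bar> \<le> 1" and q: "(\<integral>x. (\<phi> x)\<^sup>2 \<partial>G) \<le> q"
    and \<theta>: "0 < \<theta>" "\<theta> \<le> 1"
  shows "measure (iid_sample n G)
           {X \<in> space (iid_sample n G).
              real n * ((\<integral>x. \<phi> x \<partial>G) + \<theta> * q) + L / \<theta> \<le> (\<Sum>i<n. \<phi> (X i))} \<le> exp (- L)"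
proof -
  interpret G: prob_space G by fact
  have int[simp]: "integrable G \<phi>" "integrable G (\<lambda>x. (\<phi> x)\<^sup>2)"
    using bound by (auto intro!: G.integrable_const_bound[where B=1] simp: abs_square_le_1)
  define c where "c = \<theta> * (\<integral>x. \<phi> x \<partial>G) + \<theta>\<^sup>2 * q"
  have le1: "\<bar>\<theta> * \<phi> x\<bar> \<le> 1" for x
    using bound[of x] \<theta> by (auto simp: abs_mult intro: mult_le_one)
  have "(\<integral>\<^sup>+x. ennreal (exp (\<theta> * \<phi> x)) \<partial>G) \<le> (\<integral>\<^sup>+x. ennreal (1 + \<theta> * \<phi> x + \<theta>\<^sup>2 * (\<phi> x)\<^sup>2) \<partial>G)"
    using exp_le_quadratic[OF le1] by (intro nn_integral_mono ennreal_leI) (simp add: power_mult_distrib)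
  also have "\<dots> = ennreal (\<integral>x. 1 + \<theta> * \<phi> x + \<theta>\<^sup>2 * (\<phi> x)\<^sup>2 \<partial>G)"
  proof (intro nn_integral_eq_integral AE_I2)
    fix x
    show "0 \<le> 1 + \<theta> * \<phi> x + \<theta>\<^sup>2 * (\<phi> x)\<^sup>2"
      using le1[of x] by (smt (verit) mult_nonneg_nonneg zero_le_power2)
  qed auto
  also have "(\<integral>x. 1 + \<theta> * \<phi> x + \<theta>\<^sup>2 * (\<phi> x)\<^sup>2 \<partial>G) = 1 + \<theta> * (\<integral>x. \<phi> x \<partial>G) + \<theta>\<^sup>2 * (\<integral>x. (\<phi> x)\<^sup>2 \<partial>G)"
    by (simp add: G.prob_space)
  also have "ennreal \<dots> \<le> ennreal (exp c)"
  proof (rule ennreal_leI)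
    have "1 + \<theta> * (\<integral>x. \<phi> x \<partial>G) + \<theta>\<^sup>2 * (\<integral>x. (\<phi> x)\<^sup>2 \<partial>G) \<le> 1 + c"
      using q by (simp add: c_def mult_left_mono)
    also have "\<dots> \<le> exp c" by (rule exp_ge_add_one_self)
    finally show "1 + \<theta> * (\<integral>x. \<phi> x \<partial>G) + \<theta>\<^sup>2 * (\<integral>x. (\<phi> x)\<^sup>2 \<partial>G) \<le> exp c" .
  qed
  finally have "measure (iid_sample n G)
      {X \<in> space (iid_sample n G). real n * c + L \<le> (\<Sum>i<n. \<theta> * \<phi> (X i))} \<le> exp (- L)"
    by (intro chernoff_iid assms(1)) auto
  moreover have "real n * c + L \<le> (\<Sum>i<n. \<theta> * \<phi> (X i)) \<longleftrightarrow>
      real n * ((\<integral>x. \<phi> x \<partial>G) + \<theta> * q) + L / \<theta> \<le> (\<Sum>i<n. \<phi> (X i))" for X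
  proof -
    have "real n * c + L = \<theta> * (real n * ((\<integral>x. \<phi> x \<partial>G) + \<theta> * q) + L / \<theta>)"
      using \<theta> by (simp add: c_def algebra_simps power2_eq_square)
    then show ?thesis using \<theta> by (simp add: sum_distrib_left[symmetric])
  qed
  ultimately show ?thesis by simp
qed

lemma sum_linear_over_powers_of_two: "(\<Sum>j<J. (1 + real j) / 2 ^ j) \<le> 4"
proof -
  have "(\<Sum>j<J. (1 + real j) / 2 ^ j) = 4 - (2 * real J + 4) / 2 ^ J"
    by (induction J) (auto simp: diff_divide_distrib add_divide_distrib)
  then show ?thesis by simp
qed

text \<open>
  The deviation at the finest approximation \<open>\<pi> J u\<close> telescopes into the deviation at the coarsest one
  and those of the links from \<open>\<pi> j u\<close> to \<open>\<pi> (j + 1) u\<close>.  At scale \<open>j\<close> there are at most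
  \<open>exp (3 E (1 + j))\<close> links, each of variance at most \<open>B / 4\<^sup>j\<close>.  With failure probability
  \<open>exp (- 4 E (1 + j))\<close> and \<open>\<theta> = 2\<^sup>j \<surd>y\<close>, Bernstein's inequality bounds a link by \<open>\<surd>y\<close> times a
  term of a convergent series, because \<open>E / n\<close> is proportional to \<open>y\<close>.  This choice of \<open>\<theta>\<close> is
  admissible as long as \<open>2\<^sup>J \<surd>y \<le> 1\<close>, which determines where the chain has to stop.
\<close>

lemma chaining:
  fixes f :: "'k \<Rightarrow> 'a \<Rightarrow> real" and \<pi> :: "nat \<Rightarrow> 'k \<Rightarrow> 'k"
  assumes "prob_space G" and meas: "\<And>u. f u \<in> borel_measurable G"
    and f01: "\<And>u x. 0 \<le> f u x \<and> f u x \<le> 1"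
    and fin: "\<And>j. finite (\<pi> j ` K)" and entropy: "\<And>j. real (card (\<pi> j ` K)) \<le> exp (E * (1 + real j))"
    and E: "1 \<le> E" "E = c * real n * y"
    and link: "\<And>u j. u \<in> K \<Longrightarrow> j < J \<Longrightarrow> (\<integral>x. (f (\<pi> (Suc j) u) x - f (\<pi> j u) x)\<^sup>2 \<partial>G) \<le> B / 4 ^ j"
    and B: "0 \<le> B" and c: "0 \<le> c" and y: "0 < y" "2 ^ J * sqrt y \<le> 1"
  shows "measure (iid_sample n G) {X \<in> space (iid_sample n G). \<exists>u\<in>K.
            real n * ((\<integral>x. f (\<pi> J u) x \<partial>G) + (1 + 2 * B + 18 * c) * sqrt y) < (\<Sum>i<n. f (\<pi> J u) (X i))}
         \<le> 3 * exp (- E)"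
    (is "measure ?P ?Bad \<le> _")
proof -
  interpret G: prob_space G by fact
  interpret P: prob_space ?P using assms(1) by (rule prob_space_iid_sample)
  note [measurable] = meas
  have int[simp]: "integrable G (f u)" for u
    using f01[of u] by (intro G.integrable_const_bound[where B=1]) auto
  define I where "I u = (\<integral>x. f u x \<partial>G)" for u
  define pairs where "pairs j = (\<lambda>u. (\<pi> j u, \<pi> (Suc j) u)) ` K" for j
  have fin_pairs: "finite (pairs j)" for j
    using finite_subset[of "pairs j" "\<pi> j ` K \<times> \<pi> (Suc j) ` K"] fin by (auto simp: pairs_def)
  have card_pairs: "real (card (pairs j)) \<le> exp (3 * E * (1 + real j))" for j
  proof -
    have "card (pairs j) \<le> card (\<pi> j ` K \<times> \<pi> (Suc j) ` K)"
      using fin by (intro card_mono) (auto simp: pairs_def)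
    then have "real (card (pairs j)) \<le> real (card (\<pi> j ` K)) * real (card (\<pi> (Suc j) ` K))"
      by (simp add: card_cartesian_product flip: of_nat_mult)
    also have "\<dots> \<le> exp (E * (1 + real j)) * exp (E * (1 + real (Suc j)))"
      by (intro mult_mono entropy) auto
    also have "\<dots> = exp (E * (3 + 2 * real j))" by (simp flip: exp_add add: algebra_simps)
    also have "\<dots> \<le> exp (3 * E * (1 + real j))" using E(1) by (simp add: algebra_simps)
    finally show ?thesis .
  qed
  define x where "x j = sqrt y * (B / 2 ^ j + 4 * c * ((1 + real j) / 2 ^ j))" for j :: nat
  define B0 where "B0 a = {X \<in> space ?P. real n * (I a + sqrt y * (1 + 2 * c)) \<le> (\<Sum>i<n. f a (X i))}" for a
  define Bj where "Bj j = (\<lambda>(a, b). {X \<in> space ?P.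
      real n * (I b - I a + x j) \<le> (\<Sum>i<n. f b (X i) - f a (X i))})" for j :: nat
  have sy: "0 < sqrt y" "sqrt y \<le> 1"
  proof -
    have "1 * sqrt y \<le> 2 ^ J * sqrt y" using y(1) by (intro mult_right_mono) auto
    then show "sqrt y \<le> 1" using y(2) by linarith
    show "0 < sqrt y" using y(1) by simp
  qed
  have n_eq: "E / sqrt y = real n * (c * sqrt y)"
    using y by (simp add: E(2) field_simps)
  have B0: "B0 a \<in> sets ?P" "measure ?P (B0 a) \<le> exp (- (2 * E))" for a
  proof -
    show "B0 a \<in> sets ?P" unfolding B0_def by measurable
    have "(\<integral>x. (f a x)\<^sup>2 \<partial>G) \<le> (\<integral>x. 1 \<partial>G)"
      using f01[of a] by (intro integral_mono G.integrable_const_bound[where B=1])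
         (auto simp: abs_square_le_1 power_le_one)
    then have "(\<integral>x. (f a x)\<^sup>2 \<partial>G) \<le> 1" by (simp add: G.prob_space)
    then have "measure ?P {X \<in> space ?P. real n * ((\<integral>x. f a x \<partial>G) + sqrt y * 1) + 2 * E / sqrt y
        \<le> (\<Sum>i<n. f a (X i))} \<le> exp (- (2 * E))"
      using f01[of a] sy by (intro bernstein_iid assms(1)) auto
    moreover have "real n * ((\<integral>x. f a x \<partial>G) + sqrt y * 1) + 2 * E / sqrt y = real n * (I a + sqrt y * (1 + 2 * c))"
    proof -
      have "2 * E / sqrt y = 2 * (E / sqrt y)" by simp
      then show ?thesis unfolding n_eq by (simp add: I_def algebra_simps)
    qed
    ultimately show "measure ?P (B0 a) \<le> exp (- (2 * E))" by (simp add: B0_def)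
  qed
  have Bj: "Bj j ab \<in> sets ?P" "measure ?P (Bj j ab) \<le> exp (- (4 * E * (1 + real j)))"
    if j: "j < J" and ab: "ab \<in> pairs j" for j ab
  proof -
    obtain u where u: "u \<in> K" "ab = (\<pi> j u, \<pi> (Suc j) u)" using ab by (auto simp: pairs_def)
    define a b where "a = \<pi> j u" and "b = \<pi> (Suc j) u"
    have ab_eq: "ab = (a, b)" using u by (simp add: a_def b_def)
    show "Bj j ab \<in> sets ?P" unfolding Bj_def ab_eq by simp
    define \<theta> where "\<theta> = 2 ^ j * sqrt y"
    have \<theta>: "0 < \<theta>" "\<theta> \<le> 1"
    proof -
      have "2 ^ j * sqrt y \<le> 2 ^ J * sqrt y" using j sy by (intro mult_right_mono power_increasing) auto
      then show "\<theta> \<le> 1" using y(2) unfolding \<theta>_def by linarith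
      show "0 < \<theta>" using y(1) by (simp add: \<theta>_def)
    qed
    have "measure ?P {X \<in> space ?P. real n * ((\<integral>x. f b x - f a x \<partial>G) + \<theta> * (B / 4 ^ j)) + (4 * E * (1 + real j)) / \<theta>
        \<le> (\<Sum>i<n. f b (X i) - f a (X i))} \<le> exp (- (4 * E * (1 + real j)))"
    proof (intro bernstein_iid assms(1) \<theta>)
      show "\<bar>f b x - f a x\<bar> \<le> 1" for x using f01[of a x] f01[of b x] by auto
    qed (use link[OF u(1) j] in \<open>auto simp: a_def b_def\<close>)
    moreover have "real n * ((\<integral>x. f b x - f a x \<partial>G) + \<theta> * (B / 4 ^ j)) + (4 * E * (1 + real j)) / \<theta>
        = real n * (I b - I a + x j)"
    proof -
      have "(4 * E * (1 + real j)) / \<theta> = (E / sqrt y) * (4 * ((1 + real j) / 2 ^ j))"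
        by (simp add: \<theta>_def field_simps)
      also have "\<dots> = real n * (sqrt y * (4 * c * ((1 + real j) / 2 ^ j)))"
        unfolding n_eq by simp
      finally have *: "(4 * E * (1 + real j)) / \<theta> = real n * (sqrt y * (4 * c * ((1 + real j) / 2 ^ j)))" .
      have "(4::real) ^ j = 2 ^ j * 2 ^ j" by (simp flip: power_mult_distrib)
      then have "\<theta> * (B / 4 ^ j) = sqrt y * (B / 2 ^ j)" by (simp add: \<theta>_def)
      then show ?thesis unfolding * by (simp add: I_def x_def algebra_simps)
    qed
    ultimately show "measure ?P (Bj j ab) \<le> exp (- (4 * E * (1 + real j)))"
      by (simp add: Bj_def ab_eq)
  qed
  define U where "U = (\<Union>a\<in>\<pi> 0 ` K. B0 a) \<union> (\<Union>j<J. \<Union>ab\<in>pairs j. Bj j ab)"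
  have "?Bad \<subseteq> U"
  proof (rule subsetI, rule ccontr)
    fix X assume "X \<in> ?Bad" and XU: "X \<notin> U"
    then obtain u where X: "X \<in> space ?P" and u: "u \<in> K"
      and big: "real n * (I (\<pi> J u) + (1 + 2 * B + 18 * c) * sqrt y) < (\<Sum>i<n. f (\<pi> J u) (X i))"
      by (auto simp: I_def)
    define S where "S a = (\<Sum>i<n. f a (X i)) - real n * I a" for a
    have S0: "S (\<pi> 0 u) \<le> real n * (sqrt y * (1 + 2 * c))"
      using XU u X by (force simp: U_def B0_def S_def algebra_simps)
    have Sj: "S (\<pi> (Suc j) u) - S (\<pi> j u) \<le> real n * x j" if "j < J" for j
    proof -
      have "X \<notin> Bj j (\<pi> j u, \<pi> (Suc j) u)" using XU u that by (auto simp: U_def pairs_def)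
      then show ?thesis using X by (simp add: Bj_def S_def sum_subtractf algebra_simps)
    qed
    have "S (\<pi> J u) = S (\<pi> 0 u) + (\<Sum>j<J. S (\<pi> (Suc j) u) - S (\<pi> j u))"
      using sum_lessThan_telescope[of "\<lambda>j. S (\<pi> j u)" J] by simp
    also have "\<dots> \<le> real n * (sqrt y * (1 + 2 * c)) + (\<Sum>j<J. real n * x j)"
      using Sj S0 by (intro add_mono sum_mono) auto
    also have "(\<Sum>j<J. real n * x j) = real n * (sqrt y * (B * (\<Sum>j<J. 1 / 2 ^ j) + 4 * c * (\<Sum>j<J. (1 + real j) / 2 ^ j)))"
      by (simp add: x_def sum_distrib_left sum.distrib algebra_simps)
    also have "\<dots> \<le> real n * (sqrt y * (B * 2 + 4 * c * 4))"
    proof -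
      have geo: "(\<Sum>j<J. 1 / 2 ^ j) \<le> (2::real)"
      proof -
        have "(\<Sum>j<J. 1 / 2 ^ j) = (2::real) - 2 / 2 ^ J" by (induction J) (auto simp: field_simps)
        then show ?thesis by simp
      qed
      show ?thesis
        using geo sum_linear_over_powers_of_two[of J] B c y
        by (intro mult_left_mono add_mono) auto
    qed
    finally have "S (\<pi> J u) \<le> real n * ((1 + 2 * B + 18 * c) * sqrt y)"
      by (simp add: algebra_simps)
    then show False using big by (simp add: S_def algebra_simps)
  qed
  moreover have U_sets: "U \<in> sets ?P"
    unfolding U_def using fin fin_pairs B0 Bj by (intro sets.Un sets.finite_UN) auto
  ultimately have "measure ?P ?Bad \<le> measure ?P U"
    by (intro P.finite_measure_mono)
  also have "\<dots> \<le> measure ?P (\<Union>a\<in>\<pi> 0 ` K. B0 a) + measure ?P (\<Union>j<J. \<Union>ab\<in>pairs j. Bj j ab)"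
    unfolding U_def using fin fin_pairs B0 Bj by (intro measure_Un_le sets.finite_UN) auto
  also have "measure ?P (\<Union>a\<in>\<pi> 0 ` K. B0 a) \<le> exp (- E)"
  proof -
    have "measure ?P (\<Union>a\<in>\<pi> 0 ` K. B0 a) \<le> (\<Sum>a\<in>\<pi> 0 ` K. measure ?P (B0 a))"
      using fin B0 by (intro P.finite_measure_subadditive_finite) auto
    also have "\<dots> \<le> real (card (\<pi> 0 ` K)) * exp (- (2 * E))"
      using B0 by (intro sum_bounded_above) auto
    also have "\<dots> \<le> exp E * exp (- (2 * E))" using entropy[of 0] by (intro mult_right_mono) auto
    also have "\<dots> = exp (- E)" by (simp flip: exp_add)
    finally show ?thesis .
  qed
  also have "measure ?P (\<Union>j<J. \<Union>ab\<in>pairs j. Bj j ab) \<le> 2 * exp (- E)"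
  proof -
    have "measure ?P (\<Union>j<J. \<Union>ab\<in>pairs j. Bj j ab) \<le> (\<Sum>j<J. measure ?P (\<Union>ab\<in>pairs j. Bj j ab))"
      using fin_pairs Bj by (intro P.finite_measure_subadditive_finite) (auto intro!: sets.finite_UN)
    also have "\<dots> \<le> (\<Sum>j<J. exp (- E) * (1 / 2) ^ j)"
    proof (intro sum_mono)
      fix j assume j: "j \<in> {..<J}"
      have "measure ?P (\<Union>ab\<in>pairs j. Bj j ab) \<le> (\<Sum>ab\<in>pairs j. measure ?P (Bj j ab))"
        using fin_pairs Bj j by (intro P.finite_measure_subadditive_finite) auto
      also have "\<dots> \<le> real (card (pairs j)) * exp (- (4 * E * (1 + real j)))"
        using Bj j by (intro sum_bounded_above) auto
      also have "\<dots> \<le> exp (3 * E * (1 + real j)) * exp (- (4 * E * (1 + real j)))"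
        using card_pairs by (intro mult_right_mono) auto
      also have "\<dots> = exp (- E) * exp (- E) ^ j"
        by (simp flip: exp_add exp_of_nat_mult add: algebra_simps)
      also have "\<dots> \<le> exp (- E) * (1 / 2) ^ j"
      proof (intro mult_left_mono power_mono)
        have "2 \<le> exp (1::real)" using exp_ge_add_one_self[of 1] by simp
        also have "\<dots> \<le> exp E" using E by simp
        finally show "exp (- E) \<le> 1 / 2" by (simp add: exp_minus field_simps)
      qed auto
      finally show "measure ?P (\<Union>ab\<in>pairs j. Bj j ab) \<le> exp (- E) * (1 / 2) ^ j" .
    qed
    also have "\<dots> = exp (- E) * (\<Sum>j<J. (1 / 2) ^ j)" by (simp add: sum_distrib_left)
    also have "(\<Sum>j<J. (1 / 2) ^ j) \<le> (2::real)" by (subst sum_gp_strict) auto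
    finally show ?thesis by (simp add: mult.commute)
  qed
  finally show ?thesis by simp
qed

section \<open>Grids for sparse vectors\<close>

definition sparse_fun :: "nat \<Rightarrow> nat \<Rightarrow> (nat \<Rightarrow> real) \<Rightarrow> bool" where
  "sparse_fun p k u \<longleftrightarrow> (\<exists>S\<subseteq>{..<p}. card S \<le> k \<and> (\<forall>i. i \<notin> S \<longrightarrow> u i = 0))"

definition trunc_to :: "real \<Rightarrow> real \<Rightarrow> real" where
  "trunc_to \<eta> x = \<eta> * of_int (if 0 \<le> x then \<lfloor>x / \<eta>\<rfloor> else \<lceil>x / \<eta>\<rceil>)"

text \<open>
  Rounding is towards 0: zeros are kept, so supports do not grow, and norms do not increase.
\<close>

lemma trunc_to:
  assumes "0 < \<eta>"
  shows "\<bar>trunc_to \<eta> x\<bar> \<le> \<bar>x\<bar>" "\<bar>x - trunc_to \<eta> x\<bar> \<le> \<eta>" "trunc_to \<eta> 0 = 0"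
proof -
  define t where "t = x / \<eta>"
  have x: "x = \<eta> * t" using assms by (simp add: t_def)
  define z where "z = (if 0 \<le> x then \<lfloor>t\<rfloor> else \<lceil>t\<rceil>)"
  have tr: "trunc_to \<eta> x = \<eta> * of_int z" by (simp add: trunc_to_def z_def t_def)
  have sgn: "0 \<le> x \<longleftrightarrow> 0 \<le> t" using assms by (simp add: x zero_le_mult_iff)
  have z1: "\<bar>real_of_int z\<bar> \<le> \<bar>t\<bar>"
  proof (cases "0 \<le> t")
    case True
    then have "0 \<le> \<lfloor>t\<rfloor>" by simp
    then show ?thesis using True sgn by (simp add: z_def)
  next
    case False
    then have "\<lceil>t\<rceil> \<le> 0" by simp
    then have "\<bar>real_of_int \<lceil>t\<rceil>\<bar> = - real_of_int \<lceil>t\<rceil>" by linarith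
    then show ?thesis using False sgn le_of_int_ceiling[of t] by (simp add: z_def)
  qed
  have z2: "\<bar>t - of_int z\<bar> \<le> 1"
    unfolding z_def by (cases "0 \<le> x"; simp; linarith)
  show "\<bar>trunc_to \<eta> x\<bar> \<le> \<bar>x\<bar>"
    using z1 assms unfolding tr by (simp add: x abs_mult mult_left_mono)
  have "x - trunc_to \<eta> x = \<eta> * (t - of_int z)" unfolding tr by (subst x) (simp add: algebra_simps)
  then show "\<bar>x - trunc_to \<eta> x\<bar> \<le> \<eta>"
    using z2 assms by (simp add: abs_mult mult_left_le)
qed (simp add: trunc_to_def)

definition grid_round :: "nat \<Rightarrow> real \<Rightarrow> (nat \<Rightarrow> real) \<Rightarrow> nat \<Rightarrow> real" where
  "grid_round k h u i = trunc_to (h / sqrt k) (u i)"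

lemma L2_set_sparse:
  fixes p :: nat
  assumes "S \<subseteq> {..<p}" and "\<And>i. i \<notin> S \<Longrightarrow> u i = 0"
  shows "L2_set u {..<p} = L2_set u S"
  unfolding L2_set_def using assms
  by (intro arg_cong[where f=sqrt] sum.mono_neutral_right) auto

text \<open>
  The Cauchy-Schwarz inequality on the support.
\<close>

lemma sum_abs_sparse_le:
  assumes "sparse_fun p k u"
  shows "(\<Sum>i<p. \<bar>u i\<bar>) \<le> sqrt k * L2_set u {..<p}"
proof -
  obtain S where S: "S \<subseteq> {..<p}" "card S \<le> k" "\<And>i. i \<notin> S \<Longrightarrow> u i = 0"
    using assms by (auto simp: sparse_fun_def)
  have "(\<Sum>i<p. \<bar>u i\<bar>) = (\<Sum>i\<in>S. \<bar>u i\<bar> * \<bar>1\<bar>)"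
    using S by (intro sum.mono_neutral_cong_right) auto
  also have "\<dots> \<le> L2_set u S * L2_set (\<lambda>_. 1) S" by (rule L2_set_mult_ineq)
  also have "L2_set (\<lambda>_. 1) S = sqrt (card S)" by (simp add: L2_set_def)
  also have "L2_set u S * \<dots> \<le> L2_set u S * sqrt k" using S by (intro mult_left_mono) auto
  finally show ?thesis using L2_set_sparse[of S p u] S by (simp add: mult.commute)
qed

lemma grid_round:
  assumes "0 < k" "0 < h" "sparse_fun p k u"
  shows "sparse_fun p k (grid_round k h u)" "sparse_fun p k (\<lambda>i. u i - grid_round k h u i)"
    and "L2_set (grid_round k h u) {..<p} \<le> L2_set u {..<p}"
    and "L2_set (\<lambda>i. u i - grid_round k h u i) {..<p} \<le> h"
proof -
  obtain S where S: "S \<subseteq> {..<p}" "card S \<le> k" "\<And>i. i \<notin> S \<Longrightarrow> u i = 0"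
    using assms by (auto simp: sparse_fun_def)
  have pos: "0 < h / sqrt k" using assms by simp
  note tr = trunc_to[OF pos]
  have zero: "grid_round k h u i = 0" if "i \<notin> S" for i
    using S(3)[OF that] tr(3) by (simp add: grid_round_def)
  show "sparse_fun p k (grid_round k h u)" "sparse_fun p k (\<lambda>i. u i - grid_round k h u i)"
    using S zero by (auto simp: sparse_fun_def intro!: exI[of _ S])
  show "L2_set (grid_round k h u) {..<p} \<le> L2_set u {..<p}"
    unfolding L2_set_def grid_round_def using tr(1)
    by (intro real_sqrt_le_mono sum_mono) (simp add: abs_le_square_iff)
  have "L2_set (\<lambda>i. u i - grid_round k h u i) {..<p} = L2_set (\<lambda>i. u i - grid_round k h u i) S"
    using S zero by (intro L2_set_sparse) auto
  also have "\<dots> \<le> sqrt (\<Sum>i\<in>S. (h / sqrt k)\<^sup>2)"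
    unfolding L2_set_def grid_round_def using tr(2) pos
    by (intro real_sqrt_le_mono sum_mono) (metis abs_ge_zero power2_abs power_mono)
  also have "\<dots> \<le> sqrt (h\<^sup>2)"
  proof (rule real_sqrt_le_mono)
    have "(\<Sum>i\<in>S. (h / sqrt k)\<^sup>2) = real (card S) / real k * h\<^sup>2"
      by (simp add: power_divide)
    also have "\<dots> \<le> 1 * h\<^sup>2" using S assms by (intro mult_right_mono) auto
    finally show "(\<Sum>i\<in>S. (h / sqrt k)\<^sup>2) \<le> h\<^sup>2" by simp
  qed
  finally show "L2_set (\<lambda>i. u i - grid_round k h u i) {..<p} \<le> h" using assms by simp
qed

lemma sum_exp_neg_le: "0 < (h::real) \<Longrightarrow> (\<Sum>z=1..(N::int). exp (- h * real_of_int z)) \<le> 1 / h"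
proof -
  assume h: "0 < h"
  have "(\<Sum>z=1..N. exp (- h * real_of_int z)) = (\<Sum>z=1..nat N. exp (- h) ^ z)"
    by (intro sum.reindex_bij_witness[of _ int nat]) (auto simp: exp_of_nat_mult[symmetric] mult.commute)
  also have "\<dots> \<le> exp (- h) / (1 - exp (- h))"
    using h by (subst sum_gp) (auto simp: divide_right_mono)
  also have "\<dots> = 1 / (exp h - 1)" using h by (simp add: exp_minus field_simps)
  also have "\<dots> \<le> 1 / h" using h exp_ge_add_one_self[of h] by (intro divide_left_mono) (linarith | simp)+
  finally show ?thesis .
qed

text \<open>
  A generating function argument that treats the choice of the support and of the entries together.
  A lattice point is given the weight \<open>\<Prod>\<^sub>i \<omega> (z\<^sub>i)\<close>, where a nonzero entry \<open>z\<close> contributes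
  \<open>exp (- h |z|) / a\<close>.  Every point of the set has weight at least \<open>exp (- k) a\<^sup>-\<^sup>k\<close>, while the weights
  of all lattice points sum to at most \<open>(1 + 2 / (a h))\<^sup>p\<close>.  The choice \<open>a = p / (k h)\<close> makes the
  latter at most \<open>exp (2 k)\<close>.
\<close>

lemma card_sparse_lattice_points:
  fixes p k :: nat and h :: real
  assumes k: "0 < k" and h: "0 < h" and kp: "real k * h \<le> real p"
  defines "Z \<equiv> {z \<in> PiE {..<p} (\<lambda>_. UNIV :: int set).
     card {i\<in>{..<p}. z i \<noteq> 0} \<le> k \<and> (\<Sum>i<p. real_of_int \<bar>z i\<bar>) \<le> real k / h}"
  shows "finite Z" and "real (card Z) \<le> (exp 3 * real p / (real k * h)) ^ k"
proof -
  define N where "N = \<lfloor>real k / h\<rfloor>"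
  define R where "R = (PiE {..<p} (\<lambda>_. {- N..N}) :: (nat \<Rightarrow> int) set)"
  define a where "a = real p / (real k * h)"
  have a: "1 \<le> a" using k h kp by (simp add: a_def)
  have p: "0 < p" using k h kp by (auto intro!: Nat.gr0I) (smt (verit) mult_pos_pos of_nat_0_less_iff)
  have N: "0 \<le> N" using k h by (simp add: N_def)
  define \<omega> where "\<omega> z = exp (- h * real_of_int \<bar>z\<bar>) * (if z = 0 then 1 else 1 / a)" for z :: int
  have finR: "finite R" by (auto simp: R_def intro!: finite_PiE)
  have ZR: "Z \<subseteq> R"
  proof
    fix z assume z: "z \<in> Z"
    have "\<bar>z i\<bar> \<le> N" if "i < p" for i
    proof -
      have "real_of_int \<bar>z i\<bar> \<le> (\<Sum>i<p. real_of_int \<bar>z i\<bar>)"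
        using that by (intro member_le_sum) auto
      also have "\<dots> \<le> real k / h" using z by (simp add: Z_def)
      finally show ?thesis by (simp add: N_def le_floor_iff)
    qed
    then show "z \<in> R" using z by (fastforce simp: Z_def R_def PiE_iff abs_le_iff)
  qed
  show "finite Z" using finR ZR by (rule finite_subset[rotated])
  have one: "1 \<le> exp (real k) * a ^ k * (\<Prod>i<p. \<omega> (z i))" if z: "z \<in> Z" for z
  proof -
    have "(\<Prod>i<p. \<omega> (z i)) = exp (- h * (\<Sum>i<p. real_of_int \<bar>z i\<bar>)) * (1 / a) ^ card {i\<in>{..<p}. z i \<noteq> 0}"
      unfolding \<omega>_def prod.distrib
      by (simp add: exp_sum[symmetric] sum_distrib_left prod.If_cases Int_def conj_commute sum_negf)
    moreover have "exp (- real k) \<le> exp (- h * (\<Sum>i<p. real_of_int \<bar>z i\<bar>))"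
      using z h by (simp add: Z_def field_simps)
    moreover have "(1 / a) ^ k \<le> (1 / a) ^ card {i\<in>{..<p}. z i \<noteq> 0}"
      using z a by (intro power_decreasing) (auto simp: Z_def)
    ultimately have "exp (- real k) * (1 / a) ^ k \<le> (\<Prod>i<p. \<omega> (z i))"
      using a by (simp add: mult_mono)
    then have "exp (real k) * a ^ k * (exp (- real k) * (1 / a) ^ k) \<le> exp (real k) * a ^ k * (\<Prod>i<p. \<omega> (z i))"
      using a by (intro mult_left_mono) auto
    moreover have "exp (real k) * a ^ k * (exp (- real k) * (1 / a) ^ k) = 1"
      using a by (simp add: exp_minus power_one_over field_simps)
    ultimately show ?thesis by simp
  qed
  have \<omega>_pos: "0 \<le> \<omega> z" for z using a by (auto simp: \<omega>_def)
  have sum_\<omega>: "(\<Sum>z=-N..N. \<omega> z) \<le> 1 + 2 * real k / real p"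
  proof -
    have split: "{-N..N} = {-N..-1} \<union> ({0} \<union> {1..N})" using N by auto
    have "(\<Sum>z=-N..N. \<omega> z) = (\<Sum>z=-N..-1. \<omega> z) + (1 + (\<Sum>z=1..N. \<omega> z))"
      unfolding split by (subst sum.union_disjoint; (subst sum.union_disjoint)?) (auto simp: \<omega>_def)
    also have "(\<Sum>z=-N..-1. \<omega> z) = (\<Sum>z=1..N. \<omega> z)"
      by (intro sum.reindex_bij_witness[of _ uminus uminus]) (auto simp: \<omega>_def)
    also have "(\<Sum>z=1..N. \<omega> z) = (\<Sum>z=1..N. exp (- h * real_of_int z)) / a"
      unfolding sum_divide_distrib by (intro sum.cong) (auto simp: \<omega>_def)
    also have "\<dots> \<le> (1 / h) / a" using sum_exp_neg_le[OF h, of N] a by (intro divide_right_mono) auto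
    also have "(1 / h) / a = real k / real p" using h k p by (simp add: a_def field_simps)
    finally show ?thesis using sum_exp_neg_le[OF h, of N] a by simp
  qed
  have "real (card Z) = (\<Sum>z\<in>Z. 1)" by simp
  also have "\<dots> \<le> (\<Sum>z\<in>Z. exp (real k) * a ^ k * (\<Prod>i<p. \<omega> (z i)))"
    using one by (intro sum_mono) auto
  also have "\<dots> \<le> (\<Sum>z\<in>R. exp (real k) * a ^ k * (\<Prod>i<p. \<omega> (z i)))"
    using finR ZR \<omega>_pos a by (intro sum_mono2) (auto intro!: mult_nonneg_nonneg prod_nonneg)
  also have "\<dots> = exp (real k) * a ^ k * (\<Sum>z=-N..N. \<omega> z) ^ p"
    unfolding R_def sum_distrib_left[symmetric] by (subst prod_sum_PiE[symmetric]) auto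
  also have "\<dots> \<le> exp (real k) * a ^ k * exp (2 * real k / real p) ^ p"
  proof (intro mult_left_mono power_mono)
    show "(\<Sum>z=-N..N. \<omega> z) \<le> exp (2 * real k / real p)"
      using sum_\<omega> exp_ge_add_one_self[of "2 * real k / real p"] by linarith
  qed (use a \<omega>_pos in \<open>auto intro!: sum_nonneg\<close>)
  also have "\<dots> = exp (3 * real k) * a ^ k"
    using p by (simp flip: exp_of_nat_mult exp_add)
  also have "\<dots> = (exp 3 * real p / (real k * h)) ^ k"
    by (simp add: a_def power_mult_distrib power_divide exp_of_nat_mult[symmetric] mult.commute)
  finally show "real (card Z) \<le> (exp 3 * real p / (real k * h)) ^ k" .
qed

text \<open>
  On the unit ball the sum of the absolute values of \<open>k\<close> entries is at most \<open>\<surd>k\<close>, that is \<open>k / h\<close>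
  steps of the grid.
\<close>

lemma card_grid_round:
  assumes k: "0 < k" and h: "0 < h" and kp: "real k * h \<le> real p"
    and K: "\<And>u. u \<in> K \<Longrightarrow> sparse_fun p k u \<and> L2_set u {..<p} \<le> 1"
  shows "finite (grid_round k h ` K)"
    and "real (card (grid_round k h ` K)) \<le> (exp 3 * real p / (real k * h)) ^ k"
proof -
  define Z where "Z = {z \<in> PiE {..<p} (\<lambda>_. UNIV :: int set).
     card {i\<in>{..<p}. z i \<noteq> 0} \<le> k \<and> (\<Sum>i<p. real_of_int \<bar>z i\<bar>) \<le> real k / h}"
  define \<eta> where "\<eta> = h / sqrt k"
  have \<eta>: "0 < \<eta>" using k h by (simp add: \<eta>_def)
  define F where "F z i = (if i < p then \<eta> * real_of_int (z i) else 0)" for z :: "nat \<Rightarrow> int" and i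
  have sub: "grid_round k h ` K \<subseteq> F ` Z"
  proof (rule image_subsetI)
    fix u assume u: "u \<in> K"
    obtain S where S: "S \<subseteq> {..<p}" "card S \<le> k" "\<And>i. i \<notin> S \<Longrightarrow> u i = 0"
      using K[OF u] by (auto simp: sparse_fun_def)
    define z where "z = (\<lambda>i\<in>{..<p}. if 0 \<le> u i then \<lfloor>u i / \<eta>\<rfloor> else \<lceil>u i / \<eta>\<rceil>)"
    have F: "grid_round k h u = F z"
    proof
      fix i show "grid_round k h u i = F z i"
      proof (cases "i < p")
        case False
        then have "u i = 0" using S by auto
        then show ?thesis using False by (simp add: F_def grid_round_def trunc_to_def)
      qed (simp add: F_def z_def grid_round_def trunc_to_def \<eta>_def)
    qed
    have "z i = 0" if "i < p" "i \<notin> S" for i using S(3)[OF that(2)] that(1) by (simp add: z_def)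
    then have "{i\<in>{..<p}. z i \<noteq> 0} \<subseteq> S" by auto
    then have c: "card {i\<in>{..<p}. z i \<noteq> 0} \<le> k"
      using S finite_subset[OF S(1)] by (meson card_mono finite_lessThan le_trans)
    have "\<eta> * (\<Sum>i<p. real_of_int \<bar>z i\<bar>) = (\<Sum>i<p. \<bar>trunc_to \<eta> (u i)\<bar>)"
      unfolding sum_distrib_left using \<eta> by (intro sum.cong) (auto simp: z_def trunc_to_def abs_mult)
    also have "\<dots> \<le> (\<Sum>i<p. \<bar>u i\<bar>)" using trunc_to(1)[OF \<eta>] by (intro sum_mono)
    also have "\<dots> \<le> sqrt k * L2_set u {..<p}" using K[OF u] by (intro sum_abs_sparse_le) auto
    also have "\<dots> \<le> sqrt k * 1" using K[OF u] by (intro mult_left_mono) auto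
    finally have "(\<Sum>i<p. real_of_int \<bar>z i\<bar>) \<le> sqrt k / \<eta>"
      using \<eta> by (simp add: field_simps)
    also have "sqrt k / \<eta> = real k / h" using k h by (simp add: \<eta>_def)
    finally have "z \<in> Z" using c by (auto simp: Z_def z_def)
    then show "grid_round k h u \<in> F ` Z" using F by auto
  qed
  note Z = card_sparse_lattice_points[OF k h kp, folded Z_def]
  show "finite (grid_round k h ` K)" using finite_subset[OF sub] Z(1) by auto
  have "card (grid_round k h ` K) \<le> card (F ` Z)" using sub Z(1) by (intro card_mono) auto
  also have "\<dots> \<le> card Z" using Z(1) by (rule card_image_le)
  finally show "real (card (grid_round k h ` K)) \<le> (exp 3 * real p / (real k * h)) ^ k"
    using Z(2) by linarith
qed

section \<open>Linear functionals of a Gaussian vector\<close>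

definition lin :: "nat \<Rightarrow> (nat \<Rightarrow> real) \<Rightarrow> (nat \<Rightarrow> real) \<Rightarrow> real" where
  "lin p u x = (\<Sum>i<p. u i * x i)"

text \<open>
  The Gaussian law with an explicit factor \<open>A\<close> of its covariance matrix.
\<close>

definition gvec :: "nat \<Rightarrow> (nat \<Rightarrow> nat \<Rightarrow> real) \<Rightarrow> (nat \<Rightarrow> real) measure" where
  "gvec p A = distr (\<Pi>\<^sub>M i\<in>{..<p}. density lborel std_normal_density) (Rspace p)
     (\<lambda>z. \<lambda>i\<in>{..<p}. \<Sum>j<p. A i j * z j)"

text \<open>
  The standard deviation of \<open>lin p u\<close> under \<open>gvec p A\<close>, which is the Euclidean norm of \<open>A\<^sup>T u\<close>.
\<close>

definition gsd :: "nat \<Rightarrow> (nat \<Rightarrow> nat \<Rightarrow> real) \<Rightarrow> (nat \<Rightarrow> real) \<Rightarrow> real" where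
  "gsd p A u = L2_set (\<lambda>j. \<Sum>i<p. u i * A i j) {..<p}"

lemma lin_measurable [measurable]: "lin p u \<in> borel_measurable (Rspace p)"
  unfolding lin_def Rspace_def by measurable

lemma prob_space_std_normal: "prob_space (density lborel std_normal_density)"
  by (rule prob_space_normal_density) simp

lemma factor_measurable [measurable]:
  "(\<lambda>z. \<lambda>i\<in>{..<p}. \<Sum>j<p. A i j * z j) \<in>
     measurable (\<Pi>\<^sub>M i\<in>{..<p}. density lborel std_normal_density) (Rspace p)"
proof -
  have "sets (\<Pi>\<^sub>M i\<in>{..<p}. density lborel std_normal_density) = sets (\<Pi>\<^sub>M i\<in>{..<p}. (borel :: real measure))"
    by (intro sets_PiM_cong) auto
  then show ?thesis
    unfolding Rspace_def by (subst measurable_cong_sets[OF _ refl]) (assumption, measurable)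
qed

lemma prob_space_gvec: "prob_space (gvec p A)"
  unfolding gvec_def
  by (intro prob_space.prob_space_distr prob_space_PiM prob_space_std_normal factor_measurable)

lemma sets_gvec [measurable_cong]: "sets (gvec p A) = sets (Rspace p)"
  by (simp add: gvec_def)

text \<open>
  A linear functional of \<open>A z\<close> is a weighted sum of the independent coordinates of \<open>z\<close>.  Coordinates
  of weight 0 are dropped first, since a degenerate normal law has no density.
\<close>

lemma distributed_lin_gvec:
  assumes pos: "0 < gsd p A u"
  shows "distributed (gvec p A) lborel (lin p u) (normal_density 0 (gsd p A u))"
proof -
  let ?N = "density lborel std_normal_density"
  define P where "P = (\<Pi>\<^sub>M i\<in>{..<p}. ?N)"
  interpret P: prob_space P
    unfolding P_def by (intro prob_space_PiM prob_space_std_normal)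
  define w where "w j = (\<Sum>i<p. u i * A i j)" for j
  define J where "J = {j\<in>{..<p}. w j \<noteq> 0}"
  have fJ: "finite J" by (simp add: J_def)
  have comp_meas [measurable]: "(\<lambda>z. z j) \<in> borel_measurable P" if "j < p" for j
  proof -
    have "(\<lambda>z. z j) \<in> measurable P ?N"
      unfolding P_def using that by (intro measurable_component_singleton) auto
    then show ?thesis by (simp add: measurable_cong_sets[of ?N borel])
  qed
  have comp_distr: "distr P borel (\<lambda>z. z j) = ?N" if "j < p" for j
  proof -
    have "distr P borel (\<lambda>z. z j) = distr P ?N (\<lambda>z. z j)"
      by (intro distr_cong) auto
    then show ?thesis
      using distr_PiM_component[of "{..<p}" "\<lambda>_. ?N" j] that prob_space_std_normal by (simp add: P_def)
  qed
  have comp_normal: "distributed P lborel (\<lambda>z. z j) std_normal_density" if "j < p" for j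
    unfolding distributed_def using comp_distr[OF that] that
    by (auto intro!: comp_meas simp: distr_cong[OF refl sets_lborel refl])
  have wJ: "\<And>z. (\<Sum>j\<in>J. w j * z j) = (\<Sum>j<p. w j * z j)"
    unfolding J_def by (intro sum.mono_neutral_left) auto
  have sd: "gsd p A u = sqrt (\<Sum>j\<in>J. (\<bar>w j\<bar> * 1)\<^sup>2)"
    unfolding gsd_def L2_set_def w_def[symmetric] J_def
    by (intro arg_cong[where f=sqrt] sum.mono_neutral_cong_right) auto
  have "J \<noteq> {}" using pos sd by auto
  have "P.indep_vars (\<lambda>_. borel) (\<lambda>j z. z j) {..<p}"
  proof (subst P.indep_vars_iff_distr_eq_PiM')
    show "{..<p} \<noteq> {}" using \<open>J \<noteq> {}\<close> by (auto simp: J_def)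
    have "distr P (\<Pi>\<^sub>M i\<in>{..<p}. borel) (\<lambda>z. \<lambda>i\<in>{..<p}. z i) = distr P P (\<lambda>z. z)"
    proof (rule distr_cong)
      show "sets (\<Pi>\<^sub>M i\<in>{..<p}. borel) = sets P"
        unfolding P_def by (intro sets_PiM_cong) auto
      show "(\<lambda>i\<in>{..<p}. z i) = z" if "z \<in> space P" for z
        using that by (simp add: P_def space_PiM PiE_restrict)
    qed simp
    moreover have "(\<Pi>\<^sub>M i\<in>{..<p}. distr P borel (\<lambda>z. z i)) = (\<Pi>\<^sub>M i\<in>{..<p}. ?N)"
      using comp_distr by (intro PiM_cong) auto
    ultimately show "distr P (\<Pi>\<^sub>M i\<in>{..<p}. borel) (\<lambda>z. \<lambda>i\<in>{..<p}. z i) =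
        (\<Pi>\<^sub>M i\<in>{..<p}. distr P borel (\<lambda>z. z i))"
      by (simp add: distr_id P_def[symmetric])
  qed simp
  then have "P.indep_vars (\<lambda>_. borel) (\<lambda>j z. z j) J"
    by (rule P.indep_vars_subset) (auto simp: J_def)
  then have indep: "P.indep_vars (\<lambda>_. borel) (\<lambda>j z. w j * z j) J"
    by (rule P.indep_vars_compose2) auto
  have "distributed P lborel (\<lambda>z. \<Sum>j\<in>J. w j * z j)
      (normal_density (\<Sum>j\<in>J. 0) (sqrt (\<Sum>j\<in>J. (\<bar>w j\<bar> * 1)\<^sup>2)))"
  proof (rule P.sum_indep_normal[OF fJ \<open>J \<noteq> {}\<close> indep])
    fix j assume j: "j \<in> J"
    then show "0 < \<bar>w j\<bar> * 1" by (simp add: J_def)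
    have "distributed P lborel (\<lambda>z. 0 + w j * z j) (normal_density (0 + w j * 0) (\<bar>w j\<bar> * 1))"
      using j by (intro P.normal_density_affine comp_normal) (auto simp: J_def)
    then show "distributed P lborel (\<lambda>z. w j * z j) (normal_density 0 (\<bar>w j\<bar> * 1))" by simp
  qed
  then have main: "distributed P lborel (\<lambda>z. \<Sum>j<p. w j * z j) (normal_density 0 (gsd p A u))"
    unfolding wJ sd by simp
  have lin_eq: "lin p u (\<lambda>i\<in>{..<p}. \<Sum>j<p. A i j * z j) = (\<Sum>j<p. w j * z j)" for z
    unfolding lin_def w_def
    by (simp add: sum_distrib_left sum_distrib_right mult.assoc) (rule sum.swap)
  have "distr (gvec p A) lborel (lin p u) = distr P lborel (\<lambda>z. \<Sum>j<p. w j * z j)"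
    unfolding gvec_def P_def[symmetric]
    by (subst distr_distr) (auto simp: comp_def lin_eq P_def)
  then show ?thesis using main unfolding distributed_def by simp
qed

context prob_space
begin

text \<open>
  The density is at most \<open>1 / (\<sigma> \<surd>(2 \<pi>)) \<le> 1 / (2 \<sigma>)\<close>.
\<close>

lemma normal_interval_prob:
  assumes X: "distributed M lborel X (normal_density 0 \<sigma>)" and \<sigma>: "0 < \<sigma>" and "a \<le> b"
  shows "prob {x \<in> space M. a \<le> X x \<and> X x \<le> b} \<le> (b - a) / (2 * \<sigma>)"
proof -
  have "emeasure M (X -` {a..b} \<inter> space M) = (\<integral>\<^sup>+x. ennreal (normal_density 0 \<sigma> x) * indicator {a..b} x \<partial>lborel)"
    by (intro distributed_emeasure[OF X]) auto
  also have "\<dots> \<le> (\<integral>\<^sup>+x. ennreal (1 / (2 * \<sigma>)) * indicator {a..b} x \<partial>lborel)"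
  proof (intro nn_integral_mono mult_right_mono ennreal_leI)
    fix x :: real
    have "2 * \<sigma> = sqrt (4 * \<sigma>\<^sup>2)" using \<sigma> by (simp add: real_sqrt_mult)
    also have "\<dots> \<le> sqrt (2 * pi * \<sigma>\<^sup>2)" using pi_ge_two by (intro real_sqrt_le_mono mult_right_mono) auto
    finally have "1 / sqrt (2 * pi * \<sigma>\<^sup>2) \<le> 1 / (2 * \<sigma>)" using \<sigma> by (intro divide_left_mono) auto
    moreover have "normal_density 0 \<sigma> x \<le> 1 / sqrt (2 * pi * \<sigma>\<^sup>2) * 1"
      unfolding normal_density_def by (intro mult_left_mono) auto
    ultimately show "normal_density 0 \<sigma> x \<le> 1 / (2 * \<sigma>)" by simp
  qed auto
  also have "\<dots> = ennreal ((b - a) / (2 * \<sigma>))"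
    using assms by (simp add: nn_integral_cmult_indicator flip: ennreal_mult)
  finally have "prob (X -` {a..b} \<inter> space M) \<le> (b - a) / (2 * \<sigma>)"
    using assms by (simp add: emeasure_eq_measure)
  also have "X -` {a..b} \<inter> space M = {x \<in> space M. a \<le> X x \<and> X x \<le> b}" by auto
  finally show ?thesis .
qed

lemma normal_slab_prob:
  assumes X: "distributed M lborel X (normal_density 0 \<sigma>)" and \<sigma>: "0 < \<sigma>" and t: "0 \<le> t"
  shows "prob {x \<in> space M. \<bar>\<bar>X x\<bar> - T\<bar> \<le> t} \<le> 2 * t / \<sigma>"
proof -
  have [measurable]: "X \<in> borel_measurable M" using distributed_measurable[OF X] by simp
  let ?A = "{x \<in> space M. T - t \<le> X x \<and> X x \<le> T + t}"
  let ?B = "{x \<in> space M. - T - t \<le> X x \<and> X x \<le> - T + t}"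
  have "prob {x \<in> space M. \<bar>\<bar>X x\<bar> - T\<bar> \<le> t} \<le> prob (?A \<union> ?B)"
    by (intro finite_measure_mono) auto
  also have "\<dots> \<le> prob ?A + prob ?B" by (intro measure_Un_le) auto
  also have "\<dots> \<le> (T + t - (T - t)) / (2 * \<sigma>) + (- T + t - (- T - t)) / (2 * \<sigma>)"
    using t by (intro add_mono normal_interval_prob[OF X \<sigma>]) auto
  also have "\<dots> = 2 * t / \<sigma>" by (simp add: field_simps)
  finally show ?thesis .
qed

text \<open>
  The integrand is \<open>\<surd>2\<close> times a normal density with standard deviation \<open>\<surd>2 \<sigma>\<close>.
\<close>

lemma normal_exp_square:
  assumes X: "distributed M lborel X (normal_density 0 \<sigma>)" and \<sigma>: "0 < \<sigma>"
  shows "(\<integral>\<^sup>+x. ennreal (exp ((X x)\<^sup>2 / (4 * \<sigma>\<^sup>2))) \<partial>M) = ennreal (sqrt 2)"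
proof -
  interpret N: prob_space "density lborel (normal_density 0 (sqrt 2 * \<sigma>))"
    using \<sigma> by (intro prob_space_normal_density) auto
  have "(\<integral>\<^sup>+x. ennreal (exp ((X x)\<^sup>2 / (4 * \<sigma>\<^sup>2))) \<partial>M)
      = (\<integral>\<^sup>+x. ennreal (normal_density 0 \<sigma> x) * ennreal (exp (x\<^sup>2 / (4 * \<sigma>\<^sup>2))) \<partial>lborel)"
    by (rule distributed_nn_integral[OF X, symmetric]) simp
  also have "\<dots> = (\<integral>\<^sup>+x. ennreal (sqrt 2) * ennreal (normal_density 0 (sqrt 2 * \<sigma>) x) \<partial>lborel)"
  proof (intro nn_integral_cong)
    fix x :: real
    have "normal_density 0 \<sigma> x * exp (x\<^sup>2 / (4 * \<sigma>\<^sup>2)) = sqrt 2 * normal_density 0 (sqrt 2 * \<sigma>) x"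
      using \<sigma> by (simp add: normal_density_def power_mult_distrib real_sqrt_mult flip: exp_add)
        (simp add: field_simps flip: exp_add)
    then show "ennreal (normal_density 0 \<sigma> x) * ennreal (exp (x\<^sup>2 / (4 * \<sigma>\<^sup>2)))
        = ennreal (sqrt 2) * ennreal (normal_density 0 (sqrt 2 * \<sigma>) x)"
      using \<sigma> by (simp flip: ennreal_mult)
  qed
  also have "\<dots> = ennreal (sqrt 2) * emeasure (density lborel (normal_density 0 (sqrt 2 * \<sigma>))) UNIV"
    by (subst emeasure_density) (auto simp: nn_integral_cmult)
  also have "\<dots> = ennreal (sqrt 2)" using N.emeasure_space_1 by simp
  finally show ?thesis .
qed

text \<open>
  A polynomial bound suffices here.  It follows from the exponential moment of the square by
  \<open>r exp (- r) \<le> 1\<close>.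
\<close>

lemma normal_tail_prob:
  assumes X: "distributed M lborel X (normal_density 0 \<sigma>)" and \<sigma>: "0 < \<sigma>" and t: "0 < t"
  shows "prob {x \<in> space M. t \<le> \<bar>X x\<bar>} \<le> 6 * \<sigma>\<^sup>2 / t\<^sup>2"
proof -
  have [measurable]: "X \<in> borel_measurable M" using distributed_measurable[OF X] by simp
  define r where "r = t\<^sup>2 / (4 * \<sigma>\<^sup>2)"
  have r: "0 < r" using t \<sigma> by (simp add: r_def)
  let ?B = "{x \<in> space M. t \<le> \<bar>X x\<bar>}"
  let ?u = "\<lambda>x. ennreal (exp ((X x)\<^sup>2 / (4 * \<sigma>\<^sup>2)))"
  have "?B \<subseteq> {x \<in> space M. 1 \<le> ennreal (exp (- r)) * ?u x}"
  proof safe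
    fix x assume "t \<le> \<bar>X x\<bar>"
    then have "t\<^sup>2 \<le> (X x)\<^sup>2" using t by (metis abs_le_square_iff abs_of_pos)
    then have "r \<le> (X x)\<^sup>2 / (4 * \<sigma>\<^sup>2)" unfolding r_def by (intro divide_right_mono) auto
    then show "1 \<le> ennreal (exp (- r)) * ?u x"
      by (simp flip: ennreal_mult exp_add ennreal_1)
  qed
  then have "emeasure M ?B \<le> emeasure M {x \<in> space M. 1 \<le> ennreal (exp (- r)) * ?u x}"
    by (intro emeasure_mono) auto
  also have "\<dots> \<le> ennreal (exp (- r)) * (\<integral>\<^sup>+x. ?u x * indicator (space M) x \<partial>M)"
    by (intro nn_integral_Markov_inequality) auto
  also have "(\<integral>\<^sup>+x. ?u x * indicator (space M) x \<partial>M) = (\<integral>\<^sup>+x. ?u x \<partial>M)"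
    by (intro nn_integral_cong) auto
  also have "\<dots> = ennreal (sqrt 2)" by (rule normal_exp_square[OF X \<sigma>])
  finally have "prob ?B \<le> exp (- r) * sqrt 2"
    by (simp add: emeasure_eq_measure flip: ennreal_mult)
  also have "\<dots> \<le> (1 / r) * (3 / 2)"
  proof (intro mult_mono)
    have "r \<le> exp r" using exp_ge_add_one_self[of r] by linarith
    then show "exp (- r) \<le> 1 / r" using r by (simp add: exp_minus field_simps)
    show "sqrt 2 \<le> 3 / 2" by (rule real_le_lsqrt) (auto simp: power2_eq_square)
  qed (use r in auto)
  also have "\<dots> = 6 * \<sigma>\<^sup>2 / t\<^sup>2" by (simp add: r_def)
  finally show ?thesis .
qed

end

text \<open>
  A pair with first component \<open>True\<close> stands for the complement of a slab, one with \<open>False\<close> for a slab.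
  One statement then covers both counts in the definition of depth.
\<close>

definition band :: "bool \<times> real \<Rightarrow> real set" where
  "band h = {x. if fst h then snd h \<le> \<bar>x\<bar> else \<bar>x\<bar> \<le> snd h}"

text \<open>
  Both kinds of bands grow under this operation when \<open>e > 0\<close>.
\<close>

definition widen :: "real \<Rightarrow> bool \<times> real \<Rightarrow> bool \<times> real" where
  "widen e h = (fst h, if fst h then snd h - e else snd h + e)"

lemma band_measurable [measurable]: "band h \<in> sets borel"
  unfolding band_def by measurable

text \<open>
  Two functionals fall on different sides of a band only if one of them is close to its edge or
  their difference is large.  This is the only property of bands that the chaining bound uses.
\<close>

lemma band_edge: "(x \<in> band h) \<noteq> (y \<in> band h) \<Longrightarrow> \<bar>\<bar>x\<bar> - snd h\<bar> \<le> \<bar>x - y\<bar>"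
  by (auto simp: band_def split: if_splits)

lemma band_widen: "x \<in> band h \<Longrightarrow> \<bar>x - y\<bar> < e \<Longrightarrow> y \<in> band (widen e h)"
  by (auto simp: band_def widen_def split: if_splits)


text \<open>
  The median exists by continuity.  The constant \<open>c\<close> is the normal density at \<open>\<tau> + 1\<close>, a lower bound
  for the density between \<open>\<tau> - b\<close> and \<open>\<tau> + b\<close>; it quantifies how fast the two probabilities leave
  the value 1/2.
\<close>

lemma normal_median:
  obtains \<tau> c where "0 < \<tau>" "0 < c"
    and "measure (density lborel std_normal_density) (band (True, \<tau>)) = 1 / 2"
    and "measure (density lborel std_normal_density) (band (False, \<tau>)) = 1 / 2"
    and "\<And>b. 0 \<le> b \<Longrightarrow> b \<le> 1 \<Longrightarrow> b \<le> \<tau> \<Longrightarrow>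
      measure (density lborel std_normal_density) (band (True, \<tau> + b)) \<le> 1 / 2 - c * b"
    and "\<And>b. 0 \<le> b \<Longrightarrow> b \<le> 1 \<Longrightarrow> b \<le> \<tau> \<Longrightarrow>
      measure (density lborel std_normal_density) (band (False, \<tau> - b)) \<le> 1 / 2 - c * b"
proof -
  define \<nu> where "\<nu> = density lborel std_normal_density"
  interpret N: prob_space \<nu> unfolding \<nu>_def by (rule prob_space_std_normal)
  have sets_\<nu> [measurable_cong]: "sets \<nu> = sets borel" by (simp add: \<nu>_def)
  have space_\<nu>: "space \<nu> = UNIV" by (simp add: \<nu>_def)
  have id: "distributed \<nu> lborel (\<lambda>x. x) (normal_density 0 1)"
    unfolding distributed_def by (auto simp: \<nu>_def distr_id2)
  have interval: "measure \<nu> {x. a \<le> x \<and> x \<le> b} \<le> (b - a) / 2" if "a \<le> b" for a b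
    using N.normal_interval_prob[of "\<lambda>x. x" 1 a b] id that by (simp add: space_\<nu>)
  define m where "m T = measure \<nu> (band (False, T))" for T
  have m_True: "measure \<nu> (band (True, T)) = 1 - m T" for T
  proof -
    have point: "measure \<nu> {a} = 0" for a
    proof -
      have "{x. a \<le> x \<and> x \<le> a} = {a}" by auto
      then show ?thesis using interval[of a a] measure_nonneg[of \<nu> "{a}"] by simp
    qed
    have "measure \<nu> ({T} \<union> {- T}) \<le> 0"
      using measure_Un_le[of "{T}" \<nu> "{- T}"] by (simp add: sets_\<nu> point)
    then have null: "measure \<nu> {T, - T} = 0"
      using measure_nonneg[of \<nu> "{T, - T}"] by (simp add: insert_commute)
    have "measure \<nu> (band (True, T)) = measure \<nu> ((UNIV - band (False, T)) \<union> ({T, - T} \<inter> band (True, T)))"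
      by (intro arg_cong[where f="measure \<nu>"]) (auto simp: band_def)
    also have "\<dots> = measure \<nu> (UNIV - band (False, T))"
    proof (rule measure_Un_null_set)
      have "emeasure \<nu> ({T, - T} \<inter> band (True, T)) \<le> emeasure \<nu> {T, - T}"
        by (intro emeasure_mono) (auto simp: sets_\<nu>)
      then show "{T, - T} \<inter> band (True, T) \<in> null_sets \<nu>"
        using null by (auto simp: null_sets_def N.emeasure_eq_measure sets_\<nu> band_measurable intro!: sets.Int)
    qed (auto simp: sets_\<nu>)
    also have "\<dots> = 1 - m T"
      using N.prob_compl[of "band (False, T)"] by (simp add: m_def space_\<nu> sets_\<nu>)
    finally show ?thesis .
  qed
  have m_0: "m 0 = 0"
  proof -
    have "band (False, 0) = {x. 0 \<le> x \<and> x \<le> 0}" by (auto simp: band_def)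
    then have "m 0 \<le> 0" using interval[of 0 0] by (simp only: m_def) simp
    moreover have "0 \<le> m 0" by (simp add: m_def)
    ultimately show ?thesis by simp
  qed
  have m_4: "1 / 2 \<le> m 4"
  proof -
    have "measure \<nu> (band (True, 4)) \<le> 6 * 1\<^sup>2 / 4\<^sup>2"
      using N.normal_tail_prob[of "\<lambda>x. x" 1 4] id by (simp add: space_\<nu> band_def)
    then show ?thesis unfolding m_True by simp
  qed
  have m_diff: "\<bar>m T' - m T\<bar> \<le> \<bar>T' - T\<bar>" for T T'
  proof (induction T T' rule: linorder_wlog)
    case (le T T')
    have mono: "m T \<le> m T'"
      unfolding m_def using le by (intro N.finite_measure_mono) (auto simp: band_def sets_\<nu>)
    have "m T' \<le> measure \<nu> (band (False, T) \<union> ({x. T \<le> x \<and> x \<le> T'} \<union> {x. - T' \<le> x \<and> x \<le> - T}))"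
      unfolding m_def by (intro N.finite_measure_mono) (auto simp: band_def sets_\<nu> intro!: sets.Un)
    also have "\<dots> \<le> m T + measure \<nu> ({x. T \<le> x \<and> x \<le> T'} \<union> {x. - T' \<le> x \<and> x \<le> - T})"
      unfolding m_def by (intro measure_Un_le) (auto simp: sets_\<nu>)
    also have "measure \<nu> ({x. T \<le> x \<and> x \<le> T'} \<union> {x. - T' \<le> x \<and> x \<le> - T}) \<le>
        measure \<nu> {x. T \<le> x \<and> x \<le> T'} + measure \<nu> {x. - T' \<le> x \<and> x \<le> - T}"
      by (intro measure_Un_le) (auto simp: sets_\<nu>)
    also have "\<dots> \<le> (T' - T) / 2 + (T' - T) / 2"
      using interval[of T T'] interval[of "- T'" "- T"] le by (intro add_mono) auto
    finally show ?case using mono le by simp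
  next
    case (sym T T')
    then show ?case by (simp add: abs_minus_commute)
  qed
  have "continuous_on {0..4} m"
  proof (rule lipschitz_on_continuous_on)
    show "1-lipschitz_on {0..4} m"
      by (rule lipschitz_onI) (auto simp: dist_real_def m_diff)
  qed
  then obtain \<tau> where \<tau>: "0 \<le> \<tau>" "\<tau> \<le> 4" "m \<tau> = 1 / 2"
    using IVT'[of m 0 "1 / 2" 4] m_0 m_4 by auto
  have \<tau>_pos: "0 < \<tau>" using \<tau> m_0 by (cases "\<tau> = 0") auto
  define c where "c = std_normal_density (\<tau> + 1)"
  have c: "0 < c" unfolding c_def by (rule normal_density_pos) simp
  have lower: "c * (b - a) \<le> measure \<nu> {a<..b}" if "0 \<le> a" "a \<le> b" "b \<le> \<tau> + 1" for a b
  proof -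
    have "ennreal (c * (b - a)) = (\<integral>\<^sup>+x. ennreal c * indicator {a<..b} x \<partial>lborel)"
      using that c by (simp add: nn_integral_cmult_indicator ennreal_mult)
    also have "\<dots> \<le> (\<integral>\<^sup>+x. ennreal (std_normal_density x) * indicator {a<..b} x \<partial>lborel)"
    proof (intro nn_integral_mono)
      fix x :: real
      show "ennreal c * indicator {a<..b} x \<le> ennreal (std_normal_density x) * indicator {a<..b} x"
      proof (cases "x \<in> {a<..b}")
        case True
        then have "x\<^sup>2 \<le> (\<tau> + 1)\<^sup>2" using that by (intro power_mono) auto
        then have "c \<le> std_normal_density x"
          unfolding c_def std_normal_density_def by (intro mult_left_mono) auto
        then show ?thesis using True by (simp add: ennreal_leI)
      qed simp
    qed
    also have "\<dots> = emeasure \<nu> {a<..b}" unfolding \<nu>_def by (intro emeasure_density[symmetric]) auto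
    finally show ?thesis using c that by (simp add: N.emeasure_eq_measure)
  qed
  have m_step: "m a + c * (b - a) \<le> m b" if "0 \<le> a" "a \<le> b" "b \<le> \<tau> + 1" for a b
  proof -
    have "m a + measure \<nu> {a<..b} = measure \<nu> (band (False, a) \<union> {a<..b})"
      unfolding m_def by (intro N.finite_measure_Union[symmetric]) (auto simp: sets_\<nu> band_def)
    also have "\<dots> \<le> m b"
      unfolding m_def using that by (intro N.finite_measure_mono) (auto simp: band_def sets_\<nu>)
    finally show ?thesis using lower[OF that] by simp
  qed
  show ?thesis
  proof (rule that[of \<tau> c, folded \<nu>_def, OF \<tau>_pos c])
    show "measure \<nu> (band (True, \<tau>)) = 1 / 2" using m_True \<tau> by simp
    show "measure \<nu> (band (False, \<tau>)) = 1 / 2" using \<tau> by (simp add: m_def)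
    fix b :: real assume b: "0 \<le> b" "b \<le> 1" "b \<le> \<tau>"
    show "measure \<nu> (band (True, \<tau> + b)) \<le> 1 / 2 - c * b"
      using m_True[of "\<tau> + b"] m_step[of \<tau> "\<tau> + b"] b \<tau> by simp
    show "measure \<nu> (band (False, \<tau> - b)) \<le> 1 / 2 - c * b"
      using m_step[of "\<tau> - b" \<tau>] b \<tau> by (simp add: m_def)
  qed
qed

section \<open>Uniform deviations over sparse directions\<close>

lemma lin_diff: "lin p (\<lambda>i. u i - v i) x = lin p u x - lin p v x"
  by (simp add: lin_def left_diff_distrib sum_subtractf)

lemma lin_scale: "lin p (\<lambda>i. c * u i) x = c * lin p u x"
  by (simp add: lin_def sum_distrib_left mult.assoc)

lemma gsd_add: "gsd p A (\<lambda>i. u i + v i) \<le> gsd p A u + gsd p A v"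
  using L2_set_triangle_ineq[of "\<lambda>j. \<Sum>i<p. u i * A i j" "\<lambda>j. \<Sum>i<p. v i * A i j" "{..<p}"]
  by (simp add: gsd_def distrib_right sum.distrib)

lemma gsd_nonneg: "0 \<le> gsd p A u" by (simp add: gsd_def L2_set_nonneg)

lemma gsd_scale: "gsd p A (\<lambda>i. c * u i) = \<bar>c\<bar> * gsd p A u"
proof -
  have "(\<lambda>j. \<Sum>i<p. c * u i * A i j) = (\<lambda>j. c * (\<Sum>i<p. u i * A i j))"
    by (simp add: sum_distrib_left mult.assoc)
  then show ?thesis
    unfolding gsd_def by (simp add: L2_set_def power_mult_distrib sum_distrib_left[symmetric] real_sqrt_mult)
qed

lemma gsd_diff_commute: "gsd p A (\<lambda>i. u i - v i) = gsd p A (\<lambda>i. v i - u i)"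
  using gsd_scale[of p A "-1" "\<lambda>i. v i - u i"] by simp

lemma gsd_diff: "gsd p A u \<le> gsd p A v + gsd p A (\<lambda>i. u i - v i)"
  using gsd_add[of p A v "\<lambda>i. u i - v i"] by simp

text \<open>
  \<open>A\<close> is a factor of the covariance matrix, whose smallest eigenvalue is at least 1 and whose largest one is
  at most \<open>\<kappa>\<^sup>2\<close>.
\<close>

locale gauss_model =
  fixes p :: nat and A :: "nat \<Rightarrow> nat \<Rightarrow> real" and \<kappa> :: real
  assumes \<kappa>: "1 \<le> \<kappa>"
    and lower: "\<And>u. L2_set u {..<p} \<le> gsd p A u"
    and upper: "\<And>u. gsd p A u \<le> \<kappa> * L2_set u {..<p}"
begin

abbreviation "G \<equiv> gvec p A"
abbreviation "\<sigma> \<equiv> gsd p A"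

sublocale G: prob_space G by (rule prob_space_gvec)

lemma lin_eq_0: "\<sigma> v = 0 \<Longrightarrow> lin p v x = 0"
proof -
  assume "\<sigma> v = 0"
  then have "L2_set v {..<p} = 0" using lower[of v] L2_set_nonneg[of v "{..<p}"] by simp
  then have "v i = 0" if "i < p" for i using that by (simp add: L2_set_eq_0_iff)
  then show ?thesis by (simp add: lin_def)
qed

lemma lin_G_measurable [measurable]: "lin p v \<in> borel_measurable G"
  by (simp add: measurable_cong_sets[OF sets_gvec refl])

lemma lin_tail_prob: "0 < t \<Longrightarrow> measure G {x \<in> space G. t \<le> \<bar>lin p v x\<bar>} \<le> 6 * (\<sigma> v)\<^sup>2 / t\<^sup>2"
  using G.normal_tail_prob[OF distributed_lin_gvec, of v t] gsd_nonneg[of p A v]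
  by (cases "\<sigma> v = 0") (auto simp: lin_eq_0)

lemma exp_square_le:
  assumes "\<sigma> v \<le> \<kappa>"
  shows "(\<integral>\<^sup>+x. ennreal (exp ((lin p v x)\<^sup>2 / (4 * \<kappa>\<^sup>2))) \<partial>G) \<le> ennreal (exp 1)"
proof (cases "\<sigma> v = 0")
  case True
  then have "(\<integral>\<^sup>+x. ennreal (exp ((lin p v x)\<^sup>2 / (4 * \<kappa>\<^sup>2))) \<partial>G) = 1"
    by (simp add: lin_eq_0 G.emeasure_space_1)
  also have "\<dots> \<le> ennreal (exp 1)" by simp
  finally show ?thesis .
next
  case False
  then have pos: "0 < \<sigma> v" using gsd_nonneg[of p A v] by simp
  have "(\<integral>\<^sup>+x. ennreal (exp ((lin p v x)\<^sup>2 / (4 * \<kappa>\<^sup>2))) \<partial>G) \<le>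
        (\<integral>\<^sup>+x. ennreal (exp ((lin p v x)\<^sup>2 / (4 * (\<sigma> v)\<^sup>2))) \<partial>G)"
    using pos assms by (intro nn_integral_mono ennreal_leI) (auto intro!: divide_left_mono)
  also have "\<dots> = ennreal (sqrt 2)"
    by (rule G.normal_exp_square[OF distributed_lin_gvec[OF pos] pos])
  also have "\<dots> \<le> ennreal (exp 1)"
  proof (rule ennreal_leI)
    have "sqrt 2 \<le> (2::real)" by (rule real_le_lsqrt) auto
    also have "\<dots> \<le> exp 1" using exp_ge_add_one_self[of 1] by simp
    finally show "sqrt 2 \<le> exp (1::real)" .
  qed
  finally show ?thesis .
qed

text \<open>
  Whether a functional lies in the band changes only if it is within \<open>t\<close> of the edge, or if the two
  functionals differ by at least \<open>t\<close>.  Both events involve a single normal variable.  The resulting bound is of the order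
  \<open>\<parallel>b - a\<parallel>\<^sup>2\<^sup>/\<^sup>3\<close> for the best \<open>t\<close>; this loss against \<open>\<parallel>b - a\<parallel>\<close> is harmless for chaining.
\<close>

lemma band_change:
  assumes a: "1 / 2 \<le> \<sigma> a" and t: "0 < t"
  shows "measure G {x \<in> space G. (lin p a x \<in> band h) \<noteq> (lin p b x \<in> band h)}
      \<le> 4 * t + 6 * (\<sigma> (\<lambda>i. b i - a i))\<^sup>2 / t\<^sup>2"
    (is "measure G ?B \<le> _")
proof -
  let ?S = "{x \<in> space G. \<bar>\<bar>lin p a x\<bar> - snd h\<bar> \<le> t}"
  let ?T = "{x \<in> space G. t \<le> \<bar>lin p (\<lambda>i. b i - a i) x\<bar>}"
  have "?B \<subseteq> ?S \<union> ?T"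
  proof
    fix x assume x: "x \<in> ?B"
    then have "\<bar>\<bar>lin p a x\<bar> - snd h\<bar> \<le> \<bar>lin p (\<lambda>i. b i - a i) x\<bar>"
      using band_edge[of "lin p a x" h "lin p b x"] by (simp add: lin_diff abs_minus_commute)
    then show "x \<in> ?S \<union> ?T" using x by auto
  qed
  then have "measure G ?B \<le> measure G (?S \<union> ?T)" by (intro G.finite_measure_mono) (assumption, measurable)
  also have "\<dots> \<le> measure G ?S + measure G ?T" by (intro measure_Un_le) auto
  also have "\<dots> \<le> 2 * t / \<sigma> a + 6 * (\<sigma> (\<lambda>i. b i - a i))\<^sup>2 / t\<^sup>2"
    using a t by (intro add_mono lin_tail_prob G.normal_slab_prob distributed_lin_gvec) auto
  also have "2 * t / \<sigma> a \<le> 2 * t / (1 / 2)" using a t by (intro divide_left_mono) auto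
  finally show ?thesis by simp
qed

end

text \<open>
  \<open>D / n\<close> is the squared deviation rate and \<open>J\<close> the last scale of the chain.  The set \<open>\<T>\<close> collects the bands
  that are to be controlled simultaneously.
\<close>

locale gauss_sample = gauss_model +
  fixes s n J :: nat and D :: real and \<T> :: "(bool \<times> real) set"
  assumes s: "0 < s" "2 * s \<le> p" and n: "0 < n"
    and D: "real s * (1 + ln (real p / real s)) \<le> D" "D \<le> real n"
    and J: "2 ^ J * sqrt (D / real n) \<le> 1" "1 \<le> 2 * 2 ^ J * sqrt (D / real n)"
    and \<T>: "finite \<T>" "card \<T> \<le> 4"
begin

definition "k = 2 * s"
definition "y = D / real n"

text \<open>
  Even rounding to the coarsest mesh changes a standard deviation by at most 1/2, so the standard
  deviations of the functionals in the chain stay away from 0.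
\<close>

definition "mesh j = 1 / (2 * \<kappa> * 8 ^ j)" for j :: nat
definition "K = {u. sparse_fun p k u \<and> \<sigma> u = 1}"

text \<open>
  The constant in the entropy bound: \<open>exp (c D (1 + j))\<close> bounds the size of the \<open>j\<close>-th net.
\<close>

definition "c = 6 + 2 * ln (2 * \<kappa>)"

abbreviation "\<rho> \<equiv> grid_round k (mesh J)"

text \<open>
  Only upper bounds occur, each on a sum of nonnegative terms over \<open>I\<close>, so the property is inherited by smaller
  \<open>I\<close>.  Both nets are finite.  The right-hand sides refer to \<open>n\<close> and not to the cardinality of \<open>I\<close>.
\<close>

definition good :: "nat set \<Rightarrow> (nat \<Rightarrow> nat \<Rightarrow> real) \<Rightarrow> bool" where
  "good I X \<longleftrightarrow>
     (\<forall>h\<in>\<T>. \<forall>w\<in>\<rho> ` K.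
        (\<Sum>i\<in>I. of_bool (lin p w (X i) \<in> band (widen (sqrt y) h)))
        \<le> real n * (measure G {x \<in> space G. lin p w x \<in> band (widen (sqrt y) h)} + (21 + 18 * c) * sqrt y)) \<and>
     (\<forall>w\<in>grid_round k (1 / 2) ` {u. sparse_fun p k u \<and> L2_set u {..<p} \<le> 1}.
        (\<Sum>i\<in>I. (lin p w (X i))\<^sup>2) \<le> 4 * \<kappa>\<^sup>2 * (1 + 2 * c) * real n)"

lemma k_pos: "0 < k" "k \<le> p" using s by (auto simp: k_def)

text \<open>
  Constants and multiples of \<open>s\<close> can be absorbed into multiples of \<open>D\<close>.
\<close>

lemma D_ge: "1 \<le> D" "0 < D" "real s \<le> D"
proof -
  have "0 \<le> ln (real p / real s)" using s by simp
  then have *: "0 \<le> real s * ln (real p / real s)" by simp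
  have "real s + real s * ln (real p / real s) \<le> D" using D(1) by (simp add: algebra_simps)
  then show "real s \<le> D" using * by linarith
  then show "1 \<le> D" "0 < D" using s by linarith+
qed

lemma y_bounds: "0 < y" "y \<le> 1" "real n * y = D"
  using D_ge D n by (auto simp: y_def)

lemma sqrt_y: "0 < sqrt y" "sqrt y \<le> 1" "sqrt y * sqrt y = y" "y \<le> sqrt y"
proof -
  show "0 < sqrt y" "sqrt y \<le> 1" "sqrt y * sqrt y = y" using y_bounds by auto
  then show "y \<le> sqrt y" by (metis mult_left_le less_imp_le)
qed

lemma c_ge: "6 \<le> c" using \<kappa> by (simp add: c_def)

lemma mesh_pos: "0 < mesh j" "mesh j \<le> 1" "\<kappa> * mesh j = 1 / (2 * 8 ^ j)"
proof -
  have "1 \<le> 2 * \<kappa> * 8 ^ j"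
    using \<kappa> mult_mono[of 1 "2 * \<kappa>" 1 "8 ^ j"] by simp
  then show "mesh j \<le> 1" by (simp add: mesh_def)
qed (use \<kappa> in \<open>auto simp: mesh_def\<close>)

lemma K_dest: "u \<in> K \<Longrightarrow> sparse_fun p k u" "u \<in> K \<Longrightarrow> \<sigma> u = 1" "u \<in> K \<Longrightarrow> L2_set u {..<p} \<le> 1"
  using lower by (auto simp: K_def) (metis lower)

text \<open>
  The cardinality of the grid is at most \<open>(exp 3 p / (k h))\<^sup>k\<close>; its logarithm is split into the part
  \<open>s log (e p / s)\<close>, which is independent of the scale, and the part \<open>O(s (1 + j))\<close>.
\<close>

lemma entropy:
  assumes h: "1 / (2 * \<kappa> * 8 ^ j) \<le> h" "h \<le> 1"
    and K': "\<And>u. u \<in> K' \<Longrightarrow> sparse_fun p k u \<and> L2_set u {..<p} \<le> 1"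
  shows "finite (grid_round k h ` K')" "real (card (grid_round k h ` K')) \<le> exp (c * D * (1 + real j))"
proof -
  have h0: "0 < h" using h(1) mesh_pos(1)[of j] unfolding mesh_def by linarith
  have kh: "real k * h \<le> real p"
    using k_pos h h0 mult_left_mono[of h 1 "real k"] by (smt (verit) mult.right_neutral of_nat_0_le_iff of_nat_mono)
  show "finite (grid_round k h ` K')" using card_grid_round(1)[OF k_pos(1) h0 kh] K' by blast
  define b where "b = exp 3 * real p / (real k * h)"
  have b: "0 < b" using h0 k_pos by (simp add: b_def)
  have "real (card (grid_round k h ` K')) \<le> b ^ k"
    unfolding b_def using card_grid_round(2)[OF k_pos(1) h0 kh] K' by blast
  also have "b ^ k = exp (real k * ln b)" using b by (simp add: exp_of_nat_mult)
  also have "\<dots> \<le> exp (c * D * (1 + real j))"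
  proof -
    have "b \<le> exp 3 * (real p / real s) * (2 * \<kappa> * 8 ^ j)"
    proof -
      have "1 / h \<le> 2 * \<kappa> * 8 ^ j"
        using h h0 \<kappa> by (simp add: field_simps)
      then have "exp 3 * (real p / real k) * (1 / h) \<le> exp 3 * (real p / real s) * (2 * \<kappa> * 8 ^ j)"
        using s h0 by (intro mult_mono) (auto simp: k_def field_simps)
      then show ?thesis by (simp add: b_def)
    qed
    then have "ln b \<le> ln (exp 3 * (real p / real s) * (2 * \<kappa> * 8 ^ j))"
      using b by (subst ln_le_cancel_iff) auto
    also have "\<dots> = 3 + ln (real p / real s) + (ln (2 * \<kappa>) + real j * ln 8)"
    proof -
      have "0 < real p / real s" using s by simp
      moreover have "0 < 2 * \<kappa>" using \<kappa> by simp
      ultimately have "ln (exp 3 * q * (r * 8 ^ j)) = 3 + ln q + (ln r + real j * ln 8)"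
        if "q = real p / real s" "r = 2 * \<kappa>" for q r :: real
        unfolding that[symmetric] by (simp add: ln_mult ln_realpow)
      then show ?thesis by blast
    qed
    also have "\<dots> \<le> 3 + ln (real p / real s) + (ln (2 * \<kappa>) + real j * 3)"
    proof -
      have "ln 8 \<le> (3::real)"
      proof -
        have "(2::real) ^ 3 \<le> exp 1 ^ 3"
          using exp_ge_add_one_self[of "1::real"] by (intro power_mono) auto
        then have "8 \<le> exp (3::real)" by (simp flip: exp_of_nat_mult)
        then show ?thesis by (metis exp_gt_zero ln_exp ln_le_cancel_iff order_less_le_trans zero_less_numeral)
      qed
      then show ?thesis by (intro add_left_mono mult_left_mono) auto
    qed
    finally have "real s * ln b \<le> real s * (3 + ln (real p / real s) + (ln (2 * \<kappa>) + real j * 3))"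
      by (intro mult_left_mono) auto
    also have "\<dots> = real s * (1 + ln (real p / real s)) + real s * (2 + ln (2 * \<kappa>) + real j * 3)"
      by (simp add: algebra_simps)
    also have "\<dots> \<le> D + D * (2 + ln (2 * \<kappa>) + real j * 3)"
      using D D_ge \<kappa> by (intro add_mono mult_right_mono) auto
    also have "\<dots> \<le> D * (3 + ln (2 * \<kappa>)) * (1 + real j)"
    proof -
      have "0 \<le> D * (ln (2 * \<kappa>) * real j)" using D_ge \<kappa> by simp
      then show ?thesis by (simp add: algebra_simps)
    qed
    finally show ?thesis by (simp add: k_def c_def algebra_simps)
  qed
  finally show "real (card (grid_round k h ` K')) \<le> exp (c * D * (1 + real j))" .
qed

lemma mesh_approx:
  assumes "u \<in> K"
  shows "L2_set (\<lambda>i. u i - grid_round k (mesh j) u i) {..<p} \<le> mesh j"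
    and "\<sigma> (\<lambda>i. u i - grid_round k (mesh j) u i) \<le> 1 / (2 * 8 ^ j)"
    and "1 / 2 \<le> \<sigma> (grid_round k (mesh j) u)"
proof -
  show 1: "L2_set (\<lambda>i. u i - grid_round k (mesh j) u i) {..<p} \<le> mesh j"
    by (rule grid_round(4)[OF k_pos(1) mesh_pos(1) K_dest(1)[OF assms]])
  have "\<sigma> (\<lambda>i. u i - grid_round k (mesh j) u i) \<le> \<kappa> * mesh j"
    using upper[of "\<lambda>i. u i - grid_round k (mesh j) u i"] 1 \<kappa> by (meson mult_left_mono order_trans zero_le_one)
  then show 2: "\<sigma> (\<lambda>i. u i - grid_round k (mesh j) u i) \<le> 1 / (2 * 8 ^ j)"
    by (simp add: mesh_pos)
  have "1 / (2 * 8 ^ j) \<le> (1 / 2 :: real)" by (simp add: field_simps)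
  then show "1 / 2 \<le> \<sigma> (grid_round k (mesh j) u)"
    using gsd_diff[of p A u "grid_round k (mesh j) u"] 2 K_dest(2)[OF assms] by linarith
qed

text \<open>
  The nets at scale \<open>j\<close> have mesh proportional to \<open>8\<^sup>-\<^sup>j\<close>.  Taking \<open>t = 4\<^sup>-\<^sup>j\<close> in the bound for the change
  of a band gives links of variance \<open>O(4\<^sup>-\<^sup>j)\<close>.
\<close>

lemma uniform_deviation:
  "measure (iid_sample n G) {X \<in> space (iid_sample n G). \<exists>u\<in>K.
      real n * (measure G {x \<in> space G. lin p (\<rho> u) x \<in> band h} + (21 + 18 * c) * sqrt y)
      < (\<Sum>i<n. of_bool (lin p (\<rho> u) (X i) \<in> band h))} \<le> 3 * exp (- (c * D))"
proof -
  define f where "f w x = (indicator (band h) (lin p w x) :: real)" for w x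
  have f_int: "(\<integral>x. f w x \<partial>G) = measure G {x \<in> space G. lin p w x \<in> band h}" for w
  proof -
    have "(\<integral>x. f w x \<partial>G) = (\<integral>x. indicator {x \<in> space G. lin p w x \<in> band h} x \<partial>G)"
      by (intro Bochner_Integration.integral_cong) (auto simp: f_def indicator_def)
    moreover have "{x \<in> space G. lin p w x \<in> band h} \<inter> space G = {x \<in> space G. lin p w x \<in> band h}"
      by auto
    ultimately show ?thesis by simp
  qed
  have "measure (iid_sample n G) {X \<in> space (iid_sample n G). \<exists>u\<in>K.
      real n * ((\<integral>x. f (grid_round k (mesh J) u) x \<partial>G) + (1 + 2 * 10 + 18 * c) * sqrt y)
      < (\<Sum>i<n. f (grid_round k (mesh J) u) (X i))} \<le> 3 * exp (- (c * D))"
  proof (rule chaining)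
    show "prob_space G" by (rule G.prob_space_axioms)
    show "f u \<in> borel_measurable G" for u unfolding f_def by measurable
    show "0 \<le> f u x \<and> f u x \<le> 1" for u x by (simp add: f_def)
    show "finite (grid_round k (mesh j) ` K)" "real (card (grid_round k (mesh j) ` K)) \<le> exp (c * D * (1 + real j))" for j
      using entropy[of j "mesh j" K] mesh_pos[of j] K_dest by (auto simp: mesh_def)
    show "1 \<le> c * D" using c_ge D_ge mult_mono[of 1 c 1 D] by simp
    show "c * D = c * real n * y" using y_bounds by simp
    show "2 ^ J * sqrt y \<le> 1" using J by (simp add: y_def)
    fix u j assume u: "u \<in> K"
    let ?a = "grid_round k (mesh j) u" and ?b = "grid_round k (mesh (Suc j)) u"
    have dist: "\<sigma> (\<lambda>i. ?b i - ?a i) \<le> 1 / 8 ^ j"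
    proof -
      have "\<sigma> (\<lambda>i. ?b i - ?a i) \<le> \<sigma> (\<lambda>i. u i - ?a i) + \<sigma> (\<lambda>i. ?b i - u i)"
        using gsd_add[of p A "\<lambda>i. u i - ?a i" "\<lambda>i. ?b i - u i"] by simp
      also have "\<dots> \<le> 1 / (2 * 8 ^ j) + 1 / (2 * 8 ^ Suc j)"
        using mesh_approx(2)[OF u, of j] mesh_approx(2)[OF u, of "Suc j"]
        unfolding gsd_diff_commute[of p A ?b u] by (rule add_mono)
      also have "\<dots> \<le> 1 / 8 ^ j" by (simp add: field_simps)
      finally show ?thesis .
    qed
    have "(\<integral>x. (f ?b x - f ?a x)\<^sup>2 \<partial>G) =
        (\<integral>x. indicator {x \<in> space G. (lin p ?a x \<in> band h) \<noteq> (lin p ?b x \<in> band h)} x \<partial>G)"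
      by (intro Bochner_Integration.integral_cong) (auto simp: f_def indicator_def)
    also have "\<dots> = measure G {x \<in> space G. (lin p ?a x \<in> band h) \<noteq> (lin p ?b x \<in> band h)}"
      by simp
    also have "\<dots> \<le> 4 * (1 / 4 ^ j) + 6 * (\<sigma> (\<lambda>i. ?b i - ?a i))\<^sup>2 / (1 / 4 ^ j)\<^sup>2"
      by (intro band_change mesh_approx(3) u) simp
    also have "\<dots> \<le> 4 * (1 / 4 ^ j) + 6 * (1 / 8 ^ j)\<^sup>2 / (1 / 4 ^ j)\<^sup>2"
      using dist gsd_nonneg by (intro add_mono divide_right_mono mult_left_mono power_mono) auto
    also have "(1 / 8 ^ j)\<^sup>2 / (1 / 4 ^ j)\<^sup>2 = (1 / 4 ^ j :: real)"
    proof -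
      have "(8::real) ^ j * 8 ^ j = 4 ^ j * (4 ^ j * 4 ^ j)"
        by (simp flip: power_mult_distrib)
      then show ?thesis by (simp add: power2_eq_square)
    qed
    then have "4 * (1 / 4 ^ j) + 6 * (1 / 8 ^ j)\<^sup>2 / (1 / 4 ^ j)\<^sup>2 = (10::real) / 4 ^ j" by simp
    finally show "(\<integral>x. (f ?b x - f ?a x)\<^sup>2 \<partial>G) \<le> 10 / 4 ^ j" .
  qed (use c_ge y_bounds in auto)
  then show ?thesis unfolding f_int by (simp add: f_def indicator_def of_bool_def)
qed

text \<open>
  The squares have exponential moments, and \<open>D \<le> n\<close> keeps the deviation within a constant factor of
  the mean.
\<close>

lemma second_moment_deviation:
  assumes w: "sparse_fun p k w" "L2_set w {..<p} \<le> 1"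
  shows "measure (iid_sample n G) {X \<in> space (iid_sample n G).
      4 * \<kappa>\<^sup>2 * (1 + 2 * c) * real n < (\<Sum>i<n. (lin p w (X i))\<^sup>2)} \<le> exp (- (2 * c * D))"
proof -
  have "\<sigma> w \<le> \<kappa>" using upper[of w] w \<kappa> mult_left_mono[of "L2_set w {..<p}" 1 \<kappa>] by linarith
  then have "measure (iid_sample n G) {X \<in> space (iid_sample n G).
      real n * 1 + 2 * c * D \<le> (\<Sum>i<n. (lin p w (X i))\<^sup>2 / (4 * \<kappa>\<^sup>2))} \<le> exp (- (2 * c * D))"
    by (intro chernoff_iid exp_square_le G.prob_space_axioms) auto
  moreover have "measure (iid_sample n G) {X \<in> space (iid_sample n G).
      4 * \<kappa>\<^sup>2 * (1 + 2 * c) * real n < (\<Sum>i<n. (lin p w (X i))\<^sup>2)} \<le>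
     measure (iid_sample n G) {X \<in> space (iid_sample n G).
      real n * 1 + 2 * c * D \<le> (\<Sum>i<n. (lin p w (X i))\<^sup>2 / (4 * \<kappa>\<^sup>2))}"
  proof (rule finite_measure.finite_measure_mono)
    show "finite_measure (iid_sample n G)"
      by (intro prob_space.finite_measure prob_space_iid_sample G.prob_space_axioms)
    show "{X \<in> space (iid_sample n G). real n * 1 + 2 * c * D \<le> (\<Sum>i<n. (lin p w (X i))\<^sup>2 / (4 * \<kappa>\<^sup>2))}
        \<in> sets (iid_sample n G)" by measurable
    have "2 * c * D \<le> 2 * c * real n" using D c_ge by (intro mult_left_mono) auto
    then have "4 * \<kappa>\<^sup>2 * (real n * 1 + 2 * c * D) \<le> 4 * \<kappa>\<^sup>2 * (1 + 2 * c) * real n"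
      using mult_left_mono[of "real n * 1 + 2 * c * D" "(1 + 2 * c) * real n" "4 * \<kappa>\<^sup>2"]
      by (simp add: algebra_simps)
    then show "{X \<in> space (iid_sample n G). 4 * \<kappa>\<^sup>2 * (1 + 2 * c) * real n < (\<Sum>i<n. (lin p w (X i))\<^sup>2)}
      \<subseteq> {X \<in> space (iid_sample n G). real n * 1 + 2 * c * D \<le> (\<Sum>i<n. (lin p w (X i))\<^sup>2 / (4 * \<kappa>\<^sup>2))}"
      using \<kappa> by (auto simp: sum_divide_distrib[symmetric] field_simps)
  qed
  ultimately show ?thesis by linarith
qed

lemma rho_net_finite: "finite (\<rho> ` K)"
  using entropy(1)[of J "mesh J" K] mesh_pos[of J] K_dest by (auto simp: mesh_def)

lemma moment_net:
  "finite (grid_round k (1 / 2) ` {u. sparse_fun p k u \<and> L2_set u {..<p} \<le> 1})"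
  "real (card (grid_round k (1 / 2) ` {u. sparse_fun p k u \<and> L2_set u {..<p} \<le> 1})) \<le> exp (c * D)"
proof -
  have "1 / (2 * \<kappa> * 8 ^ 0) \<le> (1 / 2 :: real)" using \<kappa> by (simp add: field_simps)
  from entropy[OF this, of "{u. sparse_fun p k u \<and> L2_set u {..<p} \<le> 1}"]
  show "finite (grid_round k (1 / 2) ` {u. sparse_fun p k u \<and> L2_set u {..<p} \<le> 1})"
    "real (card (grid_round k (1 / 2) ` {u. sparse_fun p k u \<and> L2_set u {..<p} \<le> 1})) \<le> exp (c * D)"
    by auto
qed

lemma good_measurable:
  assumes "I \<subseteq> {..<n}" "sets M = sets (Rspace p)"
  shows "{X \<in> space (iid_sample n M). good I X} \<in> sets (iid_sample n M)"
proof -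
  have [measurable]: "lin p w \<in> borel_measurable M" for w
    by (simp add: measurable_cong_sets[OF assms(2) refl])
  have [measurable]: "(\<lambda>X. lin p w (X i)) \<in> borel_measurable (iid_sample n M)" if "i \<in> I" for w i
  proof -
    have "i < n" using that assms(1) by auto
    then show ?thesis by measurable
  qed
  have 1: "(\<lambda>X. \<Sum>i\<in>I. (of_bool (lin p w (X i) \<in> band h) :: real)) \<in> borel_measurable (iid_sample n M)" for w h
  proof (intro borel_measurable_sum)
    fix i assume [simp]: "i \<in> I"
    have "(\<lambda>X. (indicator (band h) (lin p w (X i)) :: real)) \<in> borel_measurable (iid_sample n M)" by measurable
    then show "(\<lambda>X. (of_bool (lin p w (X i) \<in> band h) :: real)) \<in> borel_measurable (iid_sample n M)"
      by (simp add: indicator_def of_bool_def)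
  qed
  have 2: "(\<lambda>X. \<Sum>i\<in>I. (lin p w (X i))\<^sup>2) \<in> borel_measurable (iid_sample n M)" for w
    by (intro borel_measurable_sum borel_measurable_power) measurable
  show ?thesis
    unfolding good_def
    by (intro sets.sets_Collect_conj sets.sets_Collect_finite_All \<T> rho_net_finite moment_net
        borel_measurable_le 1 2 borel_measurable_const)
qed

lemma good_subset: "I \<subseteq> I' \<Longrightarrow> finite I' \<Longrightarrow> good I' X \<Longrightarrow> good I X"
proof -
  assume sub: "I \<subseteq> I'" and fin: "finite I'" and g: "good I' X"
  have "(\<Sum>i\<in>I. f i) \<le> (\<Sum>i\<in>I'. f i)" if "\<And>i. 0 \<le> f i" for f :: "nat \<Rightarrow> real"
    using sub fin that by (intro sum_mono2) auto
  note mono = this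
  show ?thesis
    unfolding good_def
    by (intro conjI ballI; rule order_trans[OF mono]) (use g in \<open>auto simp: good_def\<close>)
qed

text \<open>
  Each of the at most four bands contributes three exponentials, and the second moments one.
\<close>

lemma prob_not_good:
  "measure (iid_sample n G) {X \<in> space (iid_sample n G). \<not> good {..<n} X} \<le> 13 * exp (- (c * D))"
proof -
  let ?P = "iid_sample n G"
  interpret P: prob_space ?P by (intro prob_space_iid_sample G.prob_space_axioms)
  let ?W = "grid_round k (1 / 2) ` {u. sparse_fun p k u \<and> L2_set u {..<p} \<le> 1}"
  define B where "B h = {X \<in> space ?P. \<exists>u\<in>K.
      real n * (measure G {x \<in> space G. lin p (\<rho> u) x \<in> band h} + (21 + 18 * c) * sqrt y)
      < (\<Sum>i<n. of_bool (lin p (\<rho> u) (X i) \<in> band h))}" for h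
  define B' where "B' w = {X \<in> space ?P. 4 * \<kappa>\<^sup>2 * (1 + 2 * c) * real n < (\<Sum>i<n. (lin p w (X i))\<^sup>2)}" for w
  have B_sets: "B h \<in> sets ?P" for h
  proof -
    have eq: "B h = (\<Union>w\<in>\<rho> ` K. {X \<in> space ?P.
      real n * (measure G {x \<in> space G. lin p w x \<in> band h} + (21 + 18 * c) * sqrt y)
      < (\<Sum>i<n. indicator (band h) (lin p w (X i)))})"
      by (auto simp: B_def indicator_def of_bool_def)
    show ?thesis unfolding eq using rho_net_finite by (intro sets.finite_UN) measurable
  qed
  have B'_sets: "B' w \<in> sets ?P" for w unfolding B'_def by measurable
  have "{X \<in> space ?P. \<not> good {..<n} X} \<subseteq> (\<Union>h\<in>\<T>. B (widen (sqrt y) h)) \<union> (\<Union>w\<in>?W. B' w)"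
    unfolding good_def B_def B'_def by (auto simp: not_le)
  then have "measure ?P {X \<in> space ?P. \<not> good {..<n} X} \<le>
      measure ?P ((\<Union>h\<in>\<T>. B (widen (sqrt y) h)) \<union> (\<Union>w\<in>?W. B' w))"
    by (intro P.finite_measure_mono sets.Un sets.finite_UN B_sets B'_sets \<T> moment_net)
  also have "\<dots> \<le> measure ?P (\<Union>h\<in>\<T>. B (widen (sqrt y) h)) + measure ?P (\<Union>w\<in>?W. B' w)"
    by (intro measure_Un_le sets.finite_UN B_sets B'_sets \<T> moment_net)
  also have "measure ?P (\<Union>h\<in>\<T>. B (widen (sqrt y) h)) \<le> 12 * exp (- (c * D))"
  proof -
    have "measure ?P (\<Union>h\<in>\<T>. B (widen (sqrt y) h)) \<le> (\<Sum>h\<in>\<T>. measure ?P (B (widen (sqrt y) h)))"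
      by (intro P.finite_measure_subadditive_finite image_subsetI B_sets \<T>)
    also have "\<dots> \<le> real (card \<T>) * (3 * exp (- (c * D)))"
      unfolding B_def by (intro sum_bounded_above uniform_deviation)
    also have "\<dots> \<le> 4 * (3 * exp (- (c * D)))" using \<T> by (intro mult_right_mono) auto
    finally show ?thesis by simp
  qed
  also have "measure ?P (\<Union>w\<in>?W. B' w) \<le> exp (- (c * D))"
  proof -
    have "measure ?P (\<Union>w\<in>?W. B' w) \<le> (\<Sum>w\<in>?W. measure ?P (B' w))"
      using B'_sets moment_net(1) by (intro P.finite_measure_subadditive_finite) auto
    also have "\<dots> \<le> real (card ?W) * exp (- (2 * c * D))"
    proof (intro sum_bounded_above)
      fix w assume "w \<in> ?W"
      then obtain u where u: "sparse_fun p k u" "L2_set u {..<p} \<le> 1" "w = grid_round k (1 / 2) u" by auto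
      then show "measure ?P (B' w) \<le> exp (- (2 * c * D))"
        unfolding B'_def using grid_round[OF k_pos(1) _ u(1), of "1 / 2"]
        by (intro second_moment_deviation) auto
    qed
    also have "\<dots> \<le> exp (c * D) * exp (- (2 * c * D))" by (intro mult_right_mono moment_net) auto
    also have "\<dots> = exp (- (c * D))" by (simp flip: exp_add)
    finally show ?thesis .
  qed
  finally show ?thesis by simp
qed

text \<open>
  The bound holds on a net of mesh 1/2.  As rounding keeps the support, a vector differs from its
  rounded version by half of a vector of the same kind; iterating \<open>m\<close> times loses a factor 2 in the
  seminorm, up to \<open>R / 2\<^sup>m\<close>.
\<close>

lemma second_moment_good:
  assumes g: "good I X" and fin: "finite I" and v: "sparse_fun p k v" "L2_set v {..<p} \<le> 1"
  shows "(\<Sum>i\<in>I. (lin p v (X i))\<^sup>2) \<le> 16 * \<kappa>\<^sup>2 * (1 + 2 * c) * real n"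
proof -
  \<comment> \<open>The empirical seminorm, its bound on the net, and a crude bound on the whole unit ball.\<close>
  define N where "N v = L2_set (\<lambda>i. lin p v (X i)) I" for v
  define b where "b = sqrt (4 * \<kappa>\<^sup>2 * (1 + 2 * c) * real n)"
  define R where "R = L2_set (\<lambda>i. \<Sum>j<p. \<bar>X i j\<bar>) I"
  have b: "0 \<le> b" using c_ge by (simp add: b_def)
  have "\<forall>v. sparse_fun p k v \<and> L2_set v {..<p} \<le> 1 \<longrightarrow> N v \<le> 2 * b + R / 2 ^ m" for m
  proof (induction m)
    case 0
    show ?case
    proof (intro allI impI)
      fix v assume v: "sparse_fun p k v \<and> L2_set v {..<p} \<le> 1"
      have "\<bar>lin p v x\<bar> \<le> (\<Sum>j<p. \<bar>x j\<bar>)" for x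
      proof -
        have "\<bar>v j\<bar> \<le> 1" if "j < p" for j
        proof -
          have "\<bar>v j\<bar> \<le> L2_set v {..<p}"
            using member_le_L2_set[of "{..<p}" j "\<lambda>i. \<bar>v i\<bar>"] that by (simp add: L2_set_def)
          then show ?thesis using v by linarith
        qed
        then have "(\<Sum>j<p. \<bar>v j * x j\<bar>) \<le> (\<Sum>j<p. \<bar>x j\<bar>)"
          by (intro sum_mono) (auto simp: abs_mult mult_left_le_one_le)
        then show ?thesis unfolding lin_def using sum_abs[of "\<lambda>j. v j * x j" "{..<p}"] by linarith
      qed
      then have "L2_set (\<lambda>i. \<bar>lin p v (X i)\<bar>) I \<le> R"
        unfolding R_def by (intro L2_set_mono) auto
      then have "N v \<le> R" by (simp add: N_def L2_set_def)
      then show "N v \<le> 2 * b + R / 2 ^ 0" using b by simp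
    qed
  next
    case (Suc m)
    show ?case
    proof (intro allI impI)
      fix v assume v: "sparse_fun p k v \<and> L2_set v {..<p} \<le> 1"
      define w where "w = grid_round k (1 / 2) v"
      define v' where "v' = (\<lambda>i. 2 * (v i - w i))"
      have w: "sparse_fun p k (\<lambda>i. v i - w i)" "L2_set (\<lambda>i. v i - w i) {..<p} \<le> 1 / 2"
        unfolding w_def using grid_round[OF k_pos(1), of "1 / 2" p v] v by auto
      have "sparse_fun p k v'" using w(1) by (auto simp: sparse_fun_def v'_def)
      moreover have "L2_set v' {..<p} \<le> 1"
        using w(2) unfolding v'_def by (subst L2_set_right_distrib[symmetric]) auto
      ultimately have "N v' \<le> 2 * b + R / 2 ^ m" using Suc by blast
      moreover have "N w \<le> b"
        unfolding N_def L2_set_def b_def using g v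
        by (intro real_sqrt_le_mono) (auto simp: good_def w_def)
      moreover have "N v \<le> N w + (1 / 2) * N v'"
      proof -
        have "lin p v x = lin p w x + (1 / 2) * lin p v' x" for x
          unfolding v'_def lin_scale lin_diff by (simp add: field_simps)
        then have "N v = L2_set (\<lambda>i. lin p w (X i) + (1 / 2) * lin p v' (X i)) I" by (simp only: N_def)
        also have "\<dots> \<le> N w + L2_set (\<lambda>i. (1 / 2) * lin p v' (X i)) I"
          unfolding N_def by (rule L2_set_triangle_ineq)
        also have "L2_set (\<lambda>i. (1 / 2) * lin p v' (X i)) I = (1 / 2) * N v'"
          unfolding N_def by (rule L2_set_right_distrib[symmetric]) simp
        finally show ?thesis .
      qed
      ultimately show "N v \<le> 2 * b + R / 2 ^ Suc m" by simp
    qed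
  qed
  then have "N v \<le> 2 * b + R / 2 ^ m" for m using v by blast
  moreover have "(\<lambda>m. 2 * b + R / 2 ^ m) \<longlonglongrightarrow> 2 * b + 0"
    by (intro tendsto_intros LIMSEQ_divide_realpow_zero) simp
  ultimately have "N v \<le> 2 * b" by (intro LIMSEQ_le_const[of _ "2 * b"]) auto
  then have "(N v)\<^sup>2 \<le> (2 * b)\<^sup>2" by (intro power_mono) (auto simp: N_def L2_set_nonneg)
  moreover have "b\<^sup>2 = 4 * \<kappa>\<^sup>2 * (1 + 2 * c) * real n" using c_ge by (simp add: b_def)
  ultimately show ?thesis by (simp add: N_def L2_set_def sum_nonneg power_mult_distrib)
qed

text \<open>
  The chain is as long as \<open>2\<^sup>J \<surd>y \<le> 1\<close> permits, hence its last mesh, proportional to \<open>8\<^sup>-\<^sup>J\<close>, is at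
  most a constant times the third power of \<open>\<surd>y\<close>.
\<close>

lemma mesh_J: "\<kappa> * mesh J \<le> 4 * (y * sqrt y)"
proof -
  have "1 / 2 ^ J \<le> 2 * sqrt y" using J(2) by (simp add: y_def field_simps)
  then have "(1 / 2 ^ J) ^ 3 \<le> (2 * sqrt y) ^ 3" by (intro power_mono) auto
  moreover have "(2 * sqrt y) ^ 3 = 8 * (y * sqrt y)"
    using sqrt_y(3) by (simp add: power3_eq_cube)
  moreover have "(1 / 2 ^ J) ^ 3 = (1 / 8 ^ J :: real)"
  proof -
    have "(8::real) ^ J = (2 ^ 3) ^ J" by simp
    also have "\<dots> = (2 ^ J) ^ 3" by (simp only: power_mult[symmetric] mult.commute)
    finally show ?thesis by (simp add: power_divide)
  qed
  ultimately show ?thesis unfolding mesh_pos(3) by simp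
qed

lemma mesh_J_sq: "(\<kappa> * mesh J)\<^sup>2 / y \<le> 16 * sqrt y"
proof -
  have "(\<kappa> * mesh J)\<^sup>2 \<le> (4 * (y * sqrt y))\<^sup>2"
    using mesh_J mesh_pos(1)[of J] \<kappa> by (intro power_mono) auto
  also have "\<dots> = 16 * (y * y) * y" using sqrt_y(3) by (simp add: power2_eq_square)
  finally have "(\<kappa> * mesh J)\<^sup>2 / y \<le> 16 * (y * y)" using y_bounds by (simp add: field_simps)
  also have "\<dots> \<le> 16 * (sqrt y * 1)" using sqrt_y y_bounds by (intro mult_left_mono mult_mono) auto
  finally show ?thesis by simp
qed

lemma band_prob_round:
  assumes u: "u \<in> K"
  shows "measure G {x \<in> space G. lin p (\<rho> u) x \<in> band (widen (sqrt y) h)}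
      \<le> measure G {x \<in> space G. lin p u x \<in> band h} + 98 * sqrt y"
proof -
  let ?v = "\<lambda>i. u i - \<rho> u i"
  let ?A = "{x \<in> space G. lin p u x \<in> band h}"
  let ?B = "{x \<in> space G. \<bar>\<bar>lin p u x\<bar> - snd (widen (sqrt y) h)\<bar> \<le> sqrt y}"
  let ?C = "{x \<in> space G. sqrt y \<le> \<bar>lin p ?v x\<bar>}"
  have "{x \<in> space G. lin p (\<rho> u) x \<in> band (widen (sqrt y) h)} \<subseteq> (?A \<union> ?B) \<union> ?C"
  proof
    fix x assume x: "x \<in> {x \<in> space G. lin p (\<rho> u) x \<in> band (widen (sqrt y) h)}"
    show "x \<in> (?A \<union> ?B) \<union> ?C"
    proof (cases "sqrt y \<le> \<bar>lin p ?v x\<bar>")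
      case False
      then have "lin p u x \<in> band (widen (sqrt y) (widen (sqrt y) h))"
        using x band_widen[of "lin p (\<rho> u) x" "widen (sqrt y) h" "lin p u x" "sqrt y"]
        by (simp add: lin_diff abs_minus_commute)
      then show ?thesis using x by (auto simp: band_def widen_def split: if_splits)
    qed (use x in auto)
  qed
  then have "measure G {x \<in> space G. lin p (\<rho> u) x \<in> band (widen (sqrt y) h)} \<le> measure G ((?A \<union> ?B) \<union> ?C)"
    by (intro G.finite_measure_mono) (assumption, measurable)
  also have "\<dots> \<le> measure G (?A \<union> ?B) + measure G ?C" by (intro measure_Un_le) measurable
  also have "measure G (?A \<union> ?B) \<le> measure G ?A + measure G ?B" by (intro measure_Un_le) measurable
  also have "measure G ?B \<le> 2 * sqrt y / \<sigma> u"
    using K_dest[OF u] sqrt_y by (intro G.normal_slab_prob distributed_lin_gvec) auto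
  also have "measure G ?C \<le> 6 * (\<sigma> ?v)\<^sup>2 / (sqrt y)\<^sup>2" by (intro lin_tail_prob sqrt_y)
  also have "\<dots> \<le> 6 * (\<kappa> * mesh J)\<^sup>2 / (sqrt y)\<^sup>2"
    using mesh_approx(2)[OF u, of J] gsd_nonneg unfolding mesh_pos(3)
    by (intro divide_right_mono mult_left_mono power_mono) auto
  also have "\<dots> = 6 * ((\<kappa> * mesh J)\<^sup>2 / y)" using y_bounds by simp
  also have "\<dots> \<le> 6 * (16 * sqrt y)" by (intro mult_left_mono mesh_J_sq) simp
  finally show ?thesis using K_dest(2)[OF u] by simp
qed

lemma std_normal_band:
  assumes "u \<in> K"
  shows "measure G {x \<in> space G. lin p u x \<in> band h} = measure (density lborel std_normal_density) (band h)"
proof -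
  have d: "distributed G lborel (lin p u) std_normal_density"
    using distributed_lin_gvec[of p A u] K_dest(2)[OF assms] by simp
  have "measure (density lborel std_normal_density) (band h) = measure (distr G lborel (lin p u)) (band h)"
    using distributed_distr_eq_density[OF d] by simp
  also have "\<dots> = measure G (lin p u -` band h \<inter> space G)"
    by (intro measure_distr) auto
  finally show ?thesis by (simp add: vimage_def Int_def conj_commute)
qed

text \<open>
  Passing from \<open>u\<close> to its approximation \<open>\<rho> u\<close> widens the band by \<open>\<surd>y\<close>, except for observations on which
  \<open>u - \<rho> u\<close> exceeds \<open>\<surd>y\<close>.  By Chebyshev's inequality and the second moment bound the fraction of the
  latter is at most a constant times \<open>mesh\<^sup>2 / y\<close>, and thus \<open>O(y\<^sup>2)\<close>.  Observations outside of \<open>I\<close> are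
  simply counted.
\<close>

lemma good_deviation:
  assumes g: "good I X" and I: "I \<subseteq> {..<n}" "real (card ({..<n} - I)) \<le> real n * (\<epsilon> + 2 * sqrt y)"
    and h: "h \<in> \<T>" and u: "u \<in> K"
  shows "(\<Sum>i<n. of_bool (lin p u (X i) \<in> band h)) \<le>
     real n * (measure (density lborel std_normal_density) (band h) + (377 + 530 * c) * sqrt y + \<epsilon>)"
proof -
  let ?w = "\<rho> u" let ?v = "\<lambda>i. u i - \<rho> u i"
  have fin: "finite I" using I(1) by (rule finite_subset) simp
  have "(\<Sum>i<n. of_bool (lin p u (X i) \<in> band h)) =
      (\<Sum>i\<in>I. of_bool (lin p u (X i) \<in> band h)) + (\<Sum>i\<in>{..<n} - I. of_bool (lin p u (X i) \<in> band h) :: real)"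
    using sum.subset_diff[OF I(1), of "\<lambda>i. of_bool (lin p u (X i) \<in> band h) :: real"] by simp
  also have "\<dots> \<le> (\<Sum>i\<in>I. of_bool (lin p u (X i) \<in> band h)) + real (card ({..<n} - I))"
    using sum_bounded_above[of "{..<n} - I" "\<lambda>i. of_bool (lin p u (X i) \<in> band h) :: real" 1] by simp
  also have "(\<Sum>i\<in>I. of_bool (lin p u (X i) \<in> band h)) \<le>
      (\<Sum>i\<in>I. of_bool (lin p ?w (X i) \<in> band (widen (sqrt y) h)) + (lin p ?v (X i))\<^sup>2 / y)"
  proof (intro sum_mono)
    fix i
    have nonneg: "0 \<le> (lin p ?v (X i))\<^sup>2 / y" using y_bounds by simp
    show "of_bool (lin p u (X i) \<in> band h) \<le>
        of_bool (lin p ?w (X i) \<in> band (widen (sqrt y) h)) + (lin p ?v (X i))\<^sup>2 / y"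
    proof (cases "\<bar>lin p ?v (X i)\<bar> < sqrt y")
      case True
      then show ?thesis
        using band_widen[of "lin p u (X i)" h "lin p ?w (X i)" "sqrt y"] nonneg by (auto simp: lin_diff)
    next
      case False
      then have "(sqrt y)\<^sup>2 \<le> \<bar>lin p ?v (X i)\<bar>\<^sup>2" using sqrt_y by (intro power_mono) auto
      then have "1 \<le> (lin p ?v (X i))\<^sup>2 / y" using y_bounds by simp
      then show ?thesis by (auto simp: of_bool_def)
    qed
  qed
  also have "\<dots> = (\<Sum>i\<in>I. of_bool (lin p ?w (X i) \<in> band (widen (sqrt y) h))) + (\<Sum>i\<in>I. (lin p ?v (X i))\<^sup>2) / y"
    by (simp add: sum.distrib sum_divide_distrib)
  also have "(\<Sum>i\<in>I. of_bool (lin p ?w (X i) \<in> band (widen (sqrt y) h))) \<le>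
      real n * (measure G {x \<in> space G. lin p ?w x \<in> band (widen (sqrt y) h)} + (21 + 18 * c) * sqrt y)"
    using g h u by (auto simp: good_def)
  also have "\<dots> \<le> real n * ((measure G {x \<in> space G. lin p u x \<in> band h} + 98 * sqrt y) + (21 + 18 * c) * sqrt y)"
    using band_prob_round[OF u] by (intro mult_left_mono add_right_mono) auto
  also have "(\<Sum>i\<in>I. (lin p ?v (X i))\<^sup>2) / y \<le> real n * (256 * (1 + 2 * c) * sqrt y)"
  proof -
    define v' where "v' = (\<lambda>i. (1 / mesh J) * ?v i)"
    have "sparse_fun p k ?v" by (intro grid_round k_pos mesh_pos K_dest u)
    then have v': "sparse_fun p k v'" unfolding v'_def sparse_fun_def by (metis mult_zero_right)
    have "L2_set v' {..<p} = (1 / mesh J) * L2_set ?v {..<p}"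
      unfolding v'_def using mesh_pos(1)[of J] by (intro L2_set_right_distrib[symmetric]) auto
    also have "\<dots> \<le> (1 / mesh J) * mesh J"
      using mesh_approx(1)[OF u, of J] mesh_pos(1)[of J] by (intro mult_left_mono) auto
    finally have "L2_set v' {..<p} \<le> 1" using mesh_pos(1)[of J] by simp
    from second_moment_good[OF g fin v' this]
    have *: "(\<Sum>i\<in>I. (lin p v' (X i))\<^sup>2) \<le> 16 * \<kappa>\<^sup>2 * (1 + 2 * c) * real n" .
    have "lin p ?v x = mesh J * lin p v' x" for x
      unfolding v'_def lin_scale using mesh_pos(1)[of J] by simp
    then have "(\<Sum>i\<in>I. (lin p ?v (X i))\<^sup>2) / y = (mesh J)\<^sup>2 * (\<Sum>i\<in>I. (lin p v' (X i))\<^sup>2) / y"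
      by (simp add: power_mult_distrib sum_distrib_left)
    also have "\<dots> \<le> (mesh J)\<^sup>2 * (16 * \<kappa>\<^sup>2 * (1 + 2 * c) * real n) / y"
      using * y_bounds by (intro divide_right_mono mult_left_mono) auto
    also have "\<dots> = 16 * (1 + 2 * c) * real n * ((\<kappa> * mesh J)\<^sup>2 / y)"
      by (simp add: power_mult_distrib)
    also have "\<dots> \<le> 16 * (1 + 2 * c) * real n * (16 * sqrt y)"
      using c_ge by (intro mult_left_mono mesh_J_sq) auto
    finally show ?thesis by (simp add: algebra_simps)
  qed
  also note I(2)
  finally show ?thesis unfolding std_normal_band[OF u] by (simp add: algebra_simps)
qed

end

section \<open>Contamination as a coupling\<close>

definition coupling :: "real \<Rightarrow> 'a measure \<Rightarrow> 'a measure \<Rightarrow> (bool \<times> 'a \<times> 'a) measure" where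
  "coupling \<epsilon> P Q = measure_pmf (bernoulli_pmf \<epsilon>) \<Otimes>\<^sub>M (P \<Otimes>\<^sub>M Q)"

definition pick :: "bool \<times> 'a \<times> 'a \<Rightarrow> 'a" where
  "pick w = (if fst w then snd (snd w) else fst (snd w))"

lemma prob_space_coupling: "prob_space P \<Longrightarrow> prob_space Q \<Longrightarrow> prob_space (coupling \<epsilon> P Q)"
  unfolding coupling_def by (intro prob_space_pair prob_space_measure_pmf)

lemma coupling_measurable [measurable]:
  "fst \<in> measurable (coupling \<epsilon> P Q) (count_space UNIV)"
  "(\<lambda>w. fst (snd w)) \<in> measurable (coupling \<epsilon> P Q) P"
  "(\<lambda>w. snd (snd w)) \<in> measurable (coupling \<epsilon> P Q) Q"
proof -
  have "fst \<in> measurable (coupling \<epsilon> P Q) (measure_pmf (bernoulli_pmf \<epsilon>))"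
    unfolding coupling_def by measurable
  then show "fst \<in> measurable (coupling \<epsilon> P Q) (count_space UNIV)"
    by (simp add: measurable_cong_sets[OF refl sets_measure_pmf_count_space])
qed (unfold coupling_def, measurable)

lemma pick_measurable [measurable]:
  assumes "sets Q = sets P"
  shows "pick \<in> measurable (coupling \<epsilon> P Q) P"
proof -
  have [measurable]: "(\<lambda>w. snd (snd w)) \<in> measurable (coupling \<epsilon> P Q) P"
    using coupling_measurable(3)[of \<epsilon> P Q] by (simp add: measurable_cong_sets[OF refl assms])
  show ?thesis unfolding pick_def by measurable
qed

lemma distr_coupling_fst_snd:
  assumes "prob_space P" "prob_space Q"
  shows "distr (coupling \<epsilon> P Q) P (\<lambda>w. fst (snd w)) = P"
proof -
  interpret P: prob_space P by fact
  interpret Q: prob_space Q by fact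
  interpret PQ: pair_prob_space P Q ..
  show ?thesis
  proof (rule measure_eqI)
    fix A assume "A \<in> sets (distr (coupling \<epsilon> P Q) P (\<lambda>w. fst (snd w)))"
    then have [measurable]: "A \<in> sets P" by simp
    have "(\<lambda>w. fst (snd w)) -` A \<inter> space (coupling \<epsilon> P Q) = UNIV \<times> (A \<times> space Q)"
      using sets.sets_into_space[of A P] by (auto simp: coupling_def space_pair_measure)
    then show "emeasure (distr (coupling \<epsilon> P Q) P (\<lambda>w. fst (snd w))) A = emeasure P A"
      by (subst emeasure_distr)
         (auto simp: coupling_def PQ.emeasure_pair_measure_Times Q.emeasure_pair_measure_Times Q.emeasure_space_1
            measure_pmf.emeasure_space_1[simplified])
  qed simp
qed

text \<open>
  A draw from the mixture selects one of two independent draws by a coin.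
\<close>

lemma mixture_eq_distr_pick:
  assumes "prob_space P" "prob_space Q" and sets: "sets Q = sets P" and \<epsilon>: "0 \<le> \<epsilon>" "\<epsilon> \<le> 1"
  shows "measure_of (space P) (sets P) (\<lambda>B. ennreal (1 - \<epsilon>) * emeasure P B + ennreal \<epsilon> * emeasure Q B)
     = distr (coupling \<epsilon> P Q) P pick"
proof -
  interpret P: prob_space P by fact
  interpret Q: prob_space Q by fact
  interpret PQ: pair_prob_space P Q ..
  let ?D = "distr (coupling \<epsilon> P Q) P pick"
  have em: "emeasure ?D B = ennreal (1 - \<epsilon>) * emeasure P B + ennreal \<epsilon> * emeasure Q B" if B: "B \<in> sets P" for B
  proof -
    have BQ: "B \<in> sets Q" using B sets by simp
    have meas: "pick -` B \<inter> space (coupling \<epsilon> P Q) \<in> sets (measure_pmf (bernoulli_pmf \<epsilon>) \<Otimes>\<^sub>M (P \<Otimes>\<^sub>M Q))"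
      using measurable_sets[OF pick_measurable[OF sets] B] by (simp add: coupling_def)
    have T: "Pair True -` (pick -` B \<inter> space (coupling \<epsilon> P Q)) = space P \<times> B"
      using sets.sets_into_space[OF BQ] by (auto simp: pick_def coupling_def space_pair_measure)
    have F: "Pair False -` (pick -` B \<inter> space (coupling \<epsilon> P Q)) = B \<times> space Q"
      using sets.sets_into_space[OF B] by (auto simp: pick_def coupling_def space_pair_measure)
    have "emeasure ?D B = emeasure (coupling \<epsilon> P Q) (pick -` B \<inter> space (coupling \<epsilon> P Q))"
      using B by (intro emeasure_distr pick_measurable sets)
    also have "\<dots> = (\<integral>\<^sup>+b. emeasure (P \<Otimes>\<^sub>M Q) (Pair b -` (pick -` B \<inter> space (coupling \<epsilon> P Q))) \<partial>measure_pmf (bernoulli_pmf \<epsilon>))"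
      unfolding coupling_def[of \<epsilon> P Q] by (intro PQ.emeasure_pair_measure_alt meas[unfolded coupling_def])
    also have "\<dots> = ennreal \<epsilon> * emeasure Q B + ennreal (1 - \<epsilon>) * emeasure P B"
      using \<epsilon> B BQ
      by (simp add: nn_integral_measure_pmf nn_integral_count_space_finite UNIV_bool T F
          Q.emeasure_pair_measure_Times P.emeasure_space_1 Q.emeasure_space_1 del: vimage_Int)
    finally show ?thesis by (simp add: add.commute)
  qed
  have "?D = measure_of (space ?D) (sets ?D) (emeasure ?D)"
    by (rule measure_of_of_measure[symmetric])
  also have "\<dots> = measure_of (space P) (sets P) (emeasure ?D)" by simp
  also have "\<dots> = measure_of (space P) (sets P) (\<lambda>B. ennreal (1 - \<epsilon>) * emeasure P B + ennreal \<epsilon> * emeasure Q B)"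
    using em by (intro measure_of_eq sets.space_closed) (simp add: sets.sigma_sets_eq)
  finally show ?thesis ..
qed

lemma iid_sample_distr:
  assumes "prob_space M" "prob_space N" "f \<in> measurable M N"
  shows "distr (iid_sample n M) (iid_sample n N) (\<lambda>X. \<lambda>i\<in>{..<n}. f (X i)) = iid_sample n (distr M N f)"
proof -
  have "compose {..<n} f = (\<lambda>X. \<lambda>i\<in>{..<n}. f (X i))" by (simp add: fun_eq_iff compose_def)
  then show ?thesis
    using distr_PiM_finite_prob_space'[of "{..<n}" "\<lambda>_. M" "\<lambda>_. N" f] assms
    by (simp add: iid_sample_def)
qed

text \<open>
  On the coupled space the mixture sample agrees with the Gaussian one at all \<open>i\<close> whose coin shows no
  contamination.  A property that depends only on the observations in \<open>I\<close> and is inherited by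
  smaller \<open>I\<close> therefore carries over to the mixture sample, with \<open>I\<close> the set of those \<open>i\<close>.  The event
  asserts the existence of such an \<open>I\<close>, as the coins cannot be recovered from the sample.
\<close>

lemma contamination_transfer:
  fixes good :: "nat set \<Rightarrow> (nat \<Rightarrow> 'a) \<Rightarrow> bool" and n :: nat and L :: real
  assumes P: "prob_space P" and Q: "prob_space Q" and sets: "sets Q = sets P" and \<epsilon>: "0 \<le> \<epsilon>" "\<epsilon> \<le> 1"
    and meas: "\<And>I. I \<subseteq> {..<n} \<Longrightarrow> {X \<in> space (iid_sample n P). good I X} \<in> sets (iid_sample n P)"
    and coords: "\<And>I X X'. good I X \<Longrightarrow> \<forall>i\<in>I. X i = X' i \<Longrightarrow> good I X'"
    and mono: "\<And>I X. I \<subseteq> {..<n} \<Longrightarrow> good {..<n} X \<Longrightarrow> good I X"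
    and \<theta>: "0 < \<theta>" "\<theta> \<le> 1"
  defines "A \<equiv> {X \<in> space (iid_sample n P). \<exists>I\<subseteq>{..<n}.
      real (card ({..<n} - I)) \<le> real n * (\<epsilon> + \<theta>) + L / \<theta> \<and> good I X}"
  shows "A \<in> sets (iid_sample n (distr (coupling \<epsilon> P Q) P pick))"
    and "1 - measure (iid_sample n P) {X \<in> space (iid_sample n P). \<not> good {..<n} X} - exp (- L)
       \<le> measure (iid_sample n (distr (coupling \<epsilon> P Q) P pick)) A"
proof -
  let ?C = "coupling \<epsilon> P Q" and ?m = "real n * (\<epsilon> + \<theta>) + L / \<theta>"
  let ?D = "distr ?C P pick"
  interpret P: prob_space P by fact
  interpret Q: prob_space Q by fact
  interpret C: prob_space ?C by (intro prob_space_coupling P Q)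
  interpret CC: prob_space "iid_sample n ?C" by (intro prob_space_iid_sample C.prob_space_axioms)
  have sets_D: "sets (iid_sample n ?D) = sets (iid_sample n P)"
    unfolding iid_sample_def by (intro sets_PiM_cong) auto
  have A_sets: "A \<in> sets (iid_sample n P)"
  proof -
    have "A = (\<Union>I\<in>{I \<in> Pow {..<n}. real (card ({..<n} - I)) \<le> ?m}. {X \<in> space (iid_sample n P). good I X})"
      by (auto simp: A_def)
    also have "\<dots> \<in> sets (iid_sample n P)" by (intro sets.finite_UN meas) auto
    finally show ?thesis .
  qed
  then show "A \<in> sets (iid_sample n ?D)" by (simp add: sets_D)
  define F where "F X = (\<lambda>i\<in>{..<n}. pick (X i))" for X :: "nat \<Rightarrow> bool \<times> 'a \<times> 'a"
  define H where "H X = (\<lambda>i\<in>{..<n}. fst (snd (X i)))" for X :: "nat \<Rightarrow> bool \<times> 'a \<times> 'a"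
  have F_meas [measurable]: "F \<in> measurable (iid_sample n ?C) (iid_sample n P)"
  proof -
    have [measurable]: "pick \<in> measurable ?C P" by (intro pick_measurable sets)
    show ?thesis unfolding F_def iid_sample_def by measurable
  qed
  have H_meas [measurable]: "H \<in> measurable (iid_sample n ?C) (iid_sample n P)"
    unfolding H_def iid_sample_def by measurable
  have distr_F: "distr (iid_sample n ?C) (iid_sample n P) F = iid_sample n ?D"
    unfolding F_def by (intro iid_sample_distr C.prob_space_axioms P pick_measurable sets)
  have distr_H: "distr (iid_sample n ?C) (iid_sample n P) H = iid_sample n P"
    unfolding H_def using iid_sample_distr[OF C.prob_space_axioms P coupling_measurable(2)]
    by (simp add: distr_coupling_fst_snd[OF P Q])
  let ?B1 = "{X \<in> space (iid_sample n ?C). \<not> good {..<n} (H X)}"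
  let ?B2 = "{X \<in> space (iid_sample n ?C). ?m \<le> (\<Sum>i<n. of_bool (fst (X i)))}"
  have bad: "{X \<in> space (iid_sample n P). \<not> good {..<n} X} \<in> sets (iid_sample n P)"
    using meas[of "{..<n}"] by (intro sets.sets_Collect_neg) auto
  have B1_eq: "?B1 = H -` {X \<in> space (iid_sample n P). \<not> good {..<n} X} \<inter> space (iid_sample n ?C)"
    using measurable_space[OF H_meas] by auto
  have B1_sets: "?B1 \<in> sets (iid_sample n ?C)"
    unfolding B1_eq by (intro measurable_sets[OF H_meas] bad)
  have B1: "measure (iid_sample n ?C) ?B1 = measure (iid_sample n P) {X \<in> space (iid_sample n P). \<not> good {..<n} X}"
  proof -
    have "measure (iid_sample n P) {X \<in> space (iid_sample n P). \<not> good {..<n} X} =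
        measure (distr (iid_sample n ?C) (iid_sample n P) H) {X \<in> space (iid_sample n P). \<not> good {..<n} X}"
      by (simp add: distr_H)
    also have "\<dots> = measure (iid_sample n ?C) ?B1"
      unfolding B1_eq by (intro measure_distr H_meas bad)
    finally show ?thesis ..
  qed
  have B2_sets: "?B2 \<in> sets (iid_sample n ?C)" by measurable
  have B2: "measure (iid_sample n ?C) ?B2 \<le> exp (- L)"
  proof -
    have mean: "(\<integral>w. of_bool (fst w) \<partial>?C) = \<epsilon>"
    proof -
      have "distr ?C (measure_pmf (bernoulli_pmf \<epsilon>)) fst = measure_pmf (bernoulli_pmf \<epsilon>)"
        unfolding coupling_def by (intro prob_space.distr_pair_fst prob_space_pair P Q)
      then have "(\<integral>b. (of_bool b :: real) \<partial>measure_pmf (bernoulli_pmf \<epsilon>)) =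
          (\<integral>b. (of_bool b :: real) \<partial>distr ?C (measure_pmf (bernoulli_pmf \<epsilon>)) fst)" by simp
      also have "\<dots> = (\<integral>w. of_bool (fst w) \<partial>?C)"
        by (intro integral_distr) (auto simp: coupling_def)
      finally show ?thesis using \<epsilon> by simp
    qed
    have "(\<integral>w. (of_bool (fst w) :: real)\<^sup>2 \<partial>?C) \<le> (\<integral>w. 1 \<partial>?C)"
      by (intro integral_mono C.integrable_const_bound[where B=1]) auto
    then have sq: "(\<integral>w. (of_bool (fst w) :: real)\<^sup>2 \<partial>?C) \<le> 1" by (simp add: C.prob_space)
    have "measure (iid_sample n ?C) {X \<in> space (iid_sample n ?C).
        real n * ((\<integral>w. of_bool (fst w) \<partial>?C) + \<theta> * 1) + L / \<theta> \<le> (\<Sum>i<n. of_bool (fst (X i)))} \<le> exp (- L)"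
      by (intro bernstein_iid C.prob_space_axioms sq \<theta>) auto
    then show ?thesis by (simp add: mean)
  qed
  have sub: "space (iid_sample n ?C) - (F -` A \<inter> space (iid_sample n ?C)) \<subseteq> ?B1 \<union> ?B2"
  proof
    fix X assume X: "X \<in> space (iid_sample n ?C) - (F -` A \<inter> space (iid_sample n ?C))"
    show "X \<in> ?B1 \<union> ?B2"
    proof (rule ccontr)
      assume "X \<notin> ?B1 \<union> ?B2"
      then have g: "good {..<n} (H X)" and few: "(\<Sum>i<n. of_bool (fst (X i))) < ?m"
        using X by auto
      \<comment> \<open>The uncontaminated observations.\<close>
      define I where "I = {i\<in>{..<n}. \<not> fst (X i)}"
      have "real (card ({..<n} - I)) = (\<Sum>i<n. of_bool (fst (X i)))"
      proof -
        have "{..<n} - I = {i\<in>{..<n}. fst (X i)}" by (auto simp: I_def)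
        then show ?thesis by (simp add: of_bool_def sum.If_cases Int_def)
      qed
      moreover have "good I (F X)"
      proof (rule coords)
        show "good I (H X)" by (rule mono[OF _ g]) (auto simp: I_def)
      qed (auto simp: I_def F_def H_def pick_def)
      moreover have "I \<subseteq> {..<n}" by (auto simp: I_def)
      moreover have "F X \<in> space (iid_sample n P)" using X measurable_space[OF F_meas] by auto
      ultimately have "F X \<in> A" using few unfolding A_def by (intro CollectI conjI exI[of _ I]) auto
      then show False using X by auto
    qed
  qed
  have FA: "F -` A \<inter> space (iid_sample n ?C) \<in> sets (iid_sample n ?C)"
    by (intro measurable_sets[OF F_meas] A_sets)
  have "1 - measure (iid_sample n ?C) (F -` A \<inter> space (iid_sample n ?C)) =
      measure (iid_sample n ?C) (space (iid_sample n ?C) - (F -` A \<inter> space (iid_sample n ?C)))"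
    using FA by (simp add: CC.prob_compl)
  also have "\<dots> \<le> measure (iid_sample n ?C) (?B1 \<union> ?B2)"
    using sub B1_sets B2_sets by (intro CC.finite_measure_mono sets.Un)
  also have "\<dots> \<le> measure (iid_sample n ?C) ?B1 + measure (iid_sample n ?C) ?B2"
    using B1_sets B2_sets by (intro measure_Un_le)
  also have "\<dots> \<le> measure (iid_sample n P) {X \<in> space (iid_sample n P). \<not> good {..<n} X} + exp (- L)"
    using B1 B2 by simp
  finally have "1 - measure (iid_sample n P) {X \<in> space (iid_sample n P). \<not> good {..<n} X} - exp (- L)
      \<le> measure (iid_sample n ?C) (F -` A \<inter> space (iid_sample n ?C))" by simp
  also have "\<dots> = measure (distr (iid_sample n ?C) (iid_sample n P) F) A"
    by (intro measure_distr[symmetric] F_meas A_sets)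
  finally show "1 - measure (iid_sample n P) {X \<in> space (iid_sample n P). \<not> good {..<n} X} - exp (- L)
       \<le> measure (iid_sample n ?D) A" by (simp add: distr_F)
qed

text \<open>
  The failure probability of the Gaussian bounds is at most \<open>13 exp (- c D)\<close>, which the choice of \<open>c\<close> keeps
  below \<open>\<delta>\<close>; the number of contaminated observations accounts for the other \<open>\<delta>\<close>.
\<close>

lemma (in gauss_sample) contaminated_uniform_bound:
  assumes Q: "prob_space Q" "sets Q = sets (Rspace p)" and \<epsilon>: "0 \<le> \<epsilon>" "\<epsilon> \<le> 1"
    and \<delta>: "0 < \<delta>" "ln (1 / \<delta>) \<le> D"
  shows "\<exists>E\<in>sets (iid_sample n (distr (coupling \<epsilon> G Q) G pick)).
    1 - 2 * \<delta> \<le> measure (iid_sample n (distr (coupling \<epsilon> G Q) G pick)) E \<and>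
    (\<forall>X\<in>E. \<forall>h\<in>\<T>. \<forall>u\<in>K. (\<Sum>i<n. of_bool (lin p u (X i) \<in> band h)) \<le>
       real n * (measure (density lborel std_normal_density) (band h) + (377 + 530 * c) * sqrt y + \<epsilon>))"
proof -
  define E where "E = {X \<in> space (iid_sample n G). \<exists>I\<subseteq>{..<n}.
      real (card ({..<n} - I)) \<le> real n * (\<epsilon> + sqrt y) + ln (1 / \<delta>) / sqrt y \<and> good I X}"
  have setsQ: "sets Q = sets G" using Q(2) by (simp add: sets_gvec)
  have coords: "good I X'" if "good I X" "\<forall>i\<in>I. X i = X' i" for I X X'
    using that by (simp add: good_def cong: sum.cong)
  have mono: "good I X" if "I \<subseteq> {..<n}" "good {..<n} X" for I X
    using good_subset[OF that(1) _ that(2)] by simp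
  have meas: "{X \<in> space (iid_sample n G). good I X} \<in> sets (iid_sample n G)" if "I \<subseteq> {..<n}" for I
    by (rule good_measurable[OF that sets_gvec])
  have E_sets: "E \<in> sets (iid_sample n (distr (coupling \<epsilon> G Q) G pick))"
    unfolding E_def
    by (rule contamination_transfer(1)) (fact G.prob_space_axioms Q(1) setsQ \<epsilon> meas coords mono sqrt_y)+
  have E_prob: "1 - measure (iid_sample n G) {X \<in> space (iid_sample n G). \<not> good {..<n} X} - exp (- ln (1 / \<delta>))
       \<le> measure (iid_sample n (distr (coupling \<epsilon> G Q) G pick)) E"
    unfolding E_def
    by (rule contamination_transfer(2)) (fact G.prob_space_axioms Q(1) setsQ \<epsilon> meas coords mono sqrt_y)+
  have fail: "13 * exp (- (c * D)) \<le> \<delta>"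
  proof -
    have "13 \<le> exp (5::real)"
    proof -
      have "(2::real) ^ 5 \<le> exp 1 ^ 5"
        using exp_ge_add_one_self[of "1::real"] by (intro power_mono) auto
      then show ?thesis by (simp flip: exp_of_nat_mult)
    qed
    moreover have "5 + ln (1 / \<delta>) \<le> c * D"
      using mult_right_mono[OF c_ge, of D] D_ge \<delta> by linarith
    ultimately have "13 * exp (- (c * D)) \<le> exp 5 * exp (- (5 + ln (1 / \<delta>)))"
      by (intro mult_mono) auto
    also have "\<dots> = exp (- ln (1 / \<delta>))" by (simp flip: exp_add)
    also have "\<dots> = \<delta>" using \<delta> by (simp add: ln_div)
    finally show ?thesis .
  qed
  have "exp (- ln (1 / \<delta>)) = \<delta>" using \<delta> by (simp add: ln_div)
  then have prob: "1 - 2 * \<delta> \<le> measure (iid_sample n (distr (coupling \<epsilon> G Q) G pick)) E"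
    using E_prob prob_not_good fail by simp
  have "(\<Sum>i<n. of_bool (lin p u (X i) \<in> band h)) \<le>
       real n * (measure (density lborel std_normal_density) (band h) + (377 + 530 * c) * sqrt y + \<epsilon>)"
    if X: "X \<in> E" and h: "h \<in> \<T>" and u: "u \<in> K" for X h u
  proof -
    obtain I where I: "I \<subseteq> {..<n}" "good I X"
      "real (card ({..<n} - I)) \<le> real n * (\<epsilon> + sqrt y) + ln (1 / \<delta>) / sqrt y"
      using X by (auto simp: E_def)
    have "ln (1 / \<delta>) / sqrt y \<le> (real n * y) / sqrt y"
      using \<delta> y_bounds sqrt_y(1) by (intro divide_right_mono) auto
    also have "\<dots> = real n * sqrt y" using sqrt_y(1,3) by (simp add: field_simps)
    finally have "real (card ({..<n} - I)) \<le> real n * (\<epsilon> + 2 * sqrt y)"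
      using I(3) by (simp add: algebra_simps)
    then show ?thesis by (rule good_deviation[OF I(2,1) _ h u])
  qed
  then show ?thesis using E_sets prob by blast
qed

section \<open>Eigenvector perturbation\<close>

abbreviation qform :: "real mat \<Rightarrow> real vec \<Rightarrow> real" where
  "qform A v \<equiv> v \<bullet> (A *\<^sub>v v)"

lemma scalar_prod_self_nonneg: "0 \<le> (v :: real vec) \<bullet> v"
  by (simp add: scalar_prod_def sum_nonneg)

lemma scalar_prod_self_eq_0: "v \<in> carrier_vec n \<Longrightarrow> (v :: real vec) \<bullet> v = 0 \<longleftrightarrow> v = 0\<^sub>v n"
  by (auto simp: scalar_prod_def sum_nonneg_eq_0_iff)

lemma scalar_prod_mult_mat_vec:
  assumes "A \<in> carrier_mat m k" "x \<in> carrier_vec m" "y \<in> carrier_vec k"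
  shows "(x :: real vec) \<bullet> (A *\<^sub>v y) = (transpose_mat A *\<^sub>v x) \<bullet> y"
  using transpose_vec_mult_scalar[OF assms(1,3,2)] by simp

text \<open>
  Padding with zero rows gives a singular square matrix.
\<close>

lemma underdetermined_kernel:
  fixes A :: "real mat"
  assumes A: "A \<in> carrier_mat m r" and "m < r"
  shows "\<exists>c\<in>carrier_vec r. c \<noteq> 0\<^sub>v r \<and> A *\<^sub>v c = 0\<^sub>v m"
proof -
  define B where "B = Matrix.mat r r (\<lambda>(i, j). if i < m then A $$ (i, j) else 0)"
  have B: "B \<in> carrier_mat r r" by (simp add: B_def)
  have "det B = 0"
  proof -
    have "B = mat\<^sub>r r r (\<lambda>i. if i = m then 0\<^sub>v r else row B i)"
      using assms by (intro eq_matI) (auto simp: B_def)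
    moreover have "det (mat\<^sub>r r r (\<lambda>i. if i = m then 0\<^sub>v r else row B i)) = 0"
      using assms B by (intro det_row_0) auto
    ultimately show ?thesis by simp
  qed
  then obtain c where c: "c \<in> carrier_vec r" "c \<noteq> 0\<^sub>v r" "B *\<^sub>v c = 0\<^sub>v r"
    using det_0_iff_vec_prod_zero[OF B] by auto
  have "A *\<^sub>v c = 0\<^sub>v m"
  proof (rule eq_vecI)
    fix i assume "i < dim_vec (0\<^sub>v m)"
    then have i: "i < m" by simp
    then have "row A i = row B i" using A assms by (intro eq_vecI) (auto simp: B_def)
    then have "(A *\<^sub>v c) $ i = (B *\<^sub>v c) $ i" using A B i assms(2) by simp
    then show "(A *\<^sub>v c) $ i = 0\<^sub>v m $ i" using c i assms(2) by simp
  qed (use A in auto)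
  then show ?thesis using c by blast
qed

lemma orthonormal_matsD:
  assumes "V \<in> orthonormal_mats p r"
  shows "V \<in> carrier_mat p r" "transpose_mat V * V = 1\<^sub>m r"
    and "\<And>x. x \<in> carrier_vec r \<Longrightarrow> transpose_mat V *\<^sub>v (V *\<^sub>v x) = x"
    and "\<And>a b. a < r \<Longrightarrow> b < r \<Longrightarrow> (\<Sum>i<p. V $$ (i, a) * V $$ (i, b)) = (if a = b then 1 else 0)"
proof -
  show V: "V \<in> carrier_mat p r" "transpose_mat V * V = 1\<^sub>m r"
    using assms by (auto simp: orthonormal_mats_def)
  then show "transpose_mat V *\<^sub>v (V *\<^sub>v x) = x" if "x \<in> carrier_vec r" for x
    using that by (simp flip: assoc_mult_mat_vec[of _ r p _ r])
  fix a b assume ab: "a < r" "b < r"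
  have "(\<Sum>i<p. V $$ (i, a) * V $$ (i, b)) = (transpose_mat V * V) $$ (a, b)"
    using V(1) ab by (simp add: scalar_prod_def atLeast0LessThan)
  then show "(\<Sum>i<p. V $$ (i, a) * V $$ (i, b)) = (if a = b then 1 else 0)"
    using V(2) ab by simp
qed

lemma orthonormal_mats_le: "V \<in> orthonormal_mats p r \<Longrightarrow> r \<le> p"
proof (rule ccontr)
  assume V: "V \<in> orthonormal_mats p r" and "\<not> r \<le> p"
  then obtain c where c: "c \<in> carrier_vec r" "c \<noteq> 0\<^sub>v r" "V *\<^sub>v c = 0\<^sub>v p"
    using underdetermined_kernel[of V p r] orthonormal_matsD(1) by auto
  then have "transpose_mat V *\<^sub>v 0\<^sub>v p = c" using orthonormal_matsD(3)[OF V c(1)] by simp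
  moreover have "transpose_mat V *\<^sub>v 0\<^sub>v p = 0\<^sub>v r"
    using orthonormal_matsD(1)[OF V] by (intro eq_vecI) auto
  ultimately show False using c(2) by simp
qed

text \<open>
  Polarization, after scaling \<open>y\<close> to the length of \<open>x\<close>: this turns the bound on the quadratic form into
  one on the operator norm.
\<close>

lemma bilinear_le_of_quadratic_le:
  fixes D :: "real mat"
  assumes D: "D \<in> carrier_mat p p" "transpose_mat D = D"
    and q: "\<And>v. v \<in> carrier_vec p \<Longrightarrow> \<bar>qform D v\<bar> \<le> e * (v \<bullet> v)"
    and x: "x \<in> carrier_vec p" and y: "y \<in> carrier_vec p"
  shows "x \<bullet> (D *\<^sub>v y) \<le> e * (sqrt (x \<bullet> x) * sqrt (y \<bullet> y))"
proof (cases "x \<bullet> x = 0 \<or> y \<bullet> y = 0")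
  case True
  then have "x = 0\<^sub>v p \<or> y = 0\<^sub>v p" using scalar_prod_self_eq_0 x y by blast
  moreover have "D *\<^sub>v 0\<^sub>v p = 0\<^sub>v p" using D by (intro eq_vecI) auto
  ultimately show ?thesis using x y D by (auto simp: mult_mat_vec_carrier[of D p p])
next
  case False
  define a b where "a = sqrt (x \<bullet> x)" and "b = sqrt (y \<bullet> y)"
  have ab: "0 < a" "0 < b" "a\<^sup>2 = x \<bullet> x" "b\<^sup>2 = y \<bullet> y"
    using False scalar_prod_self_nonneg[of x] scalar_prod_self_nonneg[of y] by (auto simp: a_def b_def)
  define s where "s = a / b"
  define z where "z = s \<cdot>\<^sub>v y"
  have z: "z \<in> carrier_vec p" using y by (simp add: z_def)
  have Dx: "D *\<^sub>v x \<in> carrier_vec p" "D *\<^sub>v z \<in> carrier_vec p" "D *\<^sub>v y \<in> carrier_vec p"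
    using D x y z by (auto intro!: mult_mat_vec_carrier[of _ p p])
  have sym: "z \<bullet> (D *\<^sub>v x) = x \<bullet> (D *\<^sub>v z)"
    using scalar_prod_mult_mat_vec[OF D(1) z x] D(2) comm_scalar_prod[OF Dx(2) x] by simp
  have xz: "z \<bullet> x = x \<bullet> z" by (rule comm_scalar_prod[OF z x])
  have plus: "(x + z) \<bullet> (D *\<^sub>v (x + z)) = qform D x + 2 * (x \<bullet> (D *\<^sub>v z)) + qform D z"
    using x z Dx by (simp add: mult_add_distrib_mat_vec[OF D(1) x z] add_scalar_prod_distrib[of _ p]
        scalar_prod_add_distrib[of _ p] sym)
  have minus: "(x - z) \<bullet> (D *\<^sub>v (x - z)) = qform D x - 2 * (x \<bullet> (D *\<^sub>v z)) + qform D z"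
    using x z Dx by (simp add: mult_minus_distrib_mat_vec[OF D(1) x z] minus_scalar_prod_distrib[of _ p]
        scalar_prod_minus_distrib[of _ p] sym)
  have n1: "(x + z) \<bullet> (x + z) = x \<bullet> x + 2 * (x \<bullet> z) + z \<bullet> z"
    using x z by (simp add: add_scalar_prod_distrib[of _ p] scalar_prod_add_distrib[of _ p] xz)
  have n2: "(x - z) \<bullet> (x - z) = x \<bullet> x - 2 * (x \<bullet> z) + z \<bullet> z"
    using x z by (simp add: minus_scalar_prod_distrib[of _ p] scalar_prod_minus_distrib[of _ p] xz)
  have "4 * (x \<bullet> (D *\<^sub>v z)) = (x + z) \<bullet> (D *\<^sub>v (x + z)) - (x - z) \<bullet> (D *\<^sub>v (x - z))"
    unfolding plus minus by simp
  also have "\<dots> \<le> e * ((x + z) \<bullet> (x + z)) + e * ((x - z) \<bullet> (x - z))"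
    using q[of "x + z"] q[of "x - z"] x z by (simp add: abs_le_iff)
  also have "\<dots> = 2 * e * (x \<bullet> x + z \<bullet> z)" unfolding n1 n2 by (simp add: algebra_simps)
  also have "z \<bullet> z = s\<^sup>2 * (y \<bullet> y)" using y by (simp add: z_def power2_eq_square)
  also have "\<dots> = a\<^sup>2" using ab by (simp add: s_def power_divide flip: ab(4))
  also have "x \<bullet> (D *\<^sub>v z) = s * (x \<bullet> (D *\<^sub>v y))"
    unfolding z_def mult_mat_vec[OF D(1) y] using x Dx by simp
  finally have "4 * (s * (x \<bullet> (D *\<^sub>v y))) \<le> 2 * e * (x \<bullet> x + a\<^sup>2)" .
  then have "s * (x \<bullet> (D *\<^sub>v y)) \<le> e * (x \<bullet> x)" using ab(3) by simp
  also have "e * (x \<bullet> x) = s * (e * (a * b))"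
    unfolding ab(3)[symmetric] using ab(1,2) by (simp add: s_def power2_eq_square)
  finally have "s * (x \<bullet> (D *\<^sub>v y)) \<le> s * (e * (a * b))" .
  moreover have "0 < s" using ab by (simp add: s_def)
  ultimately show ?thesis by (simp add: a_def b_def)
qed

lemma spiked_cov_carrier:
  assumes "V \<in> carrier_mat p r"
  shows "spiked_cov p r V L \<in> carrier_mat p p" "transpose_mat (spiked_cov p r V L) = spiked_cov p r V L"
proof -
  have VL: "V * mat_diag r L \<in> carrier_mat p r" using assms by simp
  have VLV: "V * mat_diag r L * transpose_mat V \<in> carrier_mat p p"
    using assms VL by (intro mult_carrier_mat[of _ p r]) auto
  show "spiked_cov p r V L \<in> carrier_mat p p" using VLV by (simp add: spiked_cov_def)
  have "transpose_mat (mat_diag r L) = mat_diag r L" by (intro eq_matI) (auto simp: mat_diag_def)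
  then have "transpose_mat (V * mat_diag r L * transpose_mat V) = V * (mat_diag r L * transpose_mat V)"
    using assms VL by (simp add: transpose_mult[of _ p r _ p] transpose_mult[of _ p r _ r])
  also have "\<dots> = V * mat_diag r L * transpose_mat V"
    using assms by (simp add: assoc_mult_mat[of _ p r _ r _ p])
  finally have "transpose_mat (V * mat_diag r L * transpose_mat V) = V * mat_diag r L * transpose_mat V" .
  moreover have "transpose_mat (1\<^sub>m p) = (1\<^sub>m p :: real mat)" by (intro eq_matI) auto
  ultimately show "transpose_mat (spiked_cov p r V L) = spiked_cov p r V L"
    unfolding spiked_cov_def by (subst transpose_add[OF VLV]) auto
qed

lemma spiked_cov_mult_vec:
  assumes V: "V \<in> carrier_mat p r" and x: "x \<in> carrier_vec p"
  shows "spiked_cov p r V L *\<^sub>v x = V *\<^sub>v (mat_diag r L *\<^sub>v (transpose_mat V *\<^sub>v x)) + x"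
proof -
  have VL: "V * mat_diag r L \<in> carrier_mat p r" using V by simp
  have VLV: "V * mat_diag r L * transpose_mat V \<in> carrier_mat p p"
    using V VL by (intro mult_carrier_mat[of _ p r]) auto
  have VTx: "transpose_mat V *\<^sub>v x \<in> carrier_vec r" using V x by (intro mult_mat_vec_carrier[of _ r p]) auto
  have "spiked_cov p r V L *\<^sub>v x = (V * mat_diag r L * transpose_mat V) *\<^sub>v x + 1\<^sub>m p *\<^sub>v x"
    unfolding spiked_cov_def using VLV x by (intro add_mult_distrib_mat_vec[of _ p p]) auto
  also have "(V * mat_diag r L * transpose_mat V) *\<^sub>v x = (V * mat_diag r L) *\<^sub>v (transpose_mat V *\<^sub>v x)"
    using VL V x by (intro assoc_mult_mat_vec[of _ p r _ p]) auto
  also have "\<dots> = V *\<^sub>v (mat_diag r L *\<^sub>v (transpose_mat V *\<^sub>v x))"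
    using V VTx by (intro assoc_mult_mat_vec[of _ p r _ r]) auto
  finally show ?thesis using x by simp
qed

lemma mat_diag_mult_vec:
  "x \<in> carrier_vec r \<Longrightarrow> (mat_diag r L :: real mat) *\<^sub>v x = Matrix.vec r (\<lambda>i. L i * x $ i)"
  by (intro eq_vecI) (auto simp: mat_diag_def scalar_prod_def if_distrib[of "\<lambda>a. a * _"] sum.If_cases
      cong: if_cong)

lemma spiked_cov_quadratic:
  assumes V: "V \<in> carrier_mat p r" and x: "x \<in> carrier_vec p"
  shows "qform (spiked_cov p r V L) x = (\<Sum>i<r. L i * ((transpose_mat V *\<^sub>v x) $ i)\<^sup>2) + x \<bullet> x"
proof -
  have VTx: "transpose_mat V *\<^sub>v x \<in> carrier_vec r" using V x by (intro mult_mat_vec_carrier[of _ r p]) auto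
  have LVx: "mat_diag r L *\<^sub>v (transpose_mat V *\<^sub>v x) \<in> carrier_vec r"
    by (rule mult_mat_vec_carrier[OF mat_diag_dim VTx])
  have VLx: "V *\<^sub>v (mat_diag r L *\<^sub>v (transpose_mat V *\<^sub>v x)) \<in> carrier_vec p"
    using V LVx by (rule mult_mat_vec_carrier)
  have "qform (spiked_cov p r V L) x = x \<bullet> (V *\<^sub>v (mat_diag r L *\<^sub>v (transpose_mat V *\<^sub>v x))) + x \<bullet> x"
    unfolding spiked_cov_mult_vec[OF V x] using x VLx by (intro scalar_prod_add_distrib[of _ p])
  also have "x \<bullet> (V *\<^sub>v (mat_diag r L *\<^sub>v (transpose_mat V *\<^sub>v x))) =
      (transpose_mat V *\<^sub>v x) \<bullet> (mat_diag r L *\<^sub>v (transpose_mat V *\<^sub>v x))"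
    by (rule scalar_prod_mult_mat_vec[OF V x LVx])
  also have "\<dots> = (\<Sum>i<r. L i * ((transpose_mat V *\<^sub>v x) $ i)\<^sup>2)"
    unfolding mat_diag_mult_vec[OF VTx] scalar_prod_def
    by (auto intro!: sum.cong simp: power2_eq_square atLeast0LessThan simp del: index_mult_mat_vec)
  finally show ?thesis .
qed

text \<open>
  The squared distance is the sum of the two squared norms, both \<open>r\<close>, minus twice the inner
  product of the projections.  The summand for \<open>l\<close> is the squared length of the component of the
  \<open>l\<close>-th column of \<open>W\<close> orthogonal to the range of \<open>V\<close>.
\<close>

lemma projection_frob_norm:
  assumes V: "V \<in> orthonormal_mats p r" and W: "W \<in> orthonormal_mats p r"
  shows "(frob_norm (W * transpose_mat W - V * transpose_mat V))\<^sup>2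
    = 2 * (\<Sum>l<r. 1 - (\<Sum>a<r. (\<Sum>i<p. W $$ (i, l) * V $$ (i, a))\<^sup>2))"
proof -
  note Vc = orthonormal_matsD(1)[OF V] note Wc = orthonormal_matsD(1)[OF W]
  define in_p where "in_p X Y l a = (\<Sum>i<p. X $$ (i, l) * Y $$ (i, a))" for X Y :: "real mat" and l a
  have cross: "(\<Sum>i<p. \<Sum>j<p. (\<Sum>l<r. X $$ (i, l) * X $$ (j, l)) * (\<Sum>a<r. Y $$ (i, a) * Y $$ (j, a)))
      = (\<Sum>l<r. \<Sum>a<r. (in_p X Y l a)\<^sup>2)" for X Y :: "real mat"
  proof -
    have "(\<Sum>i<p. \<Sum>j<p. (\<Sum>l<r. X $$ (i, l) * X $$ (j, l)) * (\<Sum>a<r. Y $$ (i, a) * Y $$ (j, a)))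
        = (\<Sum>i<p. \<Sum>j<p. \<Sum>l<r. \<Sum>a<r. (X $$ (i, l) * Y $$ (i, a)) * (X $$ (j, l) * Y $$ (j, a)))"
      by (simp add: sum_product algebra_simps)
    also have "\<dots> = (\<Sum>i<p. \<Sum>l<r. \<Sum>a<r. \<Sum>j<p. (X $$ (i, l) * Y $$ (i, a)) * (X $$ (j, l) * Y $$ (j, a)))"
      by (rule sum.cong[OF refl], rule trans[OF sum.swap], rule sum.cong[OF refl], rule sum.swap)
    also have "\<dots> = (\<Sum>l<r. \<Sum>a<r. \<Sum>i<p. \<Sum>j<p. (X $$ (i, l) * Y $$ (i, a)) * (X $$ (j, l) * Y $$ (j, a)))"
      by (rule trans[OF sum.swap], rule sum.cong[OF refl], rule sum.swap)
    also have "\<dots> = (\<Sum>l<r. \<Sum>a<r. (in_p X Y l a)\<^sup>2)"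
      unfolding in_p_def power2_eq_square sum_product ..
    finally show ?thesis .
  qed
  have self: "(\<Sum>l<r. \<Sum>a<r. (in_p X X l a)\<^sup>2) = real r" if "X \<in> orthonormal_mats p r" for X
  proof -
    have "(\<Sum>l<r. \<Sum>a<r. (in_p X X l a)\<^sup>2) = (\<Sum>l<r. \<Sum>a<r. if l = a then 1 else 0)"
      unfolding in_p_def using orthonormal_matsD(4)[OF that] by (intro sum.cong refl) auto
    then show ?thesis by simp
  qed
  define P where "P X i j = (\<Sum>l<r. X $$ (i, l) * X $$ (j, l))" for X :: "real mat" and i j
  have "(frob_norm (W * transpose_mat W - V * transpose_mat V))\<^sup>2 = (\<Sum>i<p. \<Sum>j<p. (P W i j - P V i j)\<^sup>2)"
    using Vc Wc unfolding frob_norm_def P_def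
    by (subst real_sqrt_pow2) (auto intro!: sum_nonneg sum.cong simp: scalar_prod_def atLeast0LessThan)
  also have "\<dots> = (\<Sum>i<p. \<Sum>j<p. P W i j * P W i j) + (\<Sum>i<p. \<Sum>j<p. P V i j * P V i j)
     - 2 * (\<Sum>i<p. \<Sum>j<p. P W i j * P V i j)"
    by (simp add: power2_eq_square algebra_simps sum.distrib sum_subtractf sum_distrib_left)
  also have "\<dots> = 2 * real r - 2 * (\<Sum>l<r. \<Sum>a<r. (in_p W V l a)\<^sup>2)"
    unfolding P_def cross self[OF V] self[OF W] by simp
  finally show ?thesis by (simp add: sum_subtractf in_p_def)
qed

text \<open>
  Let \<open>D = \<Gamma> - \<beta> \<Sigma>\<close>.  For a leading eigenvector \<open>w\<close> with eigenvalue \<open>\<mu>\<close> let \<open>u\<close> be its component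
  orthogonal to the range of \<open>V\<close>.  Since \<open>\<Sigma>\<close> is the identity on the orthogonal complement of that
  range, \<open>u\<^sup>T D w = (\<mu> - \<beta>) \<parallel>u\<parallel>\<^sup>2\<close>, so \<open>\<parallel>u\<parallel> \<le> e / (\<mu> - \<beta>)\<close>.  The gap \<open>\<mu> - \<beta> \<ge> \<beta> \<lambda> / 2\<close> is Weyl's
  inequality for the \<open>r\<close>-th eigenvalue.
\<close>

lemma davis_kahan:
  fixes \<Gamma> V W :: "real mat"
  assumes V: "V \<in> orthonormal_mats p r" and \<Gamma>: "\<Gamma> \<in> carrier_mat p p" "transpose_mat \<Gamma> = \<Gamma>"
    and W: "leading_eigenvectors p r \<Gamma> W" and r: "0 < r"
    and L: "\<And>i. i < r \<Longrightarrow> lam \<le> L i" and pos: "0 < \<beta>" "0 < lam"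
    and close: "\<And>v. v \<in> carrier_vec p \<Longrightarrow>
      \<bar>qform \<Gamma> v - \<beta> * qform (spiked_cov p r V L) v\<bar> \<le> e * (v \<bullet> v)"
    and e: "2 * e \<le> \<beta> * lam"
  shows "(frob_norm (W * transpose_mat W - V * transpose_mat V))\<^sup>2 \<le> 8 * real r * (e / (\<beta> * lam))\<^sup>2"
proof -
  define S where "S = spiked_cov p r V L"
  define D where "D = \<Gamma> + (- \<beta>) \<cdot>\<^sub>m S"
  note Vc = orthonormal_matsD(1)[OF V]
  have S: "S \<in> carrier_mat p p" "transpose_mat S = S"
    using spiked_cov_carrier[OF Vc] by (auto simp: S_def)
  have "transpose_mat ((- \<beta>) \<cdot>\<^sub>m S) = (- \<beta>) \<cdot>\<^sub>m transpose_mat S" by (intro eq_matI) auto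
  then have D: "D \<in> carrier_mat p p" "transpose_mat D = D"
    using \<Gamma> S by (auto simp: D_def transpose_add[of _ p p])
  have Dv: "D *\<^sub>v v = \<Gamma> *\<^sub>v v + (- \<beta>) \<cdot>\<^sub>v (S *\<^sub>v v)" if "v \<in> carrier_vec p" for v
  proof -
    have "((- \<beta>) \<cdot>\<^sub>m S) *\<^sub>v v = (- \<beta>) \<cdot>\<^sub>v (S *\<^sub>v v)"
      using S that by (intro eq_vecI) (auto simp: scalar_prod_def sum_distrib_left mult.assoc sum_negf)
    then show ?thesis
      unfolding D_def using \<Gamma> S that by (simp add: add_mult_distrib_mat_vec[of _ p p])
  qed
  have xDv: "x \<bullet> (D *\<^sub>v v) = x \<bullet> (\<Gamma> *\<^sub>v v) - \<beta> * (x \<bullet> (S *\<^sub>v v))"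
    if v: "v \<in> carrier_vec p" and x: "x \<in> carrier_vec p" for x v
  proof -
    have c: "\<Gamma> *\<^sub>v v \<in> carrier_vec p" "S *\<^sub>v v \<in> carrier_vec p"
      using \<Gamma> S v by (auto intro!: mult_mat_vec_carrier[of _ p p])
    have "x \<bullet> (D *\<^sub>v v) = x \<bullet> (\<Gamma> *\<^sub>v v) + x \<bullet> ((- \<beta>) \<cdot>\<^sub>v (S *\<^sub>v v))"
      unfolding Dv[OF v] using c x by (intro scalar_prod_add_distrib[of _ p]) auto
    also have "x \<bullet> ((- \<beta>) \<cdot>\<^sub>v (S *\<^sub>v v)) = - \<beta> * (x \<bullet> (S *\<^sub>v v))"
      using c x by (intro scalar_prod_smult_distrib[of _ p])
    finally show ?thesis by simp
  qed
  have bil: "x \<bullet> (D *\<^sub>v v) \<le> e * (sqrt (x \<bullet> x) * sqrt (v \<bullet> v))"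
    if "x \<in> carrier_vec p" "v \<in> carrier_vec p" for x v
  proof (rule bilinear_le_of_quadratic_le[OF D _ that])
    fix v :: "real vec" assume v: "v \<in> carrier_vec p"
    show "\<bar>qform D v\<bar> \<le> e * (v \<bullet> v)"
      using close[OF v] unfolding xDv[OF v v] S_def .
  qed
  have W': "W \<in> orthonormal_mats p r" using W by (simp add: leading_eigenvectors_def)
  obtain B \<mu> where B: "B \<in> orthonormal_mats p p"
    and spec: "\<forall>l<p. eigenvector \<Gamma> (col B l) (\<mu> l)"
      "\<forall>i j. i \<le> j \<and> j < p \<longrightarrow> \<mu> j \<le> \<mu> i" "\<forall>l<r. l < p \<and> col W l = col B l"
    using W unfolding leading_eigenvectors_def by (elim conjE bexE exE) (rule that)
  have ev: "eigenvector \<Gamma> (col B l) (\<mu> l)" if "l < p" for l using spec(1) that by simp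
  have \<mu>: "\<mu> j \<le> \<mu> i" if "i \<le> j" "j < p" for i j using spec(2) that by simp
  have WB: "col W l = col B l" if "l < r" for l using spec(3) that by simp
  note Bc = orthonormal_matsD(1)[OF B] note Wc = orthonormal_matsD(1)[OF W']
  have rp: "r \<le> p" by (rule orthonormal_mats_le[OF V])
  have eB: "\<Gamma> *\<^sub>v col B l = \<mu> l \<cdot>\<^sub>v col B l" if "l < p" for l
    using ev[OF that] by (simp add: eigenvector_def)
  have \<Gamma>B: "\<Gamma> * B = B * mat_diag p \<mu>"
  proof (rule eq_matI)
    fix i l assume "i < dim_row (B * mat_diag p \<mu>)" "l < dim_col (B * mat_diag p \<mu>)"
    then have il: "i < p" "l < p" using Bc by (auto simp: mat_diag_def)
    have "(\<Gamma> * B) $$ (i, l) = (\<Gamma> *\<^sub>v col B l) $ i" using \<Gamma> Bc il by simp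
    also have "\<dots> = (B * mat_diag p \<mu>) $$ (i, l)"
      unfolding eB[OF il(2)] mat_diag_mult_right[OF Bc] using Bc il by simp
    finally show "(\<Gamma> * B) $$ (i, l) = (B * mat_diag p \<mu>) $$ (i, l)" .
  qed (use \<Gamma> Bc in \<open>auto simp: mat_diag_def\<close>)
  have gap: "\<beta> * lam / 2 \<le> \<mu> (r - 1) - \<beta>"
  proof -
    \<comment> \<open>A vector \<open>V c\<close> orthogonal to the first \<open>r - 1\<close> eigenvectors of \<open>\<Gamma>\<close>: at it the form of \<open>\<Gamma>\<close> is at
      most the \<open>r\<close>-th eigenvalue, and that of \<open>\<Sigma>\<close> at least \<open>1 + \<lambda>\<close>.\<close>
    define M where "M = Matrix.mat (r - 1) r (\<lambda>(i, j). (transpose_mat B * V) $$ (i, j))"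
    have "M \<in> carrier_mat (r - 1) r" by (simp add: M_def)
    then obtain c where c: "c \<in> carrier_vec r" "c \<noteq> 0\<^sub>v r" "M *\<^sub>v c = 0\<^sub>v (r - 1)"
      using underdetermined_kernel[of M "r - 1" r] r by auto
    define w where "w = V *\<^sub>v c"
    define z where "z = transpose_mat B *\<^sub>v w"
    have w: "w \<in> carrier_vec p" using Vc c by (auto simp: w_def intro!: mult_mat_vec_carrier[of _ p r])
    have z: "z \<in> carrier_vec p" using Bc w by (auto simp: z_def intro!: mult_mat_vec_carrier[of _ p p])
    have VTw: "transpose_mat V *\<^sub>v w = c" unfolding w_def by (rule orthonormal_matsD(3)[OF V c(1)])
    have ww: "w \<bullet> w = c \<bullet> c"
      using scalar_prod_mult_mat_vec[OF Vc w c(1)] VTw by (simp add: w_def)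
    have BBT: "B * transpose_mat B = 1\<^sub>m p"
      using mat_mult_left_right_inverse[of "transpose_mat B" p B] Bc orthonormal_matsD(2)[OF B] by simp
    have Bz: "B *\<^sub>v z = w"
    proof -
      have "B *\<^sub>v z = (B * transpose_mat B) *\<^sub>v w"
        unfolding z_def using Bc w by (intro assoc_mult_mat_vec[symmetric, of _ p p _ p]) auto
      then show ?thesis using BBT w by simp
    qed
    have zz: "z \<bullet> z = w \<bullet> w"
      using scalar_prod_mult_mat_vec[OF Bc w z] Bz by (simp add: z_def)
    have z0: "z $ i = 0" if i: "i < r - 1" for i
    proof -
      have "z = (transpose_mat B * V) *\<^sub>v c"
        unfolding z_def w_def using Bc Vc c by (intro assoc_mult_mat_vec[symmetric, of _ p p _ r]) auto
      then have "z $ i = row (transpose_mat B * V) i \<bullet> c" using i rp Bc by simp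
      also have "row (transpose_mat B * V) i = row M i"
        using i rp Bc Vc by (intro eq_vecI) (auto simp: M_def)
      also have "row M i \<bullet> c = (M *\<^sub>v c) $ i" using i by (simp add: M_def)
      finally show ?thesis using c i by simp
    qed
    have "qform \<Gamma> w = (\<Sum>i<p. \<mu> i * (z $ i)\<^sup>2)"
    proof -
      have dz: "mat_diag p \<mu> *\<^sub>v z \<in> carrier_vec p" by (rule mult_mat_vec_carrier[of _ p p]) (use z in auto)
      have "\<Gamma> *\<^sub>v w = (\<Gamma> * B) *\<^sub>v z" unfolding Bz[symmetric] using \<Gamma> Bc z by simp
      also have "\<dots> = B *\<^sub>v (mat_diag p \<mu> *\<^sub>v z)" unfolding \<Gamma>B using Bc z by (intro assoc_mult_mat_vec[of _ p p _ p]) auto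
      finally have "qform \<Gamma> w = z \<bullet> (mat_diag p \<mu> *\<^sub>v z)"
        using scalar_prod_mult_mat_vec[OF Bc w dz] by (simp add: z_def)
      also have "\<dots> = (\<Sum>i<p. \<mu> i * (z $ i)\<^sup>2)"
        unfolding mat_diag_mult_vec[OF z] scalar_prod_def
        by (auto intro!: sum.cong simp: power2_eq_square atLeast0LessThan)
      finally show ?thesis .
    qed
    also have "\<dots> \<le> (\<Sum>i<p. \<mu> (r - 1) * (z $ i)\<^sup>2)"
    proof (intro sum_mono)
      fix i assume "i \<in> {..<p}"
      then show "\<mu> i * (z $ i)\<^sup>2 \<le> \<mu> (r - 1) * (z $ i)\<^sup>2"
        using z0[of i] \<mu>[of "r - 1" i] by (cases "i < r - 1") (auto intro!: mult_right_mono)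
    qed
    also have "\<dots> = \<mu> (r - 1) * (z \<bullet> z)"
      using z by (simp add: scalar_prod_def sum_distrib_left power2_eq_square atLeast0LessThan)
    finally have up: "qform \<Gamma> w \<le> \<mu> (r - 1) * (w \<bullet> w)" by (simp add: zz)
    have "qform S w = (\<Sum>i<r. L i * (c $ i)\<^sup>2) + w \<bullet> w"
      unfolding S_def spiked_cov_quadratic[OF Vc w] VTw ..
    moreover have "lam * (c \<bullet> c) \<le> (\<Sum>i<r. L i * (c $ i)\<^sup>2)"
    proof -
      have "lam * (c \<bullet> c) = (\<Sum>i<r. lam * (c $ i)\<^sup>2)"
        using c by (simp add: scalar_prod_def sum_distrib_left power2_eq_square atLeast0LessThan)
      also have "\<dots> \<le> (\<Sum>i<r. L i * (c $ i)\<^sup>2)" using L by (intro sum_mono mult_right_mono) auto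
      finally show ?thesis .
    qed
    ultimately have "(1 + lam) * (w \<bullet> w) \<le> qform S w" using ww by (simp add: algebra_simps)
    then have "\<beta> * ((1 + lam) * (w \<bullet> w)) \<le> \<beta> * qform S w" using pos by (intro mult_left_mono) auto
    moreover have "\<beta> * qform S w - qform \<Gamma> w \<le> e * (w \<bullet> w)"
      using close[OF w] by (simp add: S_def abs_le_iff)
    ultimately have "(\<beta> * (1 + lam)) * (w \<bullet> w) \<le> (\<mu> (r - 1) + e) * (w \<bullet> w)"
      using up by (simp add: algebra_simps)
    moreover have "0 < w \<bullet> w"
      using c scalar_prod_self_eq_0[OF c(1)] scalar_prod_self_nonneg[of c] by (simp add: ww)
    ultimately have "\<beta> * (1 + lam) \<le> \<mu> (r - 1) + e" by simp
    then show ?thesis using e by (simp add: algebra_simps)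
  qed
  have col_bound: "1 - (\<Sum>a<r. (\<Sum>i<p. W $$ (i, l) * V $$ (i, a))\<^sup>2) \<le> (2 * e / (\<beta> * lam))\<^sup>2" if l: "l < r" for l
  proof -
    define w where "w = col W l"
    define t where "t = transpose_mat V *\<^sub>v w"
    define u where "u = w - V *\<^sub>v t"
    have lp: "l < p" using l rp by simp
    have w: "w \<in> carrier_vec p" using Wc by (auto simp: w_def)
    have t: "t \<in> carrier_vec r" using Vc w by (auto simp: t_def intro!: mult_mat_vec_carrier[of _ r p])
    have Vt: "V *\<^sub>v t \<in> carrier_vec p" using Vc t by (rule mult_mat_vec_carrier)
    have u: "u \<in> carrier_vec p" using w Vt by (simp add: u_def)
    have ww: "w \<bullet> w = 1"
      using orthonormal_matsD(4)[OF W' l l] Wc l by (simp add: w_def scalar_prod_def atLeast0LessThan)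
    have \<Gamma>w: "\<Gamma> *\<^sub>v w = \<mu> l \<cdot>\<^sub>v w" using eB[OF lp] WB[OF l] by (simp add: w_def)
    have VTu: "transpose_mat V *\<^sub>v u = 0\<^sub>v r"
    proof -
      have "transpose_mat V *\<^sub>v u = t - transpose_mat V *\<^sub>v (V *\<^sub>v t)"
        unfolding u_def t_def using Vc w Vt[unfolded t_def]
        by (intro mult_minus_distrib_mat_vec[of _ r p]) auto
      then show ?thesis using orthonormal_matsD(3)[OF V t] t by simp
    qed
    have uV: "u \<bullet> (V *\<^sub>v x) = 0" if "x \<in> carrier_vec r" for x
      using scalar_prod_mult_mat_vec[OF Vc u that] VTu that by simp
    have uw: "u \<bullet> w = u \<bullet> u"
    proof -
      have "u \<bullet> u = u \<bullet> w - u \<bullet> (V *\<^sub>v t)"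
        unfolding u_def[of] by (rule scalar_prod_minus_distrib[of _ p]) (use u w Vt in \<open>auto simp: u_def\<close>)
      then show ?thesis using uV[OF t] by simp
    qed
    have uu: "u \<bullet> u = 1 - t \<bullet> t"
    proof -
      have "u \<bullet> w = w \<bullet> w - (V *\<^sub>v t) \<bullet> w"
        unfolding u_def by (rule minus_scalar_prod_distrib[of _ p]) (use w Vt in auto)
      also have "(V *\<^sub>v t) \<bullet> w = t \<bullet> t"
        using transpose_vec_mult_scalar[OF Vc t w] comm_scalar_prod[OF w Vt] by (simp add: t_def)
      finally show ?thesis using uw ww by simp
    qed
    have tt: "t \<bullet> t = (\<Sum>a<r. (\<Sum>i<p. W $$ (i, l) * V $$ (i, a))\<^sup>2)"
      using Vc Wc l lp t unfolding scalar_prod_def[of t t]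
      by (auto intro!: sum.cong simp: t_def w_def scalar_prod_def power2_eq_square atLeast0LessThan mult.commute)
    have uS: "u \<bullet> (S *\<^sub>v w) = u \<bullet> w"
    proof -
      have md: "mat_diag r L *\<^sub>v t \<in> carrier_vec r" by (rule mult_mat_vec_carrier[OF mat_diag_dim t])
      then have "u \<bullet> (V *\<^sub>v (mat_diag r L *\<^sub>v t)) = 0" by (rule uV)
      moreover have "u \<bullet> (S *\<^sub>v w) = u \<bullet> (V *\<^sub>v (mat_diag r L *\<^sub>v t)) + u \<bullet> w"
        unfolding S_def spiked_cov_mult_vec[OF Vc w] t_def[symmetric]
        using mult_mat_vec_carrier[OF Vc md] u w by (intro scalar_prod_add_distrib[of _ p])
      ultimately show ?thesis by simp
    qed
    have "u \<bullet> (D *\<^sub>v w) = (\<mu> l - \<beta>) * (u \<bullet> u)"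
      unfolding xDv[OF w u] \<Gamma>w uS using u w by (simp add: uw algebra_simps)
    then have *: "(\<mu> l - \<beta>) * (u \<bullet> u) \<le> e * sqrt (u \<bullet> u)"
      using bil[OF u w] ww by simp
    have gap_l: "\<beta> * lam / 2 \<le> \<mu> l - \<beta>" using gap \<mu>[of l "r - 1"] l rp by fastforce
    show ?thesis
    proof (cases "u \<bullet> u = 0")
      case True
      then show ?thesis using uu tt by simp
    next
      case False
      define d where "d = sqrt (u \<bullet> u)"
      have d: "0 < d" "d * d = u \<bullet> u" using False scalar_prod_self_nonneg[of u] by (auto simp: d_def)
      have "(\<beta> * lam / 2 * d) * d \<le> (\<mu> l - \<beta>) * (d * d)"
        unfolding mult.assoc[of "\<beta> * lam / 2"]
        by (intro mult_right_mono gap_l) (use d(1) in simp)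
      also have "\<dots> \<le> e * d" using * d by (simp add: d_def)
      finally have "\<beta> * lam / 2 * d \<le> e" using d by simp
      then have "d \<le> 2 * e / (\<beta> * lam)" using pos by (simp add: field_simps)
      then have "d\<^sup>2 \<le> (2 * e / (\<beta> * lam))\<^sup>2" using d by (intro power_mono) auto
      then show ?thesis using uu tt d by (simp add: power2_eq_square)
    qed
  qed
  have "(frob_norm (W * transpose_mat W - V * transpose_mat V))\<^sup>2
      = 2 * (\<Sum>l<r. 1 - (\<Sum>a<r. (\<Sum>i<p. W $$ (i, l) * V $$ (i, a))\<^sup>2))"
    by (rule projection_frob_norm[OF V W'])
  also have "\<dots> \<le> 2 * (\<Sum>l<r. (2 * e / (\<beta> * lam))\<^sup>2)"
    by (intro mult_left_mono sum_mono col_bound) auto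
  also have "\<dots> = 8 * real r * (e / (\<beta> * lam))\<^sup>2" by (simp add: power_divide power_mult_distrib)
  finally show ?thesis .
qed

section \<open>The Gaussian law of a spiked covariance\<close>

text \<open>
  Matrices of spiked form with the same \<open>V\<close> multiply like their diagonals, where \<open>1 + g\<close> is squared to
  \<open>1 + (g\<^sup>2 + 2 g)\<close>.  With \<open>g = \<surd>(1 + L) - 1\<close> this yields a symmetric square root of a spiked
  covariance.
\<close>

lemma spiked_cov_square:
  assumes V: "V \<in> orthonormal_mats p r"
  shows "spiked_cov p r V g * spiked_cov p r V g = spiked_cov p r V (\<lambda>i. g i * g i + 2 * g i)"
    (is "?S * ?S = ?T")
proof -
  note Vc = orthonormal_matsD(1)[OF V]
  have c: "?S \<in> carrier_mat p p" "?T \<in> carrier_mat p p" using spiked_cov_carrier(1)[OF Vc] by auto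
  have SS: "?S * ?S \<in> carrier_mat p p" using c by simp
  have mv: "(?S * ?S) *\<^sub>v x = ?T *\<^sub>v x" if x: "x \<in> carrier_vec p" for x
  proof -
    define t where "t = transpose_mat V *\<^sub>v x"
    have t: "t \<in> carrier_vec r" unfolding t_def using Vc x by (intro mult_mat_vec_carrier[of _ r p]) auto
    define h where "h = mat_diag r g *\<^sub>v t"
    have h: "h \<in> carrier_vec r" unfolding h_def by (rule mult_mat_vec_carrier[OF mat_diag_dim t])
    have Vh: "V *\<^sub>v h \<in> carrier_vec p" by (rule mult_mat_vec_carrier[OF Vc h])
    have Sx: "?S *\<^sub>v x = V *\<^sub>v h + x" unfolding spiked_cov_mult_vec[OF Vc x] h_def t_def ..
    have y: "V *\<^sub>v h + x \<in> carrier_vec p" using Vh x by simp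
    have "transpose_mat V *\<^sub>v (V *\<^sub>v h + x) = transpose_mat V *\<^sub>v (V *\<^sub>v h) + t"
      unfolding t_def using Vc Vh x by (intro mult_add_distrib_mat_vec[of _ r p]) auto
    also have "\<dots> = h + t" by (simp add: orthonormal_matsD(3)[OF V h])
    finally have VTy: "transpose_mat V *\<^sub>v (V *\<^sub>v h + x) = h + t" .
    have ht: "h + t \<in> carrier_vec r" using h t by simp
    have d: "mat_diag r g *\<^sub>v (h + t) \<in> carrier_vec r" by (rule mult_mat_vec_carrier[OF mat_diag_dim ht])
    have "(?S * ?S) *\<^sub>v x = ?S *\<^sub>v (V *\<^sub>v h + x)"
      using c(1) x by (simp add: assoc_mult_mat_vec[of _ p p _ p] Sx)
    also have "\<dots> = V *\<^sub>v (mat_diag r g *\<^sub>v (h + t)) + (V *\<^sub>v h + x)"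
      unfolding spiked_cov_mult_vec[OF Vc y] VTy ..
    also have "\<dots> = (V *\<^sub>v (mat_diag r g *\<^sub>v (h + t)) + V *\<^sub>v h) + x"
      using mult_mat_vec_carrier[OF Vc d] Vh x by (intro assoc_add_vec[symmetric])
    also have "V *\<^sub>v (mat_diag r g *\<^sub>v (h + t)) + V *\<^sub>v h = V *\<^sub>v (mat_diag r g *\<^sub>v (h + t) + h)"
      by (rule mult_add_distrib_mat_vec[OF Vc d h, symmetric])
    also have "mat_diag r g *\<^sub>v (h + t) + h = mat_diag r (\<lambda>i. g i * g i + 2 * g i) *\<^sub>v t"
    proof -
      have hv: "h = Matrix.vec r (\<lambda>i. g i * t $ i)" unfolding h_def by (rule mat_diag_mult_vec[OF t])
      show ?thesis
        unfolding mat_diag_mult_vec[OF ht] mat_diag_mult_vec[OF t] unfolding hv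
        using t by (intro eq_vecI) (auto simp: algebra_simps)
    qed
    also have "V *\<^sub>v \<dots> + x = ?T *\<^sub>v x" unfolding spiked_cov_mult_vec[OF Vc x] t_def ..
    finally show ?thesis .
  qed
  show ?thesis
  proof (rule eq_matI)
    fix i j assume "i < dim_row ?T" "j < dim_col ?T"
    then have ij: "i < p" "j < p" using c by auto
    have "(?S * ?S) *\<^sub>v unit_vec p j = ?T *\<^sub>v unit_vec p j" by (rule mv) simp
    moreover have "col M j = M *\<^sub>v unit_vec p j" if "M \<in> carrier_mat p p" for M :: "real mat"
      using that ij by (intro eq_vecI) (auto simp: scalar_prod_def unit_vec_def if_distrib[of "\<lambda>a. _ * a"] cong: if_cong)
    ultimately have "col (?S * ?S) j = col ?T j" using SS c(2) by simp
    then have "col (?S * ?S) j $ i = col ?T j $ i" by simp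
    then show "(?S * ?S) $$ (i, j) = ?T $$ (i, j)" using c ij by simp
  qed (use c in auto)
qed

lemma gaussian_factor_spiked:
  assumes V: "V \<in> orthonormal_mats p r" and L: "\<And>i. i < r \<Longrightarrow> 0 \<le> L i"
  defines "F \<equiv> gaussian_factor p (spiked_cov p r V L)"
  shows "F \<in> carrier_mat p p" "F * transpose_mat F = spiked_cov p r V L"
proof -
  note Vc = orthonormal_matsD(1)[OF V]
  define g where "g i = (if i < r then sqrt (1 + L i) - 1 else 0)" for i
  define A where "A = spiked_cov p r V g"
  have "mat_diag r (\<lambda>i. g i * g i + 2 * g i) = (mat_diag r L :: real mat)"
  proof (rule eq_matI)
    fix i j assume "i < dim_row (mat_diag r L)" "j < dim_col (mat_diag r L)"
    then have ij: "i < r" "j < r" by (auto simp: mat_diag_def)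
    have "sqrt (1 + L i) * sqrt (1 + L i) = 1 + L i" using L[OF ij(1)] by simp
    then have "g i * g i + 2 * g i = L i" using ij by (simp add: g_def algebra_simps)
    then show "mat_diag r (\<lambda>i. g i * g i + 2 * g i) $$ (i, j) = mat_diag r L $$ (i, j)"
      using ij by (cases "i = j") (auto simp: mat_diag_def)
  qed (auto simp: mat_diag_def)
  then have "spiked_cov p r V (\<lambda>i. g i * g i + 2 * g i) = spiked_cov p r V L"
    by (simp add: spiked_cov_def)
  then have "A \<in> carrier_mat p p \<and> A * transpose_mat A = spiked_cov p r V L"
    using spiked_cov_carrier[OF Vc, of g] spiked_cov_square[OF V, of g] by (simp add: A_def)
  then have "F \<in> carrier_mat p p \<and> F * transpose_mat F = spiked_cov p r V L"
    unfolding F_def gaussian_factor_def by (rule someI)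
  then show "F \<in> carrier_mat p p" "F * transpose_mat F = spiked_cov p r V L" by auto
qed

lemma gaussian_eq_gvec:
  assumes "gaussian_factor p \<Sigma> \<in> carrier_mat p p"
  shows "gaussian p \<Sigma> = gvec p (\<lambda>i j. gaussian_factor p \<Sigma> $$ (i, j))"
  unfolding gaussian_def gvec_def
proof (rule distr_cong)
  fix z :: "nat \<Rightarrow> real"
  show "(\<lambda>i\<in>{..<p}. (gaussian_factor p \<Sigma> *\<^sub>v Matrix.vec p z) $ i)
      = (\<lambda>i\<in>{..<p}. \<Sum>j<p. gaussian_factor p \<Sigma> $$ (i, j) * z j)"
    using assms by (auto simp: fun_eq_iff restrict_def scalar_prod_def atLeast0LessThan intro!: sum.cong)
qed auto

lemma gsd_eq_quadratic:
  assumes F: "F \<in> carrier_mat p p"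
  shows "gsd p (\<lambda>i j. F $$ (i, j)) u = sqrt (Matrix.vec p u \<bullet> (F * transpose_mat F *\<^sub>v Matrix.vec p u))"
proof -
  let ?u = "Matrix.vec p u"
  have u: "?u \<in> carrier_vec p" by simp
  have FTu: "transpose_mat F *\<^sub>v ?u \<in> carrier_vec p"
    using F by (intro mult_mat_vec_carrier[of _ p p]) auto
  have "?u \<bullet> (F * transpose_mat F *\<^sub>v ?u) = ?u \<bullet> (F *\<^sub>v (transpose_mat F *\<^sub>v ?u))"
    using F by (subst assoc_mult_mat_vec[of _ p p _ p]) auto
  also have "\<dots> = (transpose_mat F *\<^sub>v ?u) \<bullet> (transpose_mat F *\<^sub>v ?u)"
    by (rule scalar_prod_mult_mat_vec[OF F u FTu])
  also have "\<dots> = (\<Sum>j<p. (\<Sum>i<p. u i * F $$ (i, j))\<^sup>2)"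
    using F unfolding scalar_prod_def[of "transpose_mat F *\<^sub>v ?u" "transpose_mat F *\<^sub>v ?u"]
    by (auto intro!: sum.cong simp: scalar_prod_def power2_eq_square atLeast0LessThan mult.commute)
  finally show ?thesis by (simp add: gsd_def L2_set_def)
qed

text \<open>
  The upper bound is Bessel's inequality for the orthonormal columns of \<open>V\<close>.
\<close>

lemma spiked_cov_bounds:
  assumes V: "V \<in> orthonormal_mats p r" and L: "\<And>i. i < r \<Longrightarrow> 0 \<le> L i \<and> L i \<le> M" and M: "0 \<le> M"
    and x: "x \<in> carrier_vec p"
  shows "x \<bullet> x \<le> qform (spiked_cov p r V L) x"
    and "qform (spiked_cov p r V L) x \<le> (1 + M) * (x \<bullet> x)"
proof -
  note Vc = orthonormal_matsD(1)[OF V]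
  define t where "t = transpose_mat V *\<^sub>v x"
  have t: "t \<in> carrier_vec r" unfolding t_def using Vc x by (intro mult_mat_vec_carrier[of _ r p]) auto
  have Vt: "V *\<^sub>v t \<in> carrier_vec p" by (rule mult_mat_vec_carrier[OF Vc t])
  have q: "qform (spiked_cov p r V L) x = (\<Sum>i<r. L i * (t $ i)\<^sup>2) + x \<bullet> x"
    unfolding spiked_cov_quadratic[OF Vc x] t_def ..
  show "x \<bullet> x \<le> qform (spiked_cov p r V L) x"
    unfolding q using L by (auto intro!: sum_nonneg mult_nonneg_nonneg)
  have xVt: "x \<bullet> (V *\<^sub>v t) = t \<bullet> t" using scalar_prod_mult_mat_vec[OF Vc x t] by (simp add: t_def)
  have "(V *\<^sub>v t) \<bullet> (V *\<^sub>v t) = t \<bullet> t"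
    using scalar_prod_mult_mat_vec[OF Vc Vt t] orthonormal_matsD(3)[OF V t] by simp
  then have "(x - V *\<^sub>v t) \<bullet> (x - V *\<^sub>v t) = x \<bullet> x - t \<bullet> t"
    using x Vt xVt comm_scalar_prod[OF Vt x]
    by (simp add: minus_scalar_prod_distrib[of _ p] scalar_prod_minus_distrib[of _ p])
  then have bessel: "t \<bullet> t \<le> x \<bullet> x" using scalar_prod_self_nonneg[of "x - V *\<^sub>v t"] by simp
  have "(\<Sum>i<r. L i * (t $ i)\<^sup>2) \<le> (\<Sum>i<r. M * (t $ i)\<^sup>2)"
    using L by (intro sum_mono mult_right_mono) auto
  also have "\<dots> = M * (t \<bullet> t)"
    using t by (simp add: scalar_prod_def sum_distrib_left power2_eq_square atLeast0LessThan)
  also have "\<dots> \<le> M * (x \<bullet> x)" using bessel M by (rule mult_left_mono)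
  finally show "qform (spiked_cov p r V L) x \<le> (1 + M) * (x \<bullet> x)" unfolding q by (simp add: algebra_simps)
qed

lemma L2_set_vec: "L2_set u {..<p} = sqrt (Matrix.vec p u \<bullet> Matrix.vec p u)"
  by (simp add: L2_set_def scalar_prod_def power2_eq_square atLeast0LessThan)

lemma gauss_model_spiked:
  assumes V: "V \<in> orthonormal_mats p r" and L: "\<And>i. i < r \<Longrightarrow> 0 \<le> L i \<and> L i \<le> M" and M: "0 \<le> M"
  shows "gauss_model p (\<lambda>i j. gaussian_factor p (spiked_cov p r V L) $$ (i, j)) (sqrt (1 + M))"
proof
  let ?F = "gaussian_factor p (spiked_cov p r V L)"
  note F = gaussian_factor_spiked[OF V, of L]
  have sd: "gsd p (\<lambda>i j. ?F $$ (i, j)) u = sqrt (Matrix.vec p u \<bullet> (spiked_cov p r V L *\<^sub>v Matrix.vec p u))" for u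
    using gsd_eq_quadratic[of ?F p u] F L by simp
  fix u :: "nat \<Rightarrow> real"
  have u: "Matrix.vec p u \<in> carrier_vec p" by simp
  note b = spiked_cov_bounds[OF V L M u]
  show "L2_set u {..<p} \<le> gsd p (\<lambda>i j. ?F $$ (i, j)) u"
    unfolding sd L2_set_vec using b(1) by (intro real_sqrt_le_mono)
  show "gsd p (\<lambda>i j. ?F $$ (i, j)) u \<le> sqrt (1 + M) * L2_set u {..<p}"
    unfolding sd L2_set_vec real_sqrt_mult[symmetric] using b(2) by (intro real_sqrt_le_mono)
qed (use M in simp)

section \<open>Maximizers of matrix depth\<close>

definition count_below :: "nat \<Rightarrow> nat \<Rightarrow> (nat \<Rightarrow> nat \<Rightarrow> real) \<Rightarrow> real vec \<Rightarrow> real \<Rightarrow> real" where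
  "count_below p n X u a = (\<Sum>i<n. of_bool (\<bar>u \<bullet> Matrix.vec p (X i)\<bar>\<^sup>2 \<le> a))"

definition count_above :: "nat \<Rightarrow> nat \<Rightarrow> (nat \<Rightarrow> nat \<Rightarrow> real) \<Rightarrow> real vec \<Rightarrow> real \<Rightarrow> real" where
  "count_above p n X u a = (\<Sum>i<n. of_bool (\<bar>u \<bullet> Matrix.vec p (X i)\<bar>\<^sup>2 \<ge> a))"

lemma matrix_depth_eq:
  "matrix_depth p n U \<Gamma> X = Min ((\<lambda>u. min ((1 / real n) * count_below p n X u (qform \<Gamma> u))
     ((1 / real n) * count_above p n X u (qform \<Gamma> u))) ` U)"
  by (simp only: matrix_depth_def count_below_def count_above_def)

lemma count_below_add_above: "real n \<le> count_below p n X u a + count_above p n X u a"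
proof -
  have "real n = (\<Sum>i<n. 1)" by simp
  also have "\<dots> \<le> count_below p n X u a + count_above p n X u a"
    unfolding count_below_def count_above_def sum.distrib[symmetric]
    by (intro sum_mono) (auto simp: of_bool_def)
  finally show ?thesis .
qed

lemma count_below_mono: "a \<le> a' \<Longrightarrow> count_below p n X u a \<le> count_below p n X u a'"
  unfolding count_below_def by (intro sum_mono) (auto simp: of_bool_def)

lemma count_above_antimono: "a \<le> a' \<Longrightarrow> count_above p n X u a' \<le> count_above p n X u a"
  unfolding count_above_def by (intro sum_mono) (auto simp: of_bool_def)

text \<open>
  The values are multiples of \<open>1 / n\<close> between 0 and 1, so the minimum over an infinite set of directions
  is attained.
\<close>

lemma matrix_depth_image_finite:
  "finite ((\<lambda>u. min ((1 / real n) * count_below p n X u (qform \<Gamma> u))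
     ((1 / real n) * count_above p n X u (qform \<Gamma> u))) ` U)"
proof (rule finite_subset)
  have count: "(1 / real n) * (\<Sum>i<n. of_bool (P i)) \<in> (\<lambda>k. (1 / real n) * real k) ` {..n}" for P
  proof -
    have "(\<Sum>i<n. of_bool (P i)) = real (card {i \<in> {..<n}. P i})"
      by (simp add: of_bool_def sum.If_cases Int_def)
    moreover have "card {i \<in> {..<n}. P i} \<le> n" using card_mono[of "{..<n}" "{i \<in> {..<n}. P i}"] by auto
    ultimately show ?thesis by auto
  qed
  show "(\<lambda>u. min ((1 / real n) * count_below p n X u (qform \<Gamma> u))
     ((1 / real n) * count_above p n X u (qform \<Gamma> u))) ` U \<subseteq> (\<lambda>k. (1 / real n) * real k) ` {..n}"
    unfolding min_def count_below_def count_above_def using count by (auto simp del: mult_cancel_left)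
qed auto

lemma matrix_depth_le:
  assumes "0 < n" "u \<in> U"
  shows "real n * matrix_depth p n U \<Gamma> X \<le> count_below p n X u (qform \<Gamma> u)"
    and "real n * matrix_depth p n U \<Gamma> X \<le> count_above p n X u (qform \<Gamma> u)"
proof -
  have "matrix_depth p n U \<Gamma> X \<le> min ((1 / real n) * count_below p n X u (qform \<Gamma> u))
     ((1 / real n) * count_above p n X u (qform \<Gamma> u))"
    unfolding matrix_depth_eq using assms(2) by (intro Min_le matrix_depth_image_finite imageI)
  then show "real n * matrix_depth p n U \<Gamma> X \<le> count_below p n X u (qform \<Gamma> u)"
    and "real n * matrix_depth p n U \<Gamma> X \<le> count_above p n X u (qform \<Gamma> u)"
    using assms(1) by (simp_all add: field_simps)
qed

lemma matrix_depth_ge: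
  assumes "0 < n" "U \<noteq> {}"
    and "\<And>u. u \<in> U \<Longrightarrow> real n * t \<le> count_below p n X u (qform \<Gamma> u)"
    and "\<And>u. u \<in> U \<Longrightarrow> real n * t \<le> count_above p n X u (qform \<Gamma> u)"
  shows "t \<le> matrix_depth p n U \<Gamma> X"
  unfolding matrix_depth_eq using assms
  by (subst Min_ge_iff[OF matrix_depth_image_finite]) (auto simp: field_simps)


lemma quadratic_form_sum:
  assumes "M \<in> carrier_mat p p" "v \<in> carrier_vec p"
  shows "(v :: real vec) \<bullet> (M *\<^sub>v v) = (\<Sum>i<p. \<Sum>j<p. v $ i * M $$ (i, j) * v $ j)"
  using assms by (simp add: scalar_prod_def atLeast0LessThan sum_distrib_left mult.assoc)

lemma obtain_superset_card:
  assumes "S \<subseteq> {..<p::nat}" "card S \<le> k" "k \<le> p"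
  obtains S' where "S \<subseteq> S'" "S' \<subseteq> {..<p}" "card S' = k"
proof -
  have "finite S" using assms(1) by (rule finite_subset) simp
  then have "k - card S \<le> card ({..<p} - S)" using assms by (simp add: card_Diff_subset)
  then obtain T where T: "T \<subseteq> {..<p} - S" "card T = k - card S" "finite T"
    using obtain_subset_with_card_n by blast
  then have "card (S \<union> T) = k" using \<open>finite S\<close> assms by (subst card_Un_disjoint) auto
  then show ?thesis using T assms by (intro that[of "S \<union> T"]) auto
qed

text \<open>
  Off the diagonal the difference of the two matrices lives on a set \<open>S\<close> of \<open>2 s\<close> indices.  Its form at \<open>v\<close>
  is therefore the form at the restriction of \<open>v\<close> to \<open>S\<close>, a multiple of a sparse direction, plus diagonal
  terms outside of \<open>S\<close>, and the diagonal entries are the values at the unit vectors.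
\<close>

lemma sparse_quadratic_bound_all:
  assumes \<Gamma>: "\<Gamma> \<in> sparse_covs p s" and \<Sigma>: "\<Sigma> \<in> sparse_covs p s" and s: "0 < s" "2 * s \<le> p"
    and u: "\<And>u. u \<in> sparse_directions p s \<Longrightarrow> \<bar>qform \<Gamma> u - qform \<Sigma> u\<bar> \<le> E"
    and v: "v \<in> carrier_vec p"
  shows "\<bar>qform \<Gamma> v - qform \<Sigma> v\<bar> \<le> E * (v \<bullet> v)"
proof -
  have c: "\<Gamma> \<in> carrier_mat p p" "\<Sigma> \<in> carrier_mat p p" using \<Gamma> \<Sigma> by (auto simp: sparse_covs_def psd_def)
  define D where "D i j = \<Gamma> $$ (i, j) - \<Sigma> $$ (i, j)" for i j
  define q where "q w = qform \<Gamma> w - qform \<Sigma> w" for w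
  have q: "q w = (\<Sum>i<p. \<Sum>j<p. w $ i * D i j * w $ j)" if "w \<in> carrier_vec p" for w
    unfolding q_def quadratic_form_sum[OF c(1) that] quadratic_form_sum[OF c(2) that] D_def
    by (simp add: sum_subtractf[symmetric] algebra_simps)
  have off: "\<exists>S\<subseteq>{..<p}. card S \<le> s \<and> (\<forall>i<p. \<forall>j<p. i \<noteq> j \<longrightarrow> i \<notin> S \<or> j \<notin> S \<longrightarrow> M $$ (i, j) = 0)"
    if Mc: "M \<in> sparse_covs p s" for M
  proof -
    have M: "M \<in> carrier_mat p p" using Mc by (auto simp: sparse_covs_def psd_def)
    obtain S where S: "S \<subseteq> {..<p}" "card S \<le> s"
      "M - mat_diag p (\<lambda>i. M $$ (i, i)) \<in> supported_mats p S"
      using Mc by (auto simp: sparse_covs_def sparse_mats_def)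
    have "M $$ (i, j) = 0" if "i < p" "j < p" "i \<noteq> j" "i \<notin> S \<or> j \<notin> S" for i j
    proof -
      have "(M - mat_diag p (\<lambda>i. M $$ (i, i))) $$ (i, j) = 0"
        using S(3) that by (auto simp: supported_mats_def)
      then show ?thesis using that M by (simp add: mat_diag_def)
    qed
    then show ?thesis using S by blast
  qed
  obtain S1 where S1: "S1 \<subseteq> {..<p}" "card S1 \<le> s"
    "\<And>i j. i < p \<Longrightarrow> j < p \<Longrightarrow> i \<noteq> j \<Longrightarrow> i \<notin> S1 \<or> j \<notin> S1 \<Longrightarrow> \<Gamma> $$ (i, j) = 0"
    using off[OF \<Gamma>] by blast
  obtain S2 where S2: "S2 \<subseteq> {..<p}" "card S2 \<le> s"
    "\<And>i j. i < p \<Longrightarrow> j < p \<Longrightarrow> i \<noteq> j \<Longrightarrow> i \<notin> S2 \<or> j \<notin> S2 \<Longrightarrow> \<Sigma> $$ (i, j) = 0"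
    using off[OF \<Sigma>] by blast
  have "card (S1 \<union> S2) \<le> 2 * s" using card_Un_le[of S1 S2] S1(2) S2(2) by linarith
  then obtain S where S: "S1 \<union> S2 \<subseteq> S" "S \<subseteq> {..<p}" "card S = 2 * s"
    using obtain_superset_card[of "S1 \<union> S2" p "2 * s"] S1(1) S2(1) s(2) by (metis Un_least)
  have D0: "D i j = 0" if "i < p" "j < p" "i \<noteq> j" "i \<notin> S \<or> j \<notin> S" for i j
  proof -
    have "i \<notin> S1 \<or> j \<notin> S1" "i \<notin> S2 \<or> j \<notin> S2" using S(1) that(4) by auto
    then show ?thesis using S1(3)[OF that(1,2,3)] S2(3)[OF that(1,2,3)] by (simp add: D_def)
  qed
  have supp: "\<bar>q w\<bar> \<le> E * (w \<bullet> w)"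
    if w: "w \<in> carrier_vec p" and S': "S' \<subseteq> {..<p}" "card S' = 2 * s" "\<And>i. i < p \<Longrightarrow> i \<notin> S' \<Longrightarrow> w $ i = 0" for w S'
  proof (cases "w = 0\<^sub>v p")
    case True
    then show ?thesis by (simp add: q)
  next
    case False
    define a where "a = sqrt (w \<bullet> w)"
    have a: "0 < a" "a * a = w \<bullet> w"
      using False scalar_prod_self_eq_0[OF w] scalar_prod_self_nonneg[of w] by (auto simp: a_def)
    define u' where "u' = (1 / a) \<cdot>\<^sub>v w"
    have u': "u' \<in> carrier_vec p" using w by (simp add: u'_def)
    have w_pos: "0 < w \<bullet> w" using a by (metis mult_pos_pos)
    then have "u' \<bullet> u' = 1" using w a by (simp add: u'_def)
    then have "u' \<in> sparse_directions p s"
      using u' S' w by (auto simp: sparse_directions_def supported_sphere_def u'_def)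
    then have "\<bar>q u'\<bar> \<le> E" using u by (simp add: q_def)
    moreover have "q u' = q w / (a * a)"
      unfolding q[OF u'] q[OF w] sum_divide_distrib using w by (intro sum.cong refl) (auto simp: u'_def)
    ultimately have "\<bar>q w\<bar> / (a * a) \<le> E" using a(1) by (simp add: abs_mult)
    then show ?thesis using a(2) w_pos by (simp add: field_simps)
  qed
  have diag: "\<bar>D i i\<bar> \<le> E" if i: "i < p" for i
  proof -
    obtain S' where S': "{i} \<subseteq> S'" "S' \<subseteq> {..<p}" "card S' = 2 * s"
      using obtain_superset_card[of "{i}" p "2 * s"] i s by auto
    have e: "unit_vec p i \<in> carrier_vec p" by simp
    have "q (unit_vec p i) = D i i"
      unfolding q[OF e] using i
      by (simp add: unit_vec_def if_distrib[of "\<lambda>a. a * _"] if_distrib[of "\<lambda>a. _ * a"] cong: if_cong)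
    moreover have "unit_vec p i \<bullet> unit_vec p i = (1 :: real)" using i by simp
    moreover have "unit_vec p i $ j = (0 :: real)" if "j < p" "j \<notin> S'" for j
      using that S'(1) by (auto simp: unit_vec_def)
    ultimately show ?thesis using supp[OF e S'(2,3)] by simp
  qed
  define w where "w = Matrix.vec p (\<lambda>i. if i \<in> S then v $ i else 0)"
  have w: "w \<in> carrier_vec p" by (simp add: w_def)
  have pt: "v $ i * D i j * v $ j = w $ i * D i j * w $ j + (if i = j \<and> i \<notin> S then D i i * (v $ i)\<^sup>2 else 0)"
    if "i < p" "j < p" for i j
    using that D0[of i j] by (cases "i = j") (auto simp: w_def power2_eq_square)
  have "q v = (\<Sum>i<p. \<Sum>j<p. w $ i * D i j * w $ j + (if i = j \<and> i \<notin> S then D i i * (v $ i)\<^sup>2 else 0))"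
    unfolding q[OF v] using pt by (intro sum.cong refl) auto
  also have "\<dots> = q w + (\<Sum>i<p. \<Sum>j<p. if i = j \<and> i \<notin> S then D i i * (v $ i)\<^sup>2 else 0)"
    unfolding q[OF w] by (simp add: sum.distrib)
  also have "(\<Sum>i<p. \<Sum>j<p. if i = j \<and> i \<notin> S then D i i * (v $ i)\<^sup>2 else 0) =
      (\<Sum>i<p. if i \<notin> S then D i i * (v $ i)\<^sup>2 else 0)"
  proof (intro sum.cong refl)
    fix i assume "i \<in> {..<p}"
    then show "(\<Sum>j<p. if i = j \<and> i \<notin> S then D i i * (v $ i)\<^sup>2 else 0) = (if i \<notin> S then D i i * (v $ i)\<^sup>2 else 0)"
      by (cases "i \<in> S") simp_all
  qed
  finally have qv: "q v = q w + (\<Sum>i<p. if i \<notin> S then D i i * (v $ i)\<^sup>2 else 0)" .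
  have "\<bar>q v\<bar> \<le> \<bar>q w\<bar> + (\<Sum>i<p. \<bar>if i \<notin> S then D i i * (v $ i)\<^sup>2 else 0\<bar>)"
    unfolding qv
    by (rule order_trans[OF abs_triangle_ineq add_left_mono[OF sum_abs]])
  also have "\<dots> \<le> E * (w \<bullet> w) + (\<Sum>i<p. if i \<notin> S then E * (v $ i)\<^sup>2 else 0)"
  proof (intro add_mono sum_mono)
    show "\<bar>q w\<bar> \<le> E * (w \<bullet> w)" using supp[OF w S(2,3)] by (auto simp: w_def)
    fix i assume "i \<in> {..<p}"
    then show "\<bar>if i \<notin> S then D i i * (v $ i)\<^sup>2 else 0\<bar> \<le> (if i \<notin> S then E * (v $ i)\<^sup>2 else 0)"
      using diag[of i] by (auto simp: abs_mult intro!: mult_right_mono)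
  qed
  also have "\<dots> = E * (w \<bullet> w + (\<Sum>i<p. if i \<notin> S then (v $ i)\<^sup>2 else 0))"
    unfolding distrib_left sum_distrib_left by (intro arg_cong2[where f="(+)"] sum.cong refl) simp
  also have "w \<bullet> w + (\<Sum>i<p. if i \<notin> S then (v $ i)\<^sup>2 else 0) = v \<bullet> v"
  proof -
    have "w \<bullet> w = (\<Sum>i<p. if i \<in> S then (v $ i)\<^sup>2 else 0)"
      unfolding scalar_prod_def by (intro sum.cong) (auto simp: w_def power2_eq_square atLeast0LessThan)
    moreover have "v \<bullet> v = (\<Sum>i<p. (v $ i)\<^sup>2)"
      using v unfolding scalar_prod_def by (intro sum.cong) (auto simp: power2_eq_square atLeast0LessThan)
    moreover have "(\<Sum>i<p. if i \<in> S then (v $ i)\<^sup>2 else 0) + (\<Sum>i<p. if i \<notin> S then (v $ i)\<^sup>2 else 0)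
        = (\<Sum>i<p. (v $ i)\<^sup>2)"
      unfolding sum.distrib[symmetric] by (intro sum.cong refl) simp
    ultimately show ?thesis by simp
  qed
  finally show ?thesis by (simp add: q_def)
qed

lemma scaled_spiked_cov_sparse:
  assumes V: "V \<in> orthonormal_mats p r" and supp: "card (row_supp V) \<le> s"
    and L: "\<And>i. i < r \<Longrightarrow> 0 \<le> L i" and \<beta>: "0 \<le> \<beta>"
  shows "\<beta> \<cdot>\<^sub>m spiked_cov p r V L \<in> sparse_covs p s"
proof -
  note Vc = orthonormal_matsD(1)[OF V]
  let ?S = "spiked_cov p r V L"
  have S: "?S \<in> carrier_mat p p" "transpose_mat ?S = ?S" using spiked_cov_carrier[OF Vc] by auto
  have "transpose_mat (\<beta> \<cdot>\<^sub>m ?S) = \<beta> \<cdot>\<^sub>m transpose_mat ?S" by (intro eq_matI) auto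
  moreover have "0 \<le> qform (\<beta> \<cdot>\<^sub>m ?S) v" if v: "v \<in> carrier_vec p" for v
  proof -
    have "qform (\<beta> \<cdot>\<^sub>m ?S) v = \<beta> * qform ?S v"
      using S by (simp add: quadratic_form_sum[OF _ v] sum_distrib_left mult_ac)
    moreover have "0 \<le> qform ?S v"
      unfolding spiked_cov_quadratic[OF Vc v] using L scalar_prod_self_nonneg[of v]
      by (intro add_nonneg_nonneg sum_nonneg) auto
    ultimately show ?thesis using \<beta> by simp
  qed
  ultimately have psd: "psd p (\<beta> \<cdot>\<^sub>m ?S)" using S by (simp add: psd_def)
  have zero: "?S $$ (i, j) = 0" if ij: "i < p" "j < p" "i \<noteq> j" "i \<notin> row_supp V \<or> j \<notin> row_supp V" for i j
  proof -
    have row0: "V $$ (i, a) = 0" if "i < p" "i \<notin> row_supp V" "a < r" for i a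
    proof -
      have "row V i = 0\<^sub>v r" using that Vc by (simp add: row_supp_def)
      then have "row V i $ a = 0" using that by simp
      then show ?thesis using that Vc by simp
    qed
    have "(V * mat_diag r L * transpose_mat V) $$ (i, j) = (\<Sum>a<r. V $$ (i, a) * L a * V $$ (j, a))"
      using Vc ij by (simp add: mat_diag_mult_right[OF Vc] scalar_prod_def atLeast0LessThan)
    also have "\<dots> = 0" using row0 ij by (intro sum.neutral) auto
    finally show ?thesis using Vc ij by (simp add: spiked_cov_def)
  qed
  have "\<beta> \<cdot>\<^sub>m ?S - mat_diag p (\<lambda>i. (\<beta> \<cdot>\<^sub>m ?S) $$ (i, i)) \<in> supported_mats p (row_supp V)"
    unfolding supported_mats_def using S zero
    by (auto simp: mat_diag_def intro!: minus_carrier_mat) 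
  moreover have "row_supp V \<subseteq> {..<p}" using Vc by (auto simp: row_supp_def)
  ultimately show ?thesis using psd supp by (auto simp: sparse_covs_def sparse_mats_def)
qed

text \<open>
  The reference matrix \<open>S\<close> has depth at least \<open>1/2 - \<eta>\<close> and the maximizer does at least as well.  If its
  form at \<open>u\<close> were at least \<open>hi u\<close> or at most \<open>lo u\<close>, one of its two counts at \<open>u\<close> would be too small
  for that.
\<close>

lemma depth_maximizer_close:
  fixes \<Gamma> S :: "real mat"
  assumes n: "0 < n" and max: "is_arg_max (\<lambda>\<Gamma>. matrix_depth p n U \<Gamma> X) (\<lambda>\<Gamma>. \<Gamma> \<in> C) \<Gamma>"
    and ref: "S \<in> C"
    and half: "\<And>u. u \<in> U \<Longrightarrow> count_above p n X u (qform S u) \<le> real n * (1 / 2 + \<eta>)"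
      "\<And>u. u \<in> U \<Longrightarrow> count_below p n X u (qform S u) \<le> real n * (1 / 2 + \<eta>)"
    and few: "\<And>u. u \<in> U \<Longrightarrow> count_above p n X u (hi u) < real n * (1 / 2 - \<eta>)"
      "\<And>u. u \<in> U \<Longrightarrow> count_below p n X u (lo u) < real n * (1 / 2 - \<eta>)"
    and u: "u \<in> U"
  shows "lo u < qform \<Gamma> u \<and> qform \<Gamma> u < hi u"
proof -
  have "1 / 2 - \<eta> \<le> matrix_depth p n U S X"
  proof (rule matrix_depth_ge[OF n])
    show "U \<noteq> {}" using u by auto
    fix w assume w: "w \<in> U"
    show "real n * (1 / 2 - \<eta>) \<le> count_below p n X w (qform S w)"
      using half(1)[OF w] count_below_add_above[of n p X w "qform S w"] by (simp add: algebra_simps)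
    show "real n * (1 / 2 - \<eta>) \<le> count_above p n X w (qform S w)"
      using half(2)[OF w] count_below_add_above[of n p X w "qform S w"] by (simp add: algebra_simps)
  qed
  also have "\<dots> \<le> matrix_depth p n U \<Gamma> X" using max ref by (auto simp: is_arg_max_def not_less)
  finally have depth: "real n * (1 / 2 - \<eta>) \<le> real n * matrix_depth p n U \<Gamma> X"
    using n by (intro mult_left_mono) auto
  have "count_below p n X u (lo u) < count_below p n X u (qform \<Gamma> u)"
    using few(2)[OF u] depth matrix_depth_le(1)[OF n u, of p \<Gamma> X] by linarith
  moreover have "count_above p n X u (hi u) < count_above p n X u (qform \<Gamma> u)"
    using few(1)[OF u] depth matrix_depth_le(2)[OF n u, of p \<Gamma> X] by linarith
  ultimately show ?thesis
    using count_below_mono[of "qform \<Gamma> u" "lo u" p n X u] count_above_antimono[of "hi u" "qform \<Gamma> u" p n X u]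
    by linarith
qed

section \<open>The rate of the leading eigenvectors\<close>

text \<open>
  The length of the chain: the largest \<open>J\<close> with \<open>2\<^sup>J x \<le> 1\<close>.
\<close>

lemma dyadic_scale:
  fixes x :: real
  assumes "0 < x" "x \<le> 1"
  shows "\<exists>J::nat. 2 ^ J * x \<le> 1 \<and> 1 \<le> 2 * 2 ^ J * x"
proof -
  define P where "P N \<longleftrightarrow> 1 \<le> 2 ^ N * x" for N :: nat
  obtain N where "1 / x < 2 ^ N" using real_arch_pow[of 2 "1 / x"] by auto
  then have "P N" using assms by (simp add: P_def field_simps)
  then have least: "P (LEAST N. P N)" by (rule LeastI)
  show ?thesis
  proof (cases "LEAST N. P N")
    case 0
    then show ?thesis using least assms by (intro exI[of _ 0]) (auto simp: P_def)
  next
    case (Suc J)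
    then have "\<not> P J" using not_less_Least[of J P] by simp
    then show ?thesis using least Suc by (intro exI[of _ J]) (auto simp: P_def)
  qed
qed


lemma space_iid_sample_contaminated:
  "space (iid_sample n (contaminated p \<epsilon> \<Sigma> Q)) = space (iid_sample n (Rspace p))"
  by (simp add: iid_sample_def space_PiM contaminated_def space_measure_of sets.space_closed)

text \<open>
  Depth is formulated with unit vectors, but the slab of a direction is invariant under scaling; the
  chaining bound uses the normalization to variance 1, in which all functionals have the same law.
\<close>

lemma direction_to_unit_variance:
  fixes u :: "real vec"
  assumes u: "u \<in> sparse_directions p s"
    and sd: "\<And>w. gsd p A w = sqrt (Matrix.vec p w \<bullet> (S *\<^sub>v Matrix.vec p w))"
    and S: "S \<in> carrier_mat p p" and v: "0 < qform S u"
  obtains w where "sparse_fun p (2 * s) w" "gsd p A w = 1"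
    and "\<And>T. 0 \<le> T \<Longrightarrow> count_above p n X u (T\<^sup>2 * qform S u) = (\<Sum>i<n. of_bool (lin p w (X i) \<in> band (True, T)))"
    and "\<And>T. 0 \<le> T \<Longrightarrow> count_below p n X u (T\<^sup>2 * qform S u) = (\<Sum>i<n. of_bool (lin p w (X i) \<in> band (False, T)))"
proof -
  obtain I where I: "I \<subseteq> {..<p}" "card I = 2 * s" "u \<in> supported_sphere p I"
    using u by (auto simp: sparse_directions_def)
  then have uc: "u \<in> carrier_vec p" by (simp add: supported_sphere_def)
  define a where "a = sqrt (qform S u)"
  have a: "0 < a" "a\<^sup>2 = qform S u" using v by (auto simp: a_def)
  define w where "w i = (if i < p then u $ i / a else 0)" for i
  have vec_w: "Matrix.vec p w = (1 / a) \<cdot>\<^sub>v u"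
    using uc by (intro eq_vecI) (auto simp: w_def)
  have "w i = 0" if "i \<notin> I" for i
    using that I uc by (auto simp: w_def supported_sphere_def)
  then have sparse: "sparse_fun p (2 * s) w" using I by (auto simp: sparse_fun_def intro!: exI[of _ I])
  have Su: "S *\<^sub>v u \<in> carrier_vec p" by (rule mult_mat_vec_carrier[OF S uc])
  have "Matrix.vec p w \<bullet> (S *\<^sub>v Matrix.vec p w) = (1 / a) * ((1 / a) * qform S u)"
    unfolding vec_w mult_mat_vec[OF S uc] using uc Su by simp
  also have "\<dots> = 1" unfolding a(2)[symmetric] using a(1) by (simp add: power2_eq_square)
  finally have sd1: "gsd p A w = 1" unfolding sd by simp
  have lin: "\<bar>u \<bullet> Matrix.vec p x\<bar> = a * \<bar>lin p w x\<bar>" for x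
  proof -
    have "u \<bullet> Matrix.vec p x = (\<Sum>i<p. u $ i * x i)"
      by (simp add: scalar_prod_def atLeast0LessThan)
    also have "\<dots> = a * lin p w x"
      unfolding lin_def sum_distrib_left using a(1) by (intro sum.cong) (auto simp: w_def)
    finally show ?thesis using a(1) by (simp add: abs_mult)
  qed
  show ?thesis
  proof (rule that[OF sparse sd1])
    fix T :: real assume T: "0 \<le> T"
    have eq: "T\<^sup>2 * qform S u = a\<^sup>2 * T\<^sup>2" by (simp add: a(2))
    have "T\<^sup>2 \<le> \<bar>lin p w x\<bar>\<^sup>2 \<longleftrightarrow> T \<le> \<bar>lin p w x\<bar>" "\<bar>lin p w x\<bar>\<^sup>2 \<le> T\<^sup>2 \<longleftrightarrow> \<bar>lin p w x\<bar> \<le> T" for x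
      using T abs_le_square_iff[of T "lin p w x"] abs_le_square_iff[of "lin p w x" T] by simp_all
    then show "count_above p n X u (T\<^sup>2 * qform S u) = (\<Sum>i<n. of_bool (lin p w (X i) \<in> band (True, T)))"
      and "count_below p n X u (T\<^sup>2 * qform S u) = (\<Sum>i<n. of_bool (lin p w (X i) \<in> band (False, T)))"
      using a(1) unfolding count_above_def count_below_def eq lin power_mult_distrib
      by (simp_all add: band_def del: power2_abs)
  qed
qed

text \<open>
  With \<open>b = 3 \<eta> / c0\<close>, where \<open>\<eta> = Cp \<surd>y + \<epsilon>\<close>, the slab at \<open>\<tau> - b\<close> and the complement of the slab at
  \<open>\<tau> + b\<close> have Gaussian probabilities at most \<open>1/2 - 3 \<eta>\<close>, so the corresponding sample fractions stay below \<open>1/2 - \<eta>\<close>, the depth that the maximizer is known to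
  reach.
\<close>

lemma depth_estimate:
  fixes M \<tau> c0 :: real
  defines "Cp \<equiv> 377 + 530 * (6 + 2 * ln (2 * sqrt (1 + M)))"
    and "\<nu> \<equiv> density lborel std_normal_density"
  assumes M: "0 < M" and \<tau>: "0 < \<tau>" and c0: "0 < c0"
    and median: "measure \<nu> (band (True, \<tau>)) = 1 / 2" "measure \<nu> (band (False, \<tau>)) = 1 / 2"
    and slope: "measure \<nu> (band (True, \<tau> + b)) \<le> 1 / 2 - c0 * b"
      "measure \<nu> (band (False, \<tau> - b)) \<le> 1 / 2 - c0 * b"
    and size: "0 < n" "0 < s" "2 * s \<le> p" and \<epsilon>: "0 \<le> \<epsilon>" "\<epsilon> \<le> 1" and \<delta>: "0 < \<delta>" "\<delta> < 1"
    and V: "V \<in> orthonormal_mats p r" "card (row_supp V) \<le> s" and L: "\<And>i. i < r \<Longrightarrow> 0 \<le> L i \<and> L i \<le> M"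
    and Q: "prob_space Q" "sets Q = sets (Rspace p)"
    and y: "y = (real s * (1 + ln (real p / real s)) + ln (1 / \<delta>)) / real n" "y \<le> 1"
    and b: "b = 3 * (Cp * sqrt y + \<epsilon>) / c0" "b \<le> 1" "b \<le> \<tau>"
  shows "with_prob_at_least (iid_sample n (contaminated p \<epsilon> (spiked_cov p r V L) Q)) (1 - 2 * \<delta>)
    (\<lambda>X. \<forall>\<Gamma>. is_arg_max (\<lambda>\<Gamma>. matrix_depth p n (sparse_directions p s) \<Gamma> X) (\<lambda>\<Gamma>. \<Gamma> \<in> sparse_covs p s) \<Gamma> \<longrightarrow>
      (\<forall>v\<in>carrier_vec p. \<bar>qform \<Gamma> v - \<tau>\<^sup>2 * qform (spiked_cov p r V L) v\<bar>
         \<le> (2 * \<tau> + 1) * (1 + M) * b * (v \<bullet> v)))"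
proof -
  let ?S = "spiked_cov p r V L"
  define A where "A i j = gaussian_factor p ?S $$ (i, j)" for i j
  define D where "D = real s * (1 + ln (real p / real s)) + ln (1 / \<delta>)"
  define \<T> where "\<T> = {(True, \<tau>), (False, \<tau>), (True, \<tau> + b), (False, \<tau> - b)}"
  note Vc = orthonormal_matsD(1)[OF V(1)]
  note Sc = spiked_cov_carrier(1)[OF Vc, of L]
  have F: "gaussian_factor p ?S \<in> carrier_mat p p" "gaussian_factor p ?S * transpose_mat (gaussian_factor p ?S) = ?S"
    using gaussian_factor_spiked[OF V(1), of L] L by auto
  have sd: "gsd p A w = sqrt (Matrix.vec p w \<bullet> (?S *\<^sub>v Matrix.vec p w))" for w
    using gsd_eq_quadratic[OF F(1), of w] unfolding F(2) A_def .
  have ln\<delta>: "0 < ln (1 / \<delta>)" using \<delta> by simp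
  have s_pos: "0 < real s * (1 + ln (real p / real s))"
    using size by (intro mult_pos_pos add_pos_nonneg) auto
  have D_pos: "0 < D" using ln\<delta> s_pos by (simp add: D_def)
  have yD: "y = D / real n" by (simp add: y D_def)
  have y_pos: "0 < y" using D_pos size by (simp add: yD)
  obtain J where J: "2 ^ J * sqrt y \<le> 1" "1 \<le> 2 * 2 ^ J * sqrt y"
    using dyadic_scale[of "sqrt y"] y_pos y(2) by auto
  interpret gauss_model p A "sqrt (1 + M)"
    using gauss_model_spiked[OF V(1), of L M] L M by (simp add: A_def[abs_def])
  interpret gauss_sample p A "sqrt (1 + M)" s n J D \<T>
  proof
    show "card \<T> \<le> 4" using card_length[of "[(True, \<tau>), (False, \<tau>), (True, \<tau> + b), (False, \<tau> - b)]"]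
      by (simp add: \<T>_def)
    show "D \<le> real n" using y(2) size by (simp add: yD)
  qed (use size ln\<delta> J in \<open>auto simp: D_def \<T>_def yD\<close>)
  have y_eq: "gauss_sample.y n D = y" by (simp add: y_def yD)
  have c_eq: "377 + 530 * c = Cp" by (simp add: c_def Cp_def)
  have cont: "contaminated p \<epsilon> ?S Q = distr (coupling \<epsilon> G Q) G pick"
  proof -
    have "gaussian p ?S = G" using gaussian_eq_gvec[OF F(1)] by (simp add: A_def[abs_def])
    moreover have "space G = space (Rspace p)" by (rule sets_eq_imp_space_eq[OF sets_gvec])
    ultimately show ?thesis
      using mixture_eq_distr_pick[OF G.prob_space_axioms Q(1) _ \<epsilon>] Q(2)
      by (simp add: contaminated_def sets_gvec)
  qed
  have "ln (1 / \<delta>) \<le> D" using s_pos by (simp add: D_def)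
  from contaminated_uniform_bound[OF Q \<epsilon> \<delta>(1) this]
  have "\<exists>E\<in>sets (iid_sample n (contaminated p \<epsilon> ?S Q)).
    1 - 2 * \<delta> \<le> measure (iid_sample n (contaminated p \<epsilon> ?S Q)) E \<and>
    (\<forall>X\<in>E. \<forall>h\<in>\<T>. \<forall>u\<in>K. (\<Sum>i<n. of_bool (lin p u (X i) \<in> band h)) \<le>
       real n * (measure \<nu> (band h) + Cp * sqrt y + \<epsilon>))"
    unfolding cont c_eq y_eq \<nu>_def .
  then obtain E where E: "E \<in> sets (iid_sample n (contaminated p \<epsilon> ?S Q))"
    "1 - 2 * \<delta> \<le> measure (iid_sample n (contaminated p \<epsilon> ?S Q)) E"
    and dev_all: "\<forall>X\<in>E. \<forall>h\<in>\<T>. \<forall>u\<in>K. (\<Sum>i<n. of_bool (lin p u (X i) \<in> band h)) \<le>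
       real n * (measure \<nu> (band h) + Cp * sqrt y + \<epsilon>)"
    by (elim bexE conjE) (rule that)
  have dev: "(\<Sum>i<n. of_bool (lin p u (X i) \<in> band h)) \<le> real n * (measure \<nu> (band h) + Cp * sqrt y + \<epsilon>)"
    if "X \<in> E" "h \<in> \<T>" "u \<in> K" for X h u
    using dev_all that by blast
  define \<eta> where "\<eta> = Cp * sqrt y + \<epsilon>"
  have "0 < Cp" using c_ge by (simp flip: c_eq)
  then have \<eta>: "0 < \<eta>" using y_pos \<epsilon> by (simp add: \<eta>_def add_pos_nonneg)
  have b_pos: "0 < b" "c0 * b = 3 * \<eta>" using \<eta> c0 by (auto simp: b(1) \<eta>_def)
  have ref: "\<tau>\<^sup>2 \<cdot>\<^sub>m ?S \<in> sparse_covs p s"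
    using L by (intro scaled_spiked_cov_sparse V) auto
  have "\<bar>qform \<Gamma> v - \<tau>\<^sup>2 * qform ?S v\<bar> \<le> (2 * \<tau> + 1) * (1 + M) * b * (v \<bullet> v)"
    if X: "X \<in> E" and max: "is_arg_max (\<lambda>\<Gamma>. matrix_depth p n (sparse_directions p s) \<Gamma> X) (\<lambda>\<Gamma>. \<Gamma> \<in> sparse_covs p s) \<Gamma>"
      and v: "v \<in> carrier_vec p" for X \<Gamma> v
  proof -
    have scale: "qform (\<tau>\<^sup>2 \<cdot>\<^sub>m ?S) w = \<tau>\<^sup>2 * qform ?S w" if "w \<in> carrier_vec p" for w
      using Sc by (simp add: quadratic_form_sum[OF _ that] sum_distrib_left mult_ac)
    have dir: "u \<in> carrier_vec p" "u \<bullet> u = 1" if "u \<in> sparse_directions p s" for u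
      using that by (auto simp: sparse_directions_def supported_sphere_def)
    have var: "1 \<le> qform ?S u" "qform ?S u \<le> 1 + M" if "u \<in> sparse_directions p s" for u
      using spiked_cov_bounds[OF V(1) L less_imp_le[OF M] dir(1)[OF that]] dir(2)[OF that] by auto
    have counts: "count_above p n X u (T\<^sup>2 * qform ?S u) \<le> real n * (measure \<nu> (band (True, T)) + \<eta>)"
      if u: "u \<in> sparse_directions p s" and T: "0 \<le> T" "(True, T) \<in> \<T>" for u T
    proof -
      have "0 < qform ?S u" using var(1)[OF u] by simp
      from direction_to_unit_variance[OF u sd Sc this, of n X] obtain w where
        w: "sparse_fun p (2 * s) w" "gsd p A w = 1"
          "count_above p n X u (T\<^sup>2 * qform ?S u) = (\<Sum>i<n. of_bool (lin p w (X i) \<in> band (True, T)))"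
        using T(1) by metis
      then have "w \<in> K" by (simp add: K_def k_def)
      from dev[OF X T(2) this] show ?thesis unfolding w(3) by (simp add: \<eta>_def add.assoc)
    qed
    have counts': "count_below p n X u (T\<^sup>2 * qform ?S u) \<le> real n * (measure \<nu> (band (False, T)) + \<eta>)"
      if u: "u \<in> sparse_directions p s" and T: "0 \<le> T" "(False, T) \<in> \<T>" for u T
    proof -
      have "0 < qform ?S u" using var(1)[OF u] by simp
      from direction_to_unit_variance[OF u sd Sc this, of n X] obtain w where
        w: "sparse_fun p (2 * s) w" "gsd p A w = 1"
          "count_below p n X u (T\<^sup>2 * qform ?S u) = (\<Sum>i<n. of_bool (lin p w (X i) \<in> band (False, T)))"
        using T(1) by metis
      then have "w \<in> K" by (simp add: K_def k_def)
      from dev[OF X T(2) this] show ?thesis unfolding w(3) by (simp add: \<eta>_def add.assoc)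
    qed
    have strict: "real n * (q + \<eta>) < real n * (1 / 2 - \<eta>)" if "q \<le> 1 / 2 - c0 * b" for q
      using that b_pos(2) \<eta> size(1) by (intro mult_strict_left_mono) auto
    have close: "(\<tau> - b)\<^sup>2 * qform ?S u < qform \<Gamma> u \<and> qform \<Gamma> u < (\<tau> + b)\<^sup>2 * qform ?S u"
      if u: "u \<in> sparse_directions p s" for u
    proof (rule depth_maximizer_close[OF size(1) max ref, where lo="\<lambda>u. (\<tau> - b)\<^sup>2 * qform ?S u" and hi="\<lambda>u. (\<tau> + b)\<^sup>2 * qform ?S u"])
      fix w assume w: "w \<in> sparse_directions p s"
      show "count_above p n X w (qform (\<tau>\<^sup>2 \<cdot>\<^sub>m ?S) w) \<le> real n * (1 / 2 + \<eta>)"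
        using counts[OF w, of \<tau>] median \<tau> by (simp add: \<T>_def scale[OF dir(1)[OF w]])
      show "count_below p n X w (qform (\<tau>\<^sup>2 \<cdot>\<^sub>m ?S) w) \<le> real n * (1 / 2 + \<eta>)"
        using counts'[OF w, of \<tau>] median \<tau> by (simp add: \<T>_def scale[OF dir(1)[OF w]])
      show "count_above p n X w ((\<tau> + b)\<^sup>2 * qform ?S w) < real n * (1 / 2 - \<eta>)"
        by (rule order_le_less_trans[OF counts[OF w] strict[OF slope(1)]]) (use \<tau> b_pos in \<open>auto simp: \<T>_def\<close>)
      show "count_below p n X w ((\<tau> - b)\<^sup>2 * qform ?S w) < real n * (1 / 2 - \<eta>)"
        by (rule order_le_less_trans[OF counts'[OF w] strict[OF slope(2)]]) (use b(3) in \<open>auto simp: \<T>_def\<close>)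
    qed (rule u)
    have "\<bar>qform \<Gamma> u - qform (\<tau>\<^sup>2 \<cdot>\<^sub>m ?S) u\<bar> \<le> (2 * \<tau> + 1) * (1 + M) * b"
      if u: "u \<in> sparse_directions p s" for u
    proof -
      define q where "q = qform ?S u"
      have q: "0 < q" "q \<le> 1 + M" using var[OF u] by (auto simp: q_def)
      have up: "(\<tau> + b)\<^sup>2 - \<tau>\<^sup>2 \<le> (2 * \<tau> + 1) * b"
        using mult_left_mono[OF b(2), of b] b_pos(1) by (simp add: power2_eq_square algebra_simps)
      have lo: "\<tau>\<^sup>2 - (\<tau> - b)\<^sup>2 \<le> (2 * \<tau> + 1) * b"
      proof -
        have "\<tau>\<^sup>2 - (\<tau> - b)\<^sup>2 = 2 * \<tau> * b - b\<^sup>2" by (simp add: power2_eq_square algebra_simps)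
        also have "\<dots> \<le> (2 * \<tau> + 1) * b" using b_pos(1) by (simp add: algebra_simps add_nonneg_pos less_imp_le)
        finally show ?thesis .
      qed
      have "\<bar>qform \<Gamma> u - \<tau>\<^sup>2 * q\<bar> \<le> (2 * \<tau> + 1) * b * q"
        using close[OF u] mult_right_mono[OF up less_imp_le[OF q(1)]] mult_right_mono[OF lo less_imp_le[OF q(1)]]
        unfolding q_def[symmetric] abs_le_iff by (simp add: left_diff_distrib)
      also have "\<dots> \<le> (2 * \<tau> + 1) * b * (1 + M)" using q \<tau> b_pos(1) by (intro mult_left_mono) auto
      finally show ?thesis unfolding scale[OF dir(1)[OF u]] q_def[symmetric] by (simp add: mult_ac)
    qed
    moreover have "\<Gamma> \<in> sparse_covs p s" using max by (simp add: is_arg_max_def)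
    ultimately have "\<bar>qform \<Gamma> v - qform (\<tau>\<^sup>2 \<cdot>\<^sub>m ?S) v\<bar> \<le> (2 * \<tau> + 1) * (1 + M) * b * (v \<bullet> v)"
      by (intro sparse_quadratic_bound_all[OF _ ref size(2,3) _ v])
    then show ?thesis unfolding scale[OF v] .
  qed
  then show ?thesis unfolding with_prob_at_least_def using E by blast
qed

theorem theorem3p8:
  fixes M C2 :: real
  assumes "0 < M" and "0 < C2"
  shows "\<exists>C C1 :: real. 0 < C \<and> 0 < C1 \<and>
    (\<forall>(n::nat) (p::nat) (s::nat) (r::nat) (lam::real) (\<epsilon>::real)
      (\<Gamma>hat :: (nat \<Rightarrow> nat \<Rightarrow> real) \<Rightarrow> real mat) (Vhat :: (nat \<Rightarrow> nat \<Rightarrow> real) \<Rightarrow> real mat)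
      (\<delta>::real) (V :: real mat) (L :: nat \<Rightarrow> real) (Q :: (nat \<Rightarrow> real) measure).
      0 < n \<and> 0 < p \<and> 0 < s \<and> 0 < r \<and> 2 * s \<le> p \<and> real r \<le> C2 \<and>
      0 < lam \<and> lam \<le> M \<and> 0 \<le> \<epsilon> \<and> \<epsilon> < 1 / 5 \<and>
      (\<forall>X\<in>space (iid_sample n (Rspace p)).
         is_arg_max (\<lambda>\<Gamma>. matrix_depth p n (sparse_directions p s) \<Gamma> X)
           (\<lambda>\<Gamma>. \<Gamma> \<in> sparse_covs p s) (\<Gamma>hat X) \<and>
         leading_eigenvectors p r (\<Gamma>hat X) (Vhat X)) \<and>
      0 < \<delta> \<and> \<delta> < 1 / 2 \<and> C1 * rate n p s lam \<epsilon> \<delta> \<le> 1 \<and>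
      spiked_params p s lam M r V L \<and>
      prob_space Q \<and> sets Q = sets (Rspace p)
      \<longrightarrow>
      with_prob_at_least (iid_sample n (contaminated p \<epsilon> (spiked_cov p r V L) Q)) (1 - 2 * \<delta>)
        (\<lambda>X. (frob_norm (Vhat X * transpose_mat (Vhat X) - V * transpose_mat V))\<^sup>2
               \<le> C * rate n p s lam \<epsilon> \<delta>))"
proof (rule normal_median)
  fix \<tau> c0 :: real
  assume \<tau>: "0 < \<tau>" and c0: "0 < c0"
    and median: "measure (density lborel std_normal_density) (band (True, \<tau>)) = 1 / 2"
      "measure (density lborel std_normal_density) (band (False, \<tau>)) = 1 / 2"
    and slope: "\<And>b. 0 \<le> b \<Longrightarrow> b \<le> 1 \<Longrightarrow> b \<le> \<tau> \<Longrightarrow>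
        measure (density lborel std_normal_density) (band (True, \<tau> + b)) \<le> 1 / 2 - c0 * b"
      "\<And>b. 0 \<le> b \<Longrightarrow> b \<le> 1 \<Longrightarrow> b \<le> \<tau> \<Longrightarrow>
        measure (density lborel std_normal_density) (band (False, \<tau> - b)) \<le> 1 / 2 - c0 * b"
  define Cp where "Cp = 377 + 530 * (6 + 2 * ln (2 * sqrt (1 + M)))"
  have Cp: "0 < Cp"
    using \<open>0 < M\<close> unfolding Cp_def by (intro add_pos_nonneg mult_nonneg_nonneg add_nonneg_nonneg ln_ge_zero)
      (auto intro: order_trans[of 1 "sqrt (1 + M)"])
  \<comment> \<open>\<open>B\<close> bounds \<open>b\<close>, and \<open>H\<close> the distance of the quadratic forms, in units of \<open>lam * sqrt rate\<close>.\<close>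
  define B where "B = 3 * (Cp + 1) / c0"
  define H where "H = (2 * \<tau> + 1) * (1 + M) * B"
  have B: "0 < B" using Cp c0 by (simp add: B_def)
  have H: "0 < H" using B \<tau> \<open>0 < M\<close> by (simp add: H_def)
  \<comment> \<open>Each summand after the first enforces one smallness condition below: \<open>y \<le> 1\<close>, \<open>b \<le> 1\<close>, \<open>b \<le> \<tau>\<close>, and the gap
    condition of the perturbation bound.\<close>
  define R where "R = 1 + M + B * M + B * M / \<tau> + 2 * H / \<tau>\<^sup>2"
  define C where "C = 8 * C2 * (H / \<tau>\<^sup>2)\<^sup>2"
  have terms: "0 < B * M" "0 < B * M / \<tau>" "0 < 2 * H / \<tau>\<^sup>2" using B H \<tau> \<open>0 < M\<close> by auto
  have R: "0 < R" "M \<le> R" "B * M \<le> R" "B * M / \<tau> \<le> R" "2 * H / \<tau>\<^sup>2 \<le> R"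
    using terms \<open>0 < M\<close> unfolding R_def by linarith+
  have main: "with_prob_at_least (iid_sample n (contaminated p \<epsilon> (spiked_cov p r V L) Q)) (1 - 2 * \<delta>)
        (\<lambda>X. (frob_norm (Vhat X * transpose_mat (Vhat X) - V * transpose_mat V))\<^sup>2
               \<le> C * rate n p s lam \<epsilon> \<delta>)"
    if size: "0 < n" "0 < p" "0 < s" "0 < r" "2 * s \<le> p" "real r \<le> C2"
      and lam: "0 < lam" "lam \<le> M" and \<epsilon>: "0 \<le> \<epsilon>" "\<epsilon> < 1 / 5"
      and est: "\<And>X. X \<in> space (iid_sample n (Rspace p)) \<Longrightarrow>
         is_arg_max (\<lambda>\<Gamma>. matrix_depth p n (sparse_directions p s) \<Gamma> X)
           (\<lambda>\<Gamma>. \<Gamma> \<in> sparse_covs p s) (\<Gamma>hat X) \<and>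
         leading_eigenvectors p r (\<Gamma>hat X) (Vhat X)"
      and \<delta>: "0 < \<delta>" "\<delta> < 1 / 2" and small: "R\<^sup>2 * rate n p s lam \<epsilon> \<delta> \<le> 1"
      and params: "spiked_params p s lam M r V L"
      and Q: "prob_space Q" "sets Q = sets (Rspace p)"
    for n p s r :: nat and lam \<epsilon> :: real and \<Gamma>hat Vhat \<delta> V L Q
  proof -
    define \<rho> where "\<rho> = rate n p s lam \<epsilon> \<delta>"
    define y where "y = (real s * (1 + ln (real p / real s)) + ln (1 / \<delta>)) / real n"
    have V: "V \<in> orthonormal_mats p r" "card (row_supp V) \<le> s"
      and L: "\<And>i. i < r \<Longrightarrow> lam \<le> L i \<and> L i \<le> M"
      using params by (auto simp: spiked_params_def)
    have L0: "0 \<le> L i \<and> L i \<le> M" if "i < r" for i using L[OF that] lam by auto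
    have ln_eq: "ln (exp 1 * real p / real s) = 1 + ln (real p / real s)"
      using size by (simp add: ln_mult ln_div)
    have ln\<delta>: "0 < ln (1 / \<delta>)" using \<delta> by simp
    have "0 \<le> real s * (1 + ln (real p / real s))"
      using size by (intro mult_nonneg_nonneg add_nonneg_nonneg) auto
    then have y0: "0 \<le> y" using ln\<delta> by (simp add: y_def)
    have n_lam: "0 < real n * lam\<^sup>2" using size lam by simp
    have y_rate: "y \<le> lam\<^sup>2 * \<rho>"
    proof -
      have "y / lam\<^sup>2 = real s * (1 + ln (real p / real s)) / (real n * lam\<^sup>2) + ln (1 / \<delta>) / (real n * lam\<^sup>2)"
        by (simp add: y_def add_divide_distrib)
      also have "\<dots> \<le> \<rho>" unfolding \<rho>_def rate_def ln_eq by (intro add_right_mono max.cobounded1)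
      finally show ?thesis using lam by (simp add: field_simps)
    qed
    have \<epsilon>_rate: "\<epsilon>\<^sup>2 \<le> lam\<^sup>2 * \<rho>"
    proof -
      have "\<epsilon>\<^sup>2 / lam\<^sup>2 \<le> max (real s * ln (exp 1 * real p / real s) / (real n * lam\<^sup>2)) (\<epsilon>\<^sup>2 / lam\<^sup>2)"
        by simp
      also have "\<dots> \<le> \<rho>"
        using divide_nonneg_pos[OF less_imp_le[OF ln\<delta>] n_lam] unfolding \<rho>_def rate_def by linarith
      finally show ?thesis using lam by (simp add: field_simps)
    qed
    have \<rho>0: "0 \<le> \<rho>" using \<epsilon>_rate lam by (smt (verit) zero_le_mult_iff zero_le_power2 zero_less_power)
    define t where "t = sqrt \<rho>"
    have t: "0 \<le> t" "t\<^sup>2 = \<rho>" using \<rho>0 by (auto simp: t_def)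
    have Rt: "R * t \<le> 1"
    proof -
      have "(R * t)\<^sup>2 \<le> 1\<^sup>2" using small by (simp add: power_mult_distrib t(2) \<rho>_def)
      then show ?thesis by (rule power2_le_imp_le) simp
    qed
    have times_t: "a * t \<le> 1" if "a \<le> R" for a
      using mult_right_mono[OF that t(1)] Rt by linarith
    have lt: "0 \<le> lam * t" "(lam * t)\<^sup>2 = lam\<^sup>2 * \<rho>" using lam t by (simp_all only: power_mult_distrib mult_nonneg_nonneg less_imp_le)
    have sqrt_y: "sqrt y \<le> lam * t"
      using y_rate lt(1) unfolding lt(2)[symmetric] by (intro real_le_lsqrt)
    have \<epsilon>_t: "\<epsilon> \<le> lam * t"
      using \<epsilon>_rate lt(1) unfolding lt(2)[symmetric] by (rule power2_le_imp_le)
    define b where "b = 3 * (Cp * sqrt y + \<epsilon>) / c0"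
    have b0: "0 \<le> b" using Cp c0 \<epsilon> y0 by (simp add: b_def)
    have b_t: "b \<le> B * (lam * t)"
    proof -
      have "Cp * sqrt y + \<epsilon> \<le> Cp * (lam * t) + lam * t"
        using sqrt_y \<epsilon>_t Cp by (intro add_mono mult_left_mono) auto
      then have "3 * (Cp * sqrt y + \<epsilon>) / c0 \<le> 3 * (Cp * (lam * t) + lam * t) / c0"
        using c0 by (intro divide_right_mono mult_left_mono) auto
      then show ?thesis by (simp add: b_def B_def algebra_simps)
    qed
    have b_M: "b \<le> B * M * t"
    proof -
      have "B * (lam * t) \<le> B * (M * t)" using B lam t by (intro mult_left_mono mult_right_mono) auto
      then show ?thesis using b_t by (simp add: mult.assoc)
    qed
    have b1: "b \<le> 1" using b_M times_t[OF R(3)] by linarith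
    have b\<tau>: "b \<le> \<tau>"
    proof -
      have "B * M / \<tau> * t \<le> 1" by (rule times_t[OF R(4)])
      then have "B * M * t \<le> \<tau>" using \<tau> by (simp add: field_simps)
      then show ?thesis using b_M by linarith
    qed
    have y1: "y \<le> 1"
    proof -
      have "lam * t \<le> M * t" using lam t by (intro mult_right_mono) auto
      then have "sqrt y \<le> 1" using sqrt_y times_t[OF R(2)] by linarith
      then show ?thesis by simp
    qed
    define e where "e = (2 * \<tau> + 1) * (1 + M) * b"
    have e_t: "e \<le> H * (lam * t)"
    proof -
      have "e \<le> (2 * \<tau> + 1) * (1 + M) * (B * (lam * t))"
        unfolding e_def using b_t \<tau> \<open>0 < M\<close> by (intro mult_left_mono) auto
      then show ?thesis by (simp add: H_def mult.assoc)
    qed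
    have e0: "0 \<le> e" using b0 \<tau> \<open>0 < M\<close> by (simp add: e_def)
    have e_gap: "2 * e \<le> \<tau>\<^sup>2 * lam"
    proof -
      have "2 * H / \<tau>\<^sup>2 * t \<le> 1" by (rule times_t[OF R(5)])
      then have "2 * H * t \<le> \<tau>\<^sup>2" using \<tau> by (simp add: field_simps)
      then have "2 * H * t * lam \<le> \<tau>\<^sup>2 * lam" using lam by (intro mult_right_mono) auto
      then show ?thesis using e_t by (simp add: mult_ac)
    qed
    have "with_prob_at_least (iid_sample n (contaminated p \<epsilon> (spiked_cov p r V L) Q)) (1 - 2 * \<delta>)
      (\<lambda>X. \<forall>\<Gamma>. is_arg_max (\<lambda>\<Gamma>. matrix_depth p n (sparse_directions p s) \<Gamma> X) (\<lambda>\<Gamma>. \<Gamma> \<in> sparse_covs p s) \<Gamma> \<longrightarrow>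
        (\<forall>v\<in>carrier_vec p. \<bar>qform \<Gamma> v - \<tau>\<^sup>2 * qform (spiked_cov p r V L) v\<bar>
           \<le> (2 * \<tau> + 1) * (1 + M) * b * (v \<bullet> v)))"
      by (rule depth_estimate[OF \<open>0 < M\<close> \<tau> c0 median slope(1)[OF b0 b1 b\<tau>] slope(2)[OF b0 b1 b\<tau>]
            size(1,3,5) \<epsilon>(1) _ \<delta>(1) _ V L0 Q y_def y1 b_def[unfolded Cp_def] b1 b\<tau>])
         (use \<epsilon> \<delta> in auto)
    note this[unfolded with_prob_at_least_def, folded e_def]
    then obtain A where A: "A \<in> sets (iid_sample n (contaminated p \<epsilon> (spiked_cov p r V L) Q))"
      "1 - 2 * \<delta> \<le> measure (iid_sample n (contaminated p \<epsilon> (spiked_cov p r V L) Q)) A"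
      and close_all: "\<forall>X\<in>A. \<forall>\<Gamma>.
        is_arg_max (\<lambda>\<Gamma>. matrix_depth p n (sparse_directions p s) \<Gamma> X) (\<lambda>\<Gamma>. \<Gamma> \<in> sparse_covs p s) \<Gamma> \<longrightarrow>
        (\<forall>v\<in>carrier_vec p. \<bar>qform \<Gamma> v - \<tau>\<^sup>2 * qform (spiked_cov p r V L) v\<bar> \<le> e * (v \<bullet> v))"
      by (elim bexE conjE) (rule that)
    have close: "\<bar>qform \<Gamma> v - \<tau>\<^sup>2 * qform (spiked_cov p r V L) v\<bar> \<le> e * (v \<bullet> v)"
      if "X \<in> A" "is_arg_max (\<lambda>\<Gamma>. matrix_depth p n (sparse_directions p s) \<Gamma> X) (\<lambda>\<Gamma>. \<Gamma> \<in> sparse_covs p s) \<Gamma>"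
        "v \<in> carrier_vec p" for X \<Gamma> v
      using close_all that by blast
    have "(frob_norm (Vhat X * transpose_mat (Vhat X) - V * transpose_mat V))\<^sup>2 \<le> C * \<rho>" if X: "X \<in> A" for X
    proof -
      have "X \<in> space (iid_sample n (Rspace p))"
        using sets.sets_into_space[OF A(1)] X unfolding space_iid_sample_contaminated by auto
      from est[OF this] have max: "is_arg_max (\<lambda>\<Gamma>. matrix_depth p n (sparse_directions p s) \<Gamma> X)
           (\<lambda>\<Gamma>. \<Gamma> \<in> sparse_covs p s) (\<Gamma>hat X)" and lead: "leading_eigenvectors p r (\<Gamma>hat X) (Vhat X)"
        by auto
      have \<Gamma>: "\<Gamma>hat X \<in> carrier_mat p p" "transpose_mat (\<Gamma>hat X) = \<Gamma>hat X"
        using max by (auto simp: is_arg_max_def sparse_covs_def psd_def)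
      have "(frob_norm (Vhat X * transpose_mat (Vhat X) - V * transpose_mat V))\<^sup>2
          \<le> 8 * real r * (e / (\<tau>\<^sup>2 * lam))\<^sup>2"
        using close[OF X max] L \<tau> lam e_gap by (intro davis_kahan[where L=L, OF V(1) \<Gamma> lead size(4)]) auto
      also have "\<dots> \<le> 8 * C2 * (H / \<tau>\<^sup>2 * t)\<^sup>2"
      proof (intro mult_mono power_mono)
        have "e / (\<tau>\<^sup>2 * lam) \<le> H * (lam * t) / (\<tau>\<^sup>2 * lam)"
          using e_t \<tau> lam by (intro divide_right_mono) auto
        then show "e / (\<tau>\<^sup>2 * lam) \<le> H / \<tau>\<^sup>2 * t" using lam by simp
      qed (use size e0 lam \<open>0 < C2\<close> in auto)
      also have "\<dots> = C * \<rho>" unfolding C_def power_mult_distrib t(2) by (simp add: mult.assoc)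
      finally show ?thesis .
    qed
    then show ?thesis unfolding with_prob_at_least_def \<rho>_def using A by blast
  qed
  have C: "0 < C" using H \<tau> \<open>0 < C2\<close> by (simp add: C_def)
  have R2: "0 < R\<^sup>2" using R(1) by simp
  show ?thesis
    by (intro exI[of _ C] exI[of _ "R\<^sup>2"] conjI allI impI, rule C, rule R2)
       (elim conjE, rule main; (assumption | (erule bspec, assumption)))
qed

end
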